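(* Let $\Lambda\subseteq\mathbb{Z}_{\ge0}^k$ be a non-exceptional Young diagram of dimension $k$, let $B=\{b_\mu\in\mathbb{K}\mid\mu\in\mathrm{corn}(\Lambda)\}$ be a set of constants at least one of which is non-zero, and let $X$ be the projective hypersurface admitting an induced additive action that corresponds to the $H$-pair $(A_{\Lambda,B},U_{\Lambda,B})$ associated with $(\Lambda,B)$. Let $d$ be the degree of $X$. Suppose there exists $1\le i\le k$ such that (i) $\mu_i\ge3$ for any $\mu\in\mathrm{corn}(\Lambda)$ with $|\mu|=d$; (ii) $\mu_i\ge1$ for any $\mu\in\mathrm{corn}(\Lambda)$ with $|\mu|=d-1$. Then $X$ is non-normal.
   Context: The base field $\mathbb{K}$ is algebraically closed of characteristic zero. Let $k\in\mathbb{Z}_{>0}$; $e_1,\ldots,e_k$ is the standard basis of $\mathbb{Z}^k$. On $\mathbb{Z}_{\ge0}^k$ consider the product order: $\lambda\preccurlyeq\mu$ means $\lambda_i\le\mu_i$ for all $i$. A Young diagram of dimension $k$ is a finite subset $\Lambda\subseteq\mathbb{Z}_{\ge0}^k$ such that $\mu\in\Lambda$, $\lambda\in\mathbb{Z}_{\ge 0}^k$ and $\lambda\preccurlyeq\mu$ imply $\lambda\in\Lambda$; it is assumed that for any $i$ there is $\lambda\in\Lambda$ with $\lambda_i\ne0$. A corner cell is a maximal element of $\Lambda$; the set of corner cells is $\mathrm{corn}(\Lambda)$. $\Lambda$ is exceptional with respect to the $i$-th coordinate if every $\lambda\in\Lambda$ satisfies $\lambda_i=0$ or $\lambda=e_i$,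 and non-exceptional if this holds for no $i$. Write $|\lambda|=\lambda_1+\ldots+\lambda_k$ and $x^\lambda=x_1^{\lambda_1}\cdots x_k^{\lambda_k}$. The algebra $A_{\Lambda,B}$ is the quotient of $\mathbb{K}[x_1,\ldots,x_k]$ by the relations $x^\lambda=0$ for $\lambda\in\mathbb{Z}_{\ge0}^k\setminus\Lambda$ and $b_\nu x^\mu=b_\mu x^\nu$ for $\mu,\nu\in\mathrm{corn}(\Lambda)$. $U_{\Lambda,B}$ is the linear span of $x^\lambda$, $\lambda\in\Lambda\setminus(\mathrm{corn}(\Lambda)\cup\{0\})$. An $H$-pair is a pair $(A,U)$ with $A$ a local finite-dimensional commutative associative unital algebra with maximal ideal $\mathfrak{m}$ and $U\subseteq\mathfrak{m}$ a hyperplane generating $A$ as a unital algebra; $(A_{\Lambda,B},U_{\Lambda,B})$ is an $H$-pair. The hypersurface corresponding to an $H$-pair $(A,U)$ with $\dim A=n+1$ is $X=p(\overline{\mathbb{K}^\times\exp U})\subseteq\mathbb{P}(A)\cong\mathbb{P}^n$, $p\colon A\setminus\{0\}\to\mathbb{P}(A)$ being the canonical projection; it carries the induced additive action of $\exp U\cong\mathbb{G}_a^{n-1}$ by multiplication (an effective action with an open orbit, extending to $\mathbb{P}(A)$). It is known that $X$ is irreducible, its degree $d$ is the greatest integer with $\mathfrak{m}^d\nsubseteq U$, and its equation is $z_0^d\pi(\ln(1+z/z_0))=0$ for $z_0+z\in\mathbb{K}\oplus\mathfrak{m}=A$, where $\pi\colon\mathfrak{m}\to\mathfrak{m}/U\cong\mathbb{K}$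 is the projection. *)

theory Defs
  imports
    "HOL-Library.Poly_Mapping"
    "HOL-Library.Function_Algebras"
    "HOL-Algebra.Algebra"
    "HOL-Algebra.Algebraic_Closure_Type"
begin

section \<open>Young diagrams\<close>

text \<open>The coordinates are indexed by a finite type \<open>'k\<close>; an element of \<open>'k \<Rightarrow>\<^sub>0 nat\<close> is both a cell
  and the exponent of a monomial. The order that \<open>Poly_Mapping\<close> puts on \<open>'k \<Rightarrow>\<^sub>0 nat\<close> is
  lexicographic, hence a separate product order.\<close>

definition cell_le :: "('k \<Rightarrow>\<^sub>0 nat) \<Rightarrow> ('k \<Rightarrow>\<^sub>0 nat) \<Rightarrow> bool" (infix \<open>\<preceq>\<close> 50)
  where "\<kappa> \<preceq> \<mu> \<longleftrightarrow> (\<forall>i. Poly_Mapping.lookup \<kappa> i \<le> Poly_Mapping.lookup \<mu> i)"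

definition cell_size :: "('k::finite \<Rightarrow>\<^sub>0 nat) \<Rightarrow> nat"
  where "cell_size \<kappa> = (\<Sum>i\<in>UNIV. Poly_Mapping.lookup \<kappa> i)"

definition young_diagram :: "('k::finite \<Rightarrow>\<^sub>0 nat) set \<Rightarrow> bool"
  where "young_diagram \<Lambda> \<longleftrightarrow> finite \<Lambda> \<and> (\<forall>\<mu>\<in>\<Lambda>. \<forall>\<kappa>. \<kappa> \<preceq> \<mu> \<longrightarrow> \<kappa> \<in> \<Lambda>) \<and>
    (\<forall>i. \<exists>\<kappa>\<in>\<Lambda>. Poly_Mapping.lookup \<kappa> i \<noteq> 0)"

definition corner_cells :: "('k \<Rightarrow>\<^sub>0 nat) set \<Rightarrow> ('k \<Rightarrow>\<^sub>0 nat) set"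
  where "corner_cells \<Lambda> = {\<mu> \<in> \<Lambda>. \<forall>\<kappa>\<in>\<Lambda>. \<mu> \<preceq> \<kappa> \<longrightarrow> \<kappa> = \<mu>}"

definition exceptional_wrt :: "('k \<Rightarrow>\<^sub>0 nat) set \<Rightarrow> 'k \<Rightarrow> bool"
  where "exceptional_wrt \<Lambda> i \<longleftrightarrow> (\<forall>\<kappa>\<in>\<Lambda>. Poly_Mapping.lookup \<kappa> i = 0 \<or> \<kappa> = Poly_Mapping.single i 1)"

definition non_exceptional :: "('k \<Rightarrow>\<^sub>0 nat) set \<Rightarrow> bool"
  where "non_exceptional \<Lambda> \<longleftrightarrow> (\<nexists>i. exceptional_wrt \<Lambda> i)"


section \<open>The algebra and the hyperplane of a Young diagram\<close>

text \<open>\<open>Poly_Mapping.single \<kappa> c\<close> is the term \<open>c x\<^sup>\<kappa>\<close> of the polynomial ring \<open>('k \<Rightarrow>\<^sub>0 nat) \<Rightarrow>\<^sub>0 'a\<close>.\<close>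

abbreviation poly_ring :: "(('k \<Rightarrow>\<^sub>0 nat) \<Rightarrow>\<^sub>0 'a::field) ring"
  where "poly_ring \<equiv> ring_of_type_algebra"

definition diagram_ideal ::
    "('k \<Rightarrow>\<^sub>0 nat) set \<Rightarrow> (('k \<Rightarrow>\<^sub>0 nat) \<Rightarrow> 'a::field) \<Rightarrow> (('k \<Rightarrow>\<^sub>0 nat) \<Rightarrow>\<^sub>0 'a) set"
  where "diagram_ideal \<Lambda> b = Idl\<^bsub>poly_ring\<^esub>
    ({Poly_Mapping.single \<kappa> 1 |\<kappa>. \<kappa> \<notin> \<Lambda>} \<union>
     {Poly_Mapping.single \<mu> (b \<nu>) - Poly_Mapping.single \<nu> (b \<mu>) |\<mu> \<nu>.
        \<mu> \<in> corner_cells \<Lambda> \<and> \<nu> \<in> corner_cells \<Lambda>})"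

definition diagram_class ::
    "('k \<Rightarrow>\<^sub>0 nat) set \<Rightarrow> (('k \<Rightarrow>\<^sub>0 nat) \<Rightarrow> 'a::field) \<Rightarrow> (('k \<Rightarrow>\<^sub>0 nat) \<Rightarrow>\<^sub>0 'a) \<Rightarrow>
      (('k \<Rightarrow>\<^sub>0 nat) \<Rightarrow>\<^sub>0 'a) set"
  where "diagram_class \<Lambda> b f = diagram_ideal \<Lambda> b +>\<^bsub>poly_ring\<^esub> f"

text \<open>The quotient ring, with scalars acting through the constant polynomials.\<close>

definition diagram_algebra ::
    "('k \<Rightarrow>\<^sub>0 nat) set \<Rightarrow> (('k \<Rightarrow>\<^sub>0 nat) \<Rightarrow> 'a::field) \<Rightarrow> ('a, (('k \<Rightarrow>\<^sub>0 nat) \<Rightarrow>\<^sub>0 'a) set) module"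
  where "diagram_algebra \<Lambda> b =
    (let Q = poly_ring Quot diagram_ideal \<Lambda> b in
      ring.extend Q (module.fields
        (\<lambda>c v. diagram_class \<Lambda> b (Poly_Mapping.single 0 c) \<otimes>\<^bsub>Q\<^esub> v)))"

definition linear_span :: "('a, 'v, 'x) module_scheme \<Rightarrow> 'v set \<Rightarrow> 'v set"
  where "linear_span M S = {\<Oplus>\<^bsub>M\<^esub>v\<in>F. c v \<odot>\<^bsub>M\<^esub> v |c F. finite F \<and> F \<subseteq> S}"

definition diagram_hyperplane ::
    "('k \<Rightarrow>\<^sub>0 nat) set \<Rightarrow> (('k \<Rightarrow>\<^sub>0 nat) \<Rightarrow> 'a::field) \<Rightarrow> (('k \<Rightarrow>\<^sub>0 nat) \<Rightarrow>\<^sub>0 'a) set set"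
  where "diagram_hyperplane \<Lambda> b = linear_span (diagram_algebra \<Lambda> b)
    {diagram_class \<Lambda> b (Poly_Mapping.single \<kappa> 1) |\<kappa>. \<kappa> \<in> \<Lambda> - (corner_cells \<Lambda> \<union> {0})}"


section \<open>Polynomial functions and the Zariski closure\<close>

text \<open>Coordinate-free polynomials on a finite-dimensional space: the ground field being infinite, these
  are the same as polynomial functions. Only the values on the carrier matter.\<close>

definition linear_form :: "('a::field, 'v, 'x) module_scheme \<Rightarrow> ('v \<Rightarrow> 'a) \<Rightarrow> bool"
  where "linear_form M l \<longleftrightarrow>
    (\<forall>v\<in>carrier M. \<forall>w\<in>carrier M. l (v \<oplus>\<^bsub>M\<^esub> w) = l v + l w) \<and>
    (\<forall>c. \<forall>v\<in>carrier M. l (c \<odot>\<^bsub>M\<^esub> v) = c * l v)"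

inductive polynomial_fun :: "('a::field, 'v, 'x) module_scheme \<Rightarrow> ('v \<Rightarrow> 'a) \<Rightarrow> bool" for M
  where
    const: "polynomial_fun M (\<lambda>_. c)"
  | linear: "linear_form M l \<Longrightarrow> polynomial_fun M l"
  | add: "polynomial_fun M f \<Longrightarrow> polynomial_fun M g \<Longrightarrow> polynomial_fun M (\<lambda>v. f v + g v)"
  | mult: "polynomial_fun M f \<Longrightarrow> polynomial_fun M g \<Longrightarrow> polynomial_fun M (\<lambda>v. f v * g v)"

inductive homogeneous_fun :: "('a::field, 'v, 'x) module_scheme \<Rightarrow> nat \<Rightarrow> ('v \<Rightarrow> 'a) \<Rightarrow> bool" for M
  where
    const: "homogeneous_fun M 0 (\<lambda>_. c)"
  | zero: "homogeneous_fun M m (\<lambda>_. 0)"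
  | add: "homogeneous_fun M m f \<Longrightarrow> homogeneous_fun M m g \<Longrightarrow> homogeneous_fun M m (\<lambda>v. f v + g v)"
  | mult: "linear_form M l \<Longrightarrow> homogeneous_fun M m f \<Longrightarrow> homogeneous_fun M (Suc m) (\<lambda>v. l v * f v)"

definition zariski_closure :: "('a::field, 'v, 'x) module_scheme \<Rightarrow> 'v set \<Rightarrow> 'v set"
  where "zariski_closure M S =
    {v \<in> carrier M. \<forall>f. polynomial_fun M f \<longrightarrow> (\<forall>s\<in>S. f s = 0) \<longrightarrow> f v = 0}"


section \<open>The hypersurface of an H-pair\<close>

text \<open>The exponential series, summed over its non-zero terms, which are finitely many if \<open>u\<close> is
  nilpotent.\<close>

definition algebra_exp :: "('a::field_char_0, 'v, 'x) module_scheme \<Rightarrow> 'v \<Rightarrow> 'v"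
  where "algebra_exp A u =
    (\<Oplus>\<^bsub>A\<^esub>m\<in>{m::nat. u [^]\<^bsub>A\<^esub> m \<noteq> \<zero>\<^bsub>A\<^esub>}. inverse (fact m) \<odot>\<^bsub>A\<^esub> (u [^]\<^bsub>A\<^esub> m))"

text \<open>The points of the projective space are the lines through the origin, the origin included.\<close>

definition proj_point :: "('a, 'v, 'x) module_scheme \<Rightarrow> 'v \<Rightarrow> 'v set"
  where "proj_point V v = {c \<odot>\<^bsub>V\<^esub> v |c. True}"

definition hpair_hypersurface ::
    "('a::field_char_0, 'v, 'x) module_scheme \<Rightarrow> 'v set \<Rightarrow> 'v set set"
  where "hpair_hypersurface A U = proj_point A `
    (zariski_closure A {c \<odot>\<^bsub>A\<^esub> algebra_exp A u |c u. c \<noteq> 0 \<and> u \<in> U} - {\<zero>\<^bsub>A\<^esub>})"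

text \<open>The degree of a hypersurface is the degree of a homogeneous polynomial generating its
  vanishing ideal.\<close>

definition hypersurface_degree :: "('a::field, 'v, 'x) module_scheme \<Rightarrow> 'v set set \<Rightarrow> nat"
  where "hypersurface_degree V Y = (THE d. \<exists>F. homogeneous_fun V d F \<and>
    (\<exists>v\<in>carrier V. F v \<noteq> 0) \<and>
    (\<forall>G. polynomial_fun V G \<longrightarrow>
      ((\<forall>P\<in>Y. \<forall>v\<in>P. G v = 0) \<longleftrightarrow>
       (\<exists>H. polynomial_fun V H \<and> (\<forall>v\<in>carrier V. G v = F v * H v)))))"


section \<open>Normality of projective varieties\<close>

text \<open>Throughout, \<open>Y\<close> is meant to be an irreducible Zariski closed set of points of the projective
  space of \<open>V\<close>.\<close>

definition proj_open :: "('a::field, 'v, 'x) module_scheme \<Rightarrow> 'v set set \<Rightarrow> 'v set set \<Rightarrow> bool"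
  where "proj_open V Y W \<longleftrightarrow> (\<exists>T. (\<forall>f\<in>T. \<exists>m. homogeneous_fun V m f) \<and>
    W = {P \<in> Y. \<exists>f\<in>T. \<exists>v\<in>P. f v \<noteq> 0})"

definition regular_on ::
    "('a::field, 'v, 'x) module_scheme \<Rightarrow> 'v set set \<Rightarrow> 'v set set \<Rightarrow> ('v set \<Rightarrow> 'a) \<Rightarrow> bool"
  where "regular_on V Y W \<phi> \<longleftrightarrow> (\<forall>P\<in>W. \<exists>W'. proj_open V Y W' \<and> P \<in> W' \<and> W' \<subseteq> W \<and>
    (\<exists>m f g. homogeneous_fun V m f \<and> homogeneous_fun V m g \<and>
      (\<forall>Q\<in>W'. \<forall>v\<in>Q - {\<zero>\<^bsub>V\<^esub>}. g v \<noteq> 0 \<and> \<phi> Q = f v / g v)))"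

text \<open>The function field consists of the functions regular on some non-empty open subset, modulo those
  vanishing on some non-empty open subset. The local ring at \<open>P\<close> is taken as a subring of the function
  field; for irreducible \<open>Y\<close> it is isomorphic to the ring of germs at \<open>P\<close>, and the function field is
  its field of fractions.\<close>

definition rational_functions :: "('a::field, 'v, 'x) module_scheme \<Rightarrow> 'v set set \<Rightarrow> ('v set \<Rightarrow> 'a) ring"
  where "rational_functions V Y = ring_of_type_algebra
    \<lparr>carrier := {\<phi>. \<exists>W. proj_open V Y W \<and> W \<noteq> {} \<and> regular_on V Y W \<phi>}\<rparr>"

definition generically_zero :: "('a::field, 'v, 'x) module_scheme \<Rightarrow> 'v set set \<Rightarrow> ('v set \<Rightarrow> 'a) set"
  where "generically_zero V Y = {\<phi>. \<exists>W. proj_open V Y W \<and> W \<noteq> {} \<and> (\<forall>P\<in>W. \<phi> P = 0)}"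

definition function_field :: "('a::field, 'v, 'x) module_scheme \<Rightarrow> 'v set set \<Rightarrow> ('v set \<Rightarrow> 'a) set ring"
  where "function_field V Y = rational_functions V Y Quot generically_zero V Y"

definition local_ring_at ::
    "('a::field, 'v, 'x) module_scheme \<Rightarrow> 'v set set \<Rightarrow> 'v set \<Rightarrow> ('v set \<Rightarrow> 'a) set set"
  where "local_ring_at V Y P =
    {generically_zero V Y +>\<^bsub>rational_functions V Y\<^esub> \<phi> |\<phi>.
       \<exists>W. proj_open V Y W \<and> P \<in> W \<and> regular_on V Y W \<phi>}"

definition integral_over :: "('r, 'x) ring_scheme \<Rightarrow> 'r set \<Rightarrow> 'r \<Rightarrow> bool"
  where "integral_over R S x \<longleftrightarrow>
    (\<exists>p\<in>carrier (univ_poly R S). p \<noteq> [] \<and> hd p = \<one>\<^bsub>R\<^esub> \<and> ring.eval R p x = \<zero>\<^bsub>R\<^esub>)"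

definition normal_variety :: "('a::field, 'v, 'x) module_scheme \<Rightarrow> 'v set set \<Rightarrow> bool"
  where "normal_variety V Y \<longleftrightarrow> (\<forall>P\<in>Y. \<forall>h\<in>carrier (function_field V Y).
    integral_over (function_field V Y) (local_ring_at V Y P) h \<longrightarrow> h \<in> local_ring_at V Y P)"

end

theory Submission
  imports Defs
begin

text \<open>In degree \<open>\<le> N\<close> the truncated exponential and logarithm are mutually inverse, so the cone over \<open>X\<close>
  is the zero set of \<open>F = z\<^sub>0\<^sup>d \<pi>(ln (1 + z / z\<^sub>0))\<close>. Since \<open>F\<close> is linear in the socle direction with
  leading coefficient a power of \<open>z\<^sub>0\<close>, and does not vanish on \<open>z\<^sub>0 = 0\<close>, pseudo-division shows that
  \<open>F\<close> generates the vanishing ideal and that this ideal is prime. Hence \<open>d\<close> is the largest size of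
  a corner cell \<open>\<mu>\<close> with \<open>b\<^sub>\<mu> \<noteq> 0\<close>. Modulo \<open>z\<^sub>0\<^sup>2\<close> only \<open>\<pi>(z\<^sup>d)\<close> and \<open>z\<^sub>0 \<pi>(z\<^sup>d\<^sup>-\<^sup>1)\<close> matter, and conditions
  (i) and (ii) make them divisible by \<open>z\<^sub>i\<^sup>2\<close> and \<open>z\<^sub>0 z\<^sub>i\<close>, so
  \<open>F = a z\<^sub>0\<^sup>2 + b z\<^sub>0 z\<^sub>i + c z\<^sub>i\<^sup>2\<close>. On \<open>X\<close> the function \<open>h = c z\<^sub>i / z\<^sub>0\<close> satisfies
  \<open>h\<^sup>2 + b h + a c = 0\<close>, but it is not regular at the socle point, which lies on \<open>z\<^sub>0 = z\<^sub>i = 0\<close>.\<close>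

section \<open>Truncated exponential and logarithm\<close>

text \<open>The degree is defined by a generator of the vanishing ideal, and the function field
  needs that ideal to be prime, so the ideal of F has to be determined. This requires no
  factorization theory. Where \<open>z0\<close> is non-zero, translation by a multiple of
  \<open>s\<close> carries every point onto the cone, so questions on the cone become questions on
  the whole space, where polynomial functions form a domain: restrict to a line and count roots. It
  then remains to cancel powers of \<open>z0\<close>, which is possible because F is not identically
  zero on \<open>z0 = 0\<close>. Why h is not regular at the socle point: if h were f / g there,
  cross-multiplying and removing the domain of validity by primality would make c z_i g - z_0 f a
  multiple F H. On \<open>z0 = 0\<close> the function F is c z_i^2, which is not identically zero,
  so cancelling c z_i leaves g = z_i H. Hence g would vanish at the socle point, where z_i = 0.
  Since h has degree d - 2, it is not yet a function on points. The proof divides it by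
  \<open>p ^ (d - 2)\<close>, which is non-zero at the socle point, and rescales f / g and the
  quadratic equation accordingly.\<close>

lemma monom_1_dvd_poly_Suc:
  fixes p :: "'a::field_char_0 poly"
  assumes "coeff p 0 = 0" and "monom 1 n dvd pderiv p"
  shows "monom 1 (Suc n) dvd p"
proof -
  have "coeff p j = 0" if "j < Suc n" for j
  proof (cases j)
    case (Suc i)
    then have "coeff (pderiv p) i = 0"
      using assms(2) that by (simp add: monom_1_dvd_iff')
    then show ?thesis
      using Suc by (simp add: coeff_pderiv del: of_nat_Suc)
  qed (use assms in simp)
  then show ?thesis
    by (simp add: monom_1_dvd_iff')
qed

definition exp_poly :: "nat \<Rightarrow> 'a::field_char_0 poly"
  where "exp_poly n = (\<Sum>m\<le>n. monom (inverse (fact m)) m)"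

text \<open>The truncation of ln (1 + x), not of ln x; this is why it is composed with
  \<open>exp_poly n - 1\<close> below.\<close>

definition ln_poly :: "nat \<Rightarrow> 'a::field_char_0 poly"
  where "ln_poly n = (\<Sum>m<n. monom ((-1) ^ m / of_nat (Suc m)) (Suc m))"

lemma coeff_exp_poly: "coeff (exp_poly n) j = (if j \<le> n then inverse (fact j) else 0)"
  by (simp add: exp_poly_def coeff_sum sum.delta)

lemma coeff_ln_poly:
  "coeff (ln_poly n) j = (if 0 < j \<and> j \<le> n then (-1) ^ (j - 1) / of_nat j else 0)"
proof (cases j)
  case (Suc i)
  then show ?thesis
    by (simp add: ln_poly_def coeff_sum sum.delta less_Suc_eq_le Suc_le_eq del: of_nat_Suc)
qed (simp add: ln_poly_def coeff_sum)

lemma pderiv_exp_poly: "pderiv (exp_poly n) = exp_poly n - monom (inverse (fact n)) n"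
  by (rule poly_eqI) (auto simp: coeff_pderiv coeff_exp_poly simp del: of_nat_Suc)

text \<open>The derivative is a partial geometric sum in -x, so multiplication by 1 + x
  telescopes.\<close>

lemma pderiv_ln_poly:
  fixes n defines "p \<equiv> (ln_poly n :: 'a::field_char_0 poly)"
  shows "[:1, 1:] * pderiv p = 1 - monom ((-1) ^ n) n"
proof (rule poly_eqI)
  have c: "coeff (pderiv p) j = (if j < n then (-1) ^ j else 0)" for j
    by (auto simp: p_def coeff_pderiv coeff_ln_poly simp del: of_nat_Suc)
  show "coeff ([:1, 1:] * pderiv p) j = coeff (1 - monom ((-1) ^ n) n) j" for j
    by (cases j) (auto simp: c coeff_pCons le_less)
qed


lemma monom_dvd_pcompose_monom:
  fixes p :: "'a::field poly"
  assumes "coeff p 0 = 0"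
  shows "monom 1 n dvd pcompose (monom c n) p"
proof -
  have "monom 1 (Suc 0) dvd p"
    using assms by (simp add: monom_1_dvd_iff')
  then obtain r where r: "p = monom 1 (Suc 0) * r" ..
  have "pcompose (monom c n) p = smult c (p ^ n)"
    by (induct n) (simp_all add: monom_0 monom_Suc pcompose_pCons)
  also have "p ^ n = monom 1 n * r ^ n"
    by (simp add: r power_mult_distrib monom_power)
  finally show ?thesis
    by (simp add: dvd_smult)
qed

lemma exp_poly_coeff_0: "coeff (exp_poly n) 0 = 1"
  by (simp add: coeff_exp_poly)

text \<open>Substituting exp - 1 into the identity for (1 + x) ln'(1 + x) shows that the composition
  has derivative 1 up to terms divisible by x^n. Integrating this congruence, which characteristic
  zero permits, gains one order.\<close>

lemma ln_poly_exp_poly: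
  "monom 1 (Suc n) dvd pcompose (ln_poly n) (exp_poly n - 1) - ([:0, 1:] :: 'a::field_char_0 poly)"
proof (rule monom_1_dvd_poly_Suc)
  let ?p = "exp_poly n :: 'a poly"
  define r where "r = pcompose (ln_poly n) (?p - 1)"
  show "coeff (pcompose (ln_poly n) (?p - 1) - [:0, 1:]) 0 = 0"
    by (simp add: exp_poly_coeff_0 poly_0_coeff_0 coeff_ln_poly)
  have "pderiv r = pcompose (pderiv (ln_poly n)) (?p - 1) * (?p - monom (inverse (fact n)) n)"
    by (simp add: r_def pderiv_pcompose pderiv_diff pderiv_exp_poly)
  moreover have "pcompose (pderiv (ln_poly n)) (?p - 1) * ?p =
      1 - pcompose (monom ((-1) ^ n) n) (?p - 1)"
  proof -
    have "pcompose [:1, 1:] (?p - 1) = ?p"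
      by (simp add: pcompose_pCons one_pCons)
    then show ?thesis
      using arg_cong[OF pderiv_ln_poly[of n], of "\<lambda>x. pcompose x (?p - 1)"]
      by (simp only: pcompose_mult pcompose_diff pcompose_1 mult.commute)
  qed
  ultimately have "pderiv r - 1 = - pcompose (monom ((-1) ^ n) n) (?p - 1)
      - pcompose (pderiv (ln_poly n)) (?p - 1) * monom (inverse (fact n)) n"
    by (simp add: right_diff_distrib)
  moreover have "monom 1 n dvd pcompose (monom ((-1) ^ n) n) (?p - 1)"
    by (rule monom_dvd_pcompose_monom) (simp add: exp_poly_coeff_0)
  moreover have "monom 1 n dvd pcompose (pderiv (ln_poly n)) (?p - 1) * monom (inverse (fact n)) n"
    by (intro dvd_mult) (simp add: monom_1_dvd_iff')
  ultimately have "monom 1 n dvd pderiv r - 1"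
    by simp
  then show "monom 1 n dvd pderiv (pcompose (ln_poly n) (?p - 1) - [:0, 1:])"
    by (simp add: r_def pderiv_diff pderiv_pCons one_pCons)
qed

text \<open>Again a differential equation: the composition s satisfies (1 + x) s' = s below order
  \<open>n\<close>, and this determines its coefficients up to degree \<open>n\<close> from the
  constant one.\<close>

lemma exp_poly_ln_poly:
  "monom 1 (Suc n) dvd pcompose (exp_poly n) (ln_poly n) - ([:1, 1:] :: 'a::field_char_0 poly)"
proof -
  let ?q = "ln_poly n :: 'a poly"
  define s where "s = pcompose (exp_poly n) ?q"
  have s0: "coeff s 0 = 1"
    by (simp add: s_def coeff_ln_poly poly_0_coeff_0 exp_poly_coeff_0)
  have "pderiv s = (s - pcompose (monom (inverse (fact n)) n) ?q) * pderiv ?q"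
    by (simp add: s_def pderiv_pcompose pderiv_exp_poly pcompose_diff)
  then have "[:1, 1:] * pderiv s =
      (s - pcompose (monom (inverse (fact n)) n) ?q) * ([:1, 1:] * pderiv ?q)"
    by (simp only: mult_ac)
  then have e: "[:1, 1:] * pderiv s - s = - s * monom ((-1) ^ n) n
      - pcompose (monom (inverse (fact n)) n) ?q * (1 - monom ((-1) ^ n) n)"
    by (simp only: pderiv_ln_poly) (simp add: algebra_simps)
  have "monom 1 n dvd s * monom ((-1) ^ n) n"
    by (intro dvd_mult) (simp add: monom_1_dvd_iff')
  moreover have "monom 1 n dvd pcompose (monom (inverse (fact n)) n) ?q"
    by (rule monom_dvd_pcompose_monom) (simp add: coeff_ln_poly)
  ultimately have "monom 1 n dvd [:1, 1:] * pderiv s - s"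
    unfolding e minus_mult_left[symmetric] by (intro dvd_diff dvd_mult2) simp_all
  then have "coeff ([:1, 1:] * pderiv s - s) j = 0" if "j < n" for j
    using that by (simp add: monom_1_dvd_iff')
  \<comment> \<open>At j = 0 this gives s_1 = s_0 = 1; at j = 1 the factor 1 - j makes s_2 vanish,
    and the later coefficients vanish with it.\<close>
  then have rec: "of_nat (Suc j) * coeff s (Suc j) = (1 - of_nat j) * coeff s j" if "j < n" for j
    using that
    by (cases j) (force simp: coeff_pderiv coeff_pCons algebra_simps simp del: of_nat_Suc)+
  have "coeff s j = coeff [:1, 1:] j" if "j \<le> n" for j
    using that
  proof (induct j)
    case (Suc i)
    have "coeff [:1, 1:] i = (0::'a)" if "i > 1"
      using that by (cases i) (auto simp: coeff_pCons split: nat.split)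
    then have "of_nat (Suc i) * coeff s (Suc i) = (of_nat (Suc i) * coeff [:1, 1:] (Suc i) :: 'a)"
      using rec[of i] Suc by (cases "i = 0 \<or> i = 1") (auto simp: coeff_pCons split: nat.split)
    then show ?case
      by (simp del: of_nat_Suc)
  qed (simp add: s0)
  then show ?thesis
    by (simp add: monom_1_dvd_iff' s_def less_Suc_eq_le)
qed

section \<open>Closure properties of homogeneous functions\<close>

lemma homogeneous_fun_cmult:
  "homogeneous_fun M m f \<Longrightarrow> homogeneous_fun M m (\<lambda>v. c * f v)"
proof (induct rule: homogeneous_fun.induct)
  case (const a)
  show ?case by (rule homogeneous_fun.const)
next
  case (zero m)
  show ?case using homogeneous_fun.zero by simp
next
  case (add m f g)
  then show ?case using homogeneous_fun.add[OF add(2,4)] by (simp add: distrib_left)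
next
  case (mult l m f)
  then show ?case using homogeneous_fun.mult[OF mult(1,3)] by (simp add: mult.left_commute)
qed

lemma homogeneous_fun_mult:
  assumes "homogeneous_fun M m f" and "homogeneous_fun M n g"
  shows "homogeneous_fun M (m + n) (\<lambda>v. f v * g v)"
  using assms(1)
proof (induct rule: homogeneous_fun.induct)
  case (const a)
  show ?case using homogeneous_fun_cmult[OF assms(2)] by simp
next
  case (zero m)
  show ?case using homogeneous_fun.zero by simp
next
  case (add m f h)
  then show ?case using homogeneous_fun.add[OF add(2,4)] by (simp add: distrib_right)
next
  case (mult l m f)
  then show ?case using homogeneous_fun.mult[OF mult(1,3)] by (simp add: mult.assoc)
qed

lemma homogeneous_fun_linear: "linear_form M l \<Longrightarrow> homogeneous_fun M 1 l"
  using homogeneous_fun.mult[OF _ homogeneous_fun.const, of M l 1] by simp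

lemma homogeneous_fun_power:
  "homogeneous_fun M m f \<Longrightarrow> homogeneous_fun M (n * m) (\<lambda>v. f v ^ n)"
  by (induct n) (simp_all add: homogeneous_fun.const homogeneous_fun_mult)

lemma homogeneous_fun_smult:
  assumes "homogeneous_fun M m f" and "v \<in> carrier M"
  shows "f (c \<odot>\<^bsub>M\<^esub> v) = c ^ m * f v"
  using assms(1)
proof (induct rule: homogeneous_fun.induct)
  case (mult l m f)
  then show ?case using assms(2) by (simp add: linear_form_def mult_ac)
qed (simp_all add: distrib_left)

lemma homogeneous_imp_polynomial: "homogeneous_fun M m f \<Longrightarrow> polynomial_fun M f"
  by (induct rule: homogeneous_fun.induct)
    (auto intro: polynomial_fun.const polynomial_fun.linear polynomial_fun.add polynomial_fun.mult)


section \<open>Algebras presented as quotients\<close>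

text \<open>These are the pullbacks along \<open>q\<close> of the linear forms on the quotient. The
  definition stands outside the locale because the assumption \<open>finite_basis\<close> already
  speaks of coordinates of this kind.\<close>

definition quot_linear :: "('r::comm_ring_1 \<Rightarrow> 'v) \<Rightarrow> ('a::field_char_0 \<Rightarrow> 'r) \<Rightarrow> ('r \<Rightarrow> 'a) \<Rightarrow> bool"
  where "quot_linear q k L \<longleftrightarrow> (\<forall>a b. L (a + b) = L a + L b) \<and> (\<forall>c a. L (k c * a) = c * L a) \<and>
    (\<forall>a b. q a = q b \<longrightarrow> L a = L b)"

text \<open>Functions on \<open>V\<close> are studied through their pullbacks to \<open>'r\<close>, where the ring operations are
  total.\<close>

locale presented_algebra =
  fixes V :: "('a::field_char_0, 'v, 'x) module_scheme"
    and q :: "'r::comm_ring_1 \<Rightarrow> 'v"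
    and k :: "'a \<Rightarrow> 'r"
  assumes cring: "cring V"
    and carrier_eq: "carrier V = range q"
    and q_add: "q (a + b) = q a \<oplus>\<^bsub>V\<^esub> q b"
    and q_mult: "q (a * b) = q a \<otimes>\<^bsub>V\<^esub> q b"
    and q_zero: "q 0 = \<zero>\<^bsub>V\<^esub>"
    and q_one: "q 1 = \<one>\<^bsub>V\<^esub>"
    and q_smult: "q (k c * a) = c \<odot>\<^bsub>V\<^esub> q a"
    and k_add: "k (c + c') = k c + k c'"
    and k_mult: "k (c * c') = k c * k c'"
    and k_one: "k 1 = 1"
    and finite_basis: "\<exists>B coord. finite B \<and> (\<forall>\<beta>\<in>B. quot_linear q k (coord \<beta>)) \<and>
      (\<forall>a. q a = q (\<Sum>\<beta>\<in>B. k (coord \<beta> a) * \<beta>))"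
begin

sublocale V: cring V by (rule cring)

section \<open>Calculus of linear, polynomial and homogeneous functions pulled back along
  \<open>q\<close>\<close>

abbreviation "qlin \<equiv> quot_linear q k"

definition qpol :: "('r \<Rightarrow> 'a) \<Rightarrow> bool"
  where "qpol F \<longleftrightarrow> (\<exists>f. polynomial_fun V f \<and> F = (\<lambda>a. f (q a)))"

definition qhom :: "nat \<Rightarrow> ('r \<Rightarrow> 'a) \<Rightarrow> bool"
  where "qhom n F \<longleftrightarrow> (\<exists>f. homogeneous_fun V n f \<and> F = (\<lambda>a. f (q a)))"

lemma q_carrier [simp, intro]: "q a \<in> carrier V"
  by (simp add: carrier_eq)

lemma k_zero [simp]: "k 0 = 0"
  using k_add[of 0 0] by simp

lemma k_inverse: "c \<noteq> 0 \<Longrightarrow> k c * k (inverse c) = 1"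
  by (simp add: k_mult[symmetric] k_one)

lemma k_power: "k c ^ m = k (c ^ m)"
  by (induct m) (simp_all add: k_one k_mult)

lemma q_eq_iff: "q a = q b \<longleftrightarrow> q (a - b) = q 0"
proof
  assume "q a = q b"
  then show "q (a - b) = q 0"
    using q_add[of a "- b"] q_add[of b "- b"] by simp
next
  assume "q (a - b) = q 0"
  then show "q a = q b"
    using q_add[of "a - b" b] by (simp add: q_zero)
qed

lemma q_cong_add: "q a = q a' \<Longrightarrow> q b = q b' \<Longrightarrow> q (a + b) = q (a' + b')"
  by (simp add: q_add)

lemma q_cong_mult: "q a = q a' \<Longrightarrow> q b = q b' \<Longrightarrow> q (a * b) = q (a' * b')"
  by (simp add: q_mult)

lemma q_cong_diff: "q a = q a' \<Longrightarrow> q b = q b' \<Longrightarrow> q (a - b) = q (a' - b')"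
  using q_cong_add[of a a' "- b" "- b'"] q_cong_mult[of b b' "- 1" "- 1"] by simp

lemma q_mult_zero: "q a = q 0 \<Longrightarrow> q (a * b) = q 0"
  using q_cong_mult[of a 0 b b] by simp

lemma q_power: "q (a ^ n) = q a [^]\<^bsub>V\<^esub> n"
  by (induct n) (simp_all add: q_one q_mult V.m_comm)

lemma q_sum: "finite I \<Longrightarrow> q (sum g I) = (\<Oplus>\<^bsub>V\<^esub>j\<in>I. q (g j))"
proof (induct I rule: finite_induct)
  case (insert j I)
  have "(\<Oplus>\<^bsub>V\<^esub>i\<in>insert j I. q (g i)) = q (g j) \<oplus>\<^bsub>V\<^esub> (\<Oplus>\<^bsub>V\<^esub>i\<in>I. q (g i))"
    using insert(1,2) by (intro V.finsum_insert) auto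
  then show ?case
    using insert q_add[of "g j" "sum g I"] by simp
qed (simp add: q_zero)

lemma qlin_add: "qlin L \<Longrightarrow> L (a + b) = L a + L b"
  and qlin_smult: "qlin L \<Longrightarrow> L (k c * a) = c * L a"
  and qlin_cong: "qlin L \<Longrightarrow> q a = q b \<Longrightarrow> L a = L b"
  unfolding quot_linear_def by blast+

lemma qlin_zero: "qlin L \<Longrightarrow> L 0 = 0"
  using qlin_add[of L 0 0] by simp

lemma qlin_diff: "qlin L \<Longrightarrow> L (a - b) = L a - L b"
  using qlin_add[of L "a - b" b] by simp

lemma qlin_sum: "qlin L \<Longrightarrow> L (sum g I) = (\<Sum>j\<in>I. L (g j))"
  using qlin_zero qlin_add[of L "g j" "sum g I" for j I]
  by (induct I rule: infinite_finite_induct) fastforce+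

lemma qlin_of_nat: "qlin L \<Longrightarrow> L (of_nat m * a) = of_nat m * L a"
  by (induct m) (simp_all add: qlin_zero distrib_right, simp add: qlin_add)

lemma linear_form_pullback: "linear_form V l \<Longrightarrow> qlin (\<lambda>a. l (q a))"
  by (simp add: linear_form_def quot_linear_def q_add q_smult)

lemma qlin_imp_linear_form:
  assumes "qlin L"
  obtains l where "linear_form V l" and "L = (\<lambda>a. l (q a))"
proof
  \<comment> \<open>An arbitrary preimage may be chosen, because \<open>L\<close> is constant on the
    fibres of \<open>q\<close>.\<close>
  define l where "l v = L (inv_into UNIV q v)" for v
  have lq: "l (q a) = L a" for a
    unfolding l_def by (rule qlin_cong[OF assms]) (simp add: f_inv_into_f)
  show "L = (\<lambda>a. l (q a))"
    by (simp add: lq)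
  show "linear_form V l"
    unfolding linear_form_def carrier_eq
    by (auto simp: q_add[symmetric] q_smult[symmetric] lq qlin_add[OF assms] qlin_smult[OF assms])
qed

lemma qhom_imp_qpol: "qhom n F \<Longrightarrow> qpol F"
  by (auto simp: qhom_def qpol_def intro: homogeneous_imp_polynomial)

lemma qpol_const: "qpol (\<lambda>_. c)"
  unfolding qpol_def by (rule exI[of _ "\<lambda>_. c"]) (simp add: polynomial_fun.const)

lemma qpol_lin: "qlin L \<Longrightarrow> qpol L"
  by (metis qlin_imp_linear_form polynomial_fun.linear qpol_def)

lemma qpol_add: "qpol F \<Longrightarrow> qpol G \<Longrightarrow> qpol (\<lambda>a. F a + G a)"
  unfolding qpol_def using polynomial_fun.add by fast

lemma qpol_mult: "qpol F \<Longrightarrow> qpol G \<Longrightarrow> qpol (\<lambda>a. F a * G a)"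
  unfolding qpol_def using polynomial_fun.mult by fast

lemma qpol_diff: "qpol F \<Longrightarrow> qpol G \<Longrightarrow> qpol (\<lambda>a. F a - G a)"
  using qpol_add[of F "\<lambda>a. - 1 * G a"] qpol_mult[OF qpol_const, of G "- 1"] by simp

lemma qpol_power: "qpol F \<Longrightarrow> qpol (\<lambda>a. F a ^ n)"
  by (induct n) (simp_all add: qpol_const qpol_mult)

lemma qpol_induct [consumes 1, case_names const lin add mult]:
  assumes "qpol F"
    and "\<And>c. P (\<lambda>_. c)"
    and "\<And>L. qlin L \<Longrightarrow> P L"
    and "\<And>F G. qpol F \<Longrightarrow> qpol G \<Longrightarrow> P F \<Longrightarrow> P G \<Longrightarrow> P (\<lambda>a. F a + G a)"
    and "\<And>F G. qpol F \<Longrightarrow> qpol G \<Longrightarrow> P F \<Longrightarrow> P G \<Longrightarrow> P (\<lambda>a. F a * G a)"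
  shows "P F"
proof -
  obtain f where f: "polynomial_fun V f" "F = (\<lambda>a. f (q a))"
    using assms(1) by (auto simp: qpol_def)
  have "P (\<lambda>a. f (q a))"
    using f(1)
  proof (induct rule: polynomial_fun.induct)
    case (add f g)
    then show ?case
      using assms(4)[of "\<lambda>a. f (q a)" "\<lambda>a. g (q a)"] by (auto simp: qpol_def)
  next
    case (mult f g)
    then show ?case
      using assms(5)[of "\<lambda>a. f (q a)" "\<lambda>a. g (q a)"] by (auto simp: qpol_def)
  qed (simp_all add: assms linear_form_pullback)
  then show ?thesis
    by (simp add: f)
qed

lemma qhom_const: "qhom 0 (\<lambda>_. c)"
  unfolding qhom_def by (rule exI[of _ "\<lambda>_. c"]) (simp add: homogeneous_fun.const)

lemma qhom_zero: "qhom n (\<lambda>_. 0)"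
  unfolding qhom_def by (rule exI[of _ "\<lambda>_. 0"]) (simp add: homogeneous_fun.zero)

lemma qhom_add: "qhom n F \<Longrightarrow> qhom n G \<Longrightarrow> qhom n (\<lambda>a. F a + G a)"
  unfolding qhom_def using homogeneous_fun.add by fast

lemma qhom_mult: "qhom m F \<Longrightarrow> qhom n G \<Longrightarrow> qhom (m + n) (\<lambda>a. F a * G a)"
  unfolding qhom_def using homogeneous_fun_mult by fast

lemma qhom_cmult: "qhom n F \<Longrightarrow> qhom n (\<lambda>a. c * F a)"
  using qhom_mult[OF qhom_const] by simp

lemma qhom_lin: "qlin L \<Longrightarrow> qhom 1 L"
  by (metis qlin_imp_linear_form homogeneous_fun_linear qhom_def)

lemma qhom_lin_power: "qlin L \<Longrightarrow> qhom n (\<lambda>a. L a ^ n)"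
proof (induct n)
  case (Suc n)
  then show ?case
    using qhom_mult[OF qhom_lin[OF Suc(2)], of n] by simp
qed (simp add: qhom_const)

lemma qhom_sum: "(\<And>j. j \<in> I \<Longrightarrow> qhom n (G j)) \<Longrightarrow> qhom n (\<lambda>a. \<Sum>j\<in>I. G j a)"
  by (induct I rule: infinite_finite_induct) (simp_all add: qhom_zero qhom_add)

lemma qhom_smult: "qhom n F \<Longrightarrow> F (k c * a) = c ^ n * F a"
  by (auto simp: qhom_def q_smult homogeneous_fun_smult)

text \<open>Expand one factor \<open>T a\<close> in the finite basis: its coordinates are linear
  forms in \<open>a\<close>, and each \<open>T \<beta>\<close> is absorbed into \<open>w\<close>,
  which therefore stays arbitrary in the induction. This is the use of finite dimension.\<close>

lemma qhom_lin_of_power: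
  assumes L: "qlin L"
    and T: "\<And>a b. T (a + b) = T a + T b" "\<And>c a. T (k c * a) = k c * T a"
      "\<And>a b. q a = q b \<Longrightarrow> q (T a) = q (T b)"
  shows "qhom n (\<lambda>a. L (T a ^ n * w))"
proof (induct n arbitrary: w)
  case 0
  then show ?case by (simp add: qhom_const)
next
  case (Suc n)
  obtain B coord where B: "finite B" "\<And>\<beta>. \<beta> \<in> B \<Longrightarrow> qlin (coord \<beta>)"
    "\<And>a. q a = q (\<Sum>\<beta>\<in>B. k (coord \<beta> a) * \<beta>)"
    using finite_basis by auto
  have T0: "T 0 = 0"
    using T(1)[of 0 0] by simp
  have Tsum: "T (sum g I) = (\<Sum>j\<in>I. T (g j))" if "finite I" for g :: "'r \<Rightarrow> 'r" and I
    using that by (induct I) (simp_all add: T0 T(1))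
  have "L (T a ^ Suc n * w) = (\<Sum>\<beta>\<in>B. coord \<beta> a * L (T a ^ n * (T \<beta> * w)))" for a
  proof -
    have "q (T a) = q (\<Sum>\<beta>\<in>B. k (coord \<beta> a) * T \<beta>)"
      using T(3)[OF B(3)[of a]] by (simp add: Tsum B(1) T(2))
    then have "q (T a * (T a ^ n * w)) = q ((\<Sum>\<beta>\<in>B. k (coord \<beta> a) * T \<beta>) * (T a ^ n * w))"
      by (rule q_cong_mult) simp
    then have "L (T a ^ Suc n * w) = L ((\<Sum>\<beta>\<in>B. k (coord \<beta> a) * T \<beta>) * (T a ^ n * w))"
      unfolding power_Suc mult.assoc by (rule qlin_cong[OF L])
    also have "\<dots> = (\<Sum>\<beta>\<in>B. L (k (coord \<beta> a) * (T a ^ n * (T \<beta> * w))))"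
      unfolding sum_distrib_right qlin_sum[OF L] by (simp add: mult_ac)
    finally show ?thesis
      by (simp add: qlin_smult[OF L])
  qed
  moreover have "qhom (Suc n) (\<lambda>a. \<Sum>\<beta>\<in>B. coord \<beta> a * L (T a ^ n * (T \<beta> * w)))"
    using qhom_mult[OF qhom_lin[OF B(2)] Suc] by (intro qhom_sum) simp
  ultimately show ?case
    by simp
qed

section \<open>Polynomial functions on lines and hyperplanes: absence of zero divisors and
  division\<close>

lemma qpol_on_line:
  assumes "qpol F"
  obtains P where "\<And>t. F (v + k t * w) = poly P t"
proof -
  have "\<exists>P. \<forall>t. F (v + k t * w) = poly P t"
    using assms
  proof (induct rule: qpol_induct)
    case (const c)
    show ?case by (rule exI[of _ "[:c:]"]) simp
  next
    case (lin L)
    then show ?case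
      by (intro exI[of _ "[:L v, L w:]"]) (simp add: qlin_add[OF lin] qlin_smult[OF lin])
  next
    case (add F G)
    then show ?case by (metis poly_add)
  next
    case (mult F G)
    then show ?case by (metis poly_mult)
  qed
  with that show ?thesis by auto
qed

text \<open>The common non-vanishing point is found on the line through the two given points.\<close>

lemma qpol_common_nonzero:
  assumes "qpol F" "qpol G" and "F v \<noteq> 0" "G w \<noteq> 0"
  obtains t where "F (v + k t * (w - v)) \<noteq> 0" and "G (v + k t * (w - v)) \<noteq> 0"
proof -
  obtain P where P: "\<And>t. F (v + k t * (w - v)) = poly P t"
    using qpol_on_line[OF assms(1)] by blast
  obtain Q where Q: "\<And>t. G (v + k t * (w - v)) = poly Q t"
    using qpol_on_line[OF assms(2)] by blast
  have "P \<noteq> 0" "Q \<noteq> 0"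
    using P[of 0] Q[of 1] assms(3,4) by (auto simp: k_one)
  then have "finite {t. poly (P * Q) t = 0}"
    by (intro poly_roots_finite) simp
  then obtain t where "poly (P * Q) t \<noteq> 0"
    using infinite_UNIV_char_0 by (metis (mono_tags, lifting) Collect_mono_iff UNIV_def finite_subset mem_Collect_eq)
  with that show ?thesis
    by (auto simp: P Q)
qed

lemma qpol_mult_eq_0:
  assumes "qpol F" "qpol G" and "\<And>v. F v * G v = 0"
  shows "(\<forall>v. F v = 0) \<or> (\<forall>v. G v = 0)"
  using qpol_common_nonzero[OF assms(1,2)] assms(3) by (metis mult_eq_0_iff)

text \<open>The line through two points of a hyperplane stays inside it, so the argument for the
  whole space applies again.\<close>

lemma qpol_mult_eq_0_hyperplane:
  assumes "qpol F" "qpol G" and "qlin L" and "\<And>v. L v = 0 \<Longrightarrow> F v * G v = 0"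
  shows "(\<forall>v. L v = 0 \<longrightarrow> F v = 0) \<or> (\<forall>v. L v = 0 \<longrightarrow> G v = 0)"
proof (rule ccontr)
  assume "\<not> ?thesis"
  then obtain v w where vw: "L v = 0" "L w = 0" "F v \<noteq> 0" "G w \<noteq> 0"
    by auto
  from qpol_common_nonzero[OF assms(1,2) vw(3,4)] obtain t
    where t: "F (v + k t * (w - v)) \<noteq> 0" "G (v + k t * (w - v)) \<noteq> 0" .
  have "L (v + k t * (w - v)) = 0"
    by (simp add: qlin_add[OF assms(3)] qlin_smult[OF assms(3)] qlin_diff[OF assms(3)] vw)
  with t assms(4) show False
    by (metis mult_eq_0_iff)
qed

text \<open>Division by \<open>L\<close> with remainder. When \<open>L e = 1\<close>, the remainder
  is \<open>F\<close> composed with the projection along \<open>e\<close> onto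
  \<open>L = 0\<close>.\<close>

lemma qpol_reduce_mod_lin:
  assumes "qpol F" and L: "qlin L"
  obtains G where "qpol G" and "\<And>v. F v = F (v - k (L v) * e) + L v * G v"
proof -
  have "\<exists>G. qpol G \<and> (\<forall>v. F v = F (v - k (L v) * e) + L v * G v)"
    using assms(1)
  proof (induct rule: qpol_induct)
    case (const c)
    show ?case by (rule exI[of _ "\<lambda>_. 0"]) (simp add: qpol_const)
  next
    case (lin M)
    then show ?case
      by (intro exI[of _ "\<lambda>_. M e"]) (simp add: qpol_const qlin_diff[OF lin] qlin_smult[OF lin])
  next
    case (add F1 F2)
    then obtain G1 G2 where G: "qpol G1" "\<And>v. F1 v = F1 (v - k (L v) * e) + L v * G1 v"
      "qpol G2" "\<And>v. F2 v = F2 (v - k (L v) * e) + L v * G2 v" by auto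
    show ?case
    proof (intro exI[of _ "\<lambda>v. G1 v + G2 v"] conjI allI)
      show "F1 v + F2 v = F1 (v - k (L v) * e) + F2 (v - k (L v) * e) + L v * (G1 v + G2 v)" for v
        by (subst G(2), subst G(4)) (simp add: distrib_left)
    qed (intro qpol_add G)
  next
    case (mult F1 F2)
    then obtain G1 G2 where G: "qpol G1" "\<And>v. F1 v = F1 (v - k (L v) * e) + L v * G1 v"
      "qpol G2" "\<And>v. F2 v = F2 (v - k (L v) * e) + L v * G2 v" by auto
    show ?case
    proof (intro exI[of _ "\<lambda>v. F1 v * G2 v + F2 v * G1 v - L v * (G1 v * G2 v)"] conjI allI)
      show "qpol (\<lambda>v. F1 v * G2 v + F2 v * G1 v - L v * (G1 v * G2 v))"
        by (intro qpol_add qpol_mult qpol_diff qpol_lin[OF L] G mult(1,2))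
      fix v
      have e: "F1 (v - k (L v) * e) = F1 v - L v * G1 v" "F2 (v - k (L v) * e) = F2 v - L v * G2 v"
        using G(2)[of v] G(4)[of v] by simp_all
      show "F1 v * F2 v = F1 (v - k (L v) * e) * F2 (v - k (L v) * e) +
          L v * (F1 v * G2 v + F2 v * G1 v - L v * (G1 v * G2 v))"
        unfolding e by (simp add: algebra_simps)
    qed
  qed
  with that show ?thesis by auto
qed

lemma qpol_factor_lin:
  assumes "qpol F" and L: "qlin L" and "L e = 1" and "\<And>v. L v = 0 \<Longrightarrow> F v = 0"
  obtains G where "qpol G" and "\<And>v. F v = L v * G v"
proof -
  obtain G where G: "qpol G" "\<And>v. F v = F (v - k (L v) * e) + L v * G v"
    using qpol_reduce_mod_lin[OF assms(1) L] by blast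
  moreover have "F (v - k (L v) * e) = 0" for v
    by (rule assms(4)) (simp add: qlin_diff[OF L] qlin_smult[OF L] assms(3))
  ultimately show ?thesis
    using that by simp
qed

text \<open>Pseudo-division: \<open>x\<close> stands for \<open>F\<^sub>0 v / Z v ^ D\<close>.\<close>

lemma qpol_pseudo_division:
  assumes "qpol G" and Z: "qpol Z" and F0: "qpol F0"
  shows "\<exists>n H. qpol H \<and> (\<forall>v x. x * Z v ^ D = F0 v \<longrightarrow>
    Z v ^ n * G (v - k x * s) = Z v ^ n * G v - F0 v * H v)"
  using assms(1)
proof (induct rule: qpol_induct)
  case (const c)
  show ?case by (rule exI[of _ 0], rule exI[of _ "\<lambda>_. 0"]) (simp add: qpol_const)
next
  case (lin M)
  show ?case
  proof (intro exI[of _ D] exI[of _ "\<lambda>_. M s"] conjI allI impI)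
    show "Z v ^ D * M (v - k x * s) = Z v ^ D * M v - F0 v * M s" if "x * Z v ^ D = F0 v" for v x
      unfolding qlin_diff[OF lin] qlin_smult[OF lin] that[symmetric] by (simp add: algebra_simps)
  qed (rule qpol_const)
next
  case (add G1 G2)
  then obtain n1 H1 n2 H2 where 1: "qpol H1" "\<And>v x. x * Z v ^ D = F0 v \<Longrightarrow>
      Z v ^ n1 * G1 (v - k x * s) = Z v ^ n1 * G1 v - F0 v * H1 v"
    and 2: "qpol H2" "\<And>v x. x * Z v ^ D = F0 v \<Longrightarrow>
      Z v ^ n2 * G2 (v - k x * s) = Z v ^ n2 * G2 v - F0 v * H2 v"
    by auto
  show ?case
  proof (intro exI[of _ "n1 + n2"] exI[of _ "\<lambda>v. Z v ^ n2 * H1 v + Z v ^ n1 * H2 v"] conjI allI impI)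
    show "qpol (\<lambda>v. Z v ^ n2 * H1 v + Z v ^ n1 * H2 v)"
      by (intro qpol_add qpol_mult qpol_power Z 1 2)
    fix v x assume x: "x * Z v ^ D = F0 v"
    have "Z v ^ (n1 + n2) * (G1 (v - k x * s) + G2 (v - k x * s)) =
        Z v ^ n2 * (Z v ^ n1 * G1 (v - k x * s)) + Z v ^ n1 * (Z v ^ n2 * G2 (v - k x * s))"
      by (simp add: algebra_simps power_add)
    then show "Z v ^ (n1 + n2) * (G1 (v - k x * s) + G2 (v - k x * s)) =
        Z v ^ (n1 + n2) * (G1 v + G2 v) - F0 v * (Z v ^ n2 * H1 v + Z v ^ n1 * H2 v)"
      unfolding 1(2)[OF x] 2(2)[OF x] by (simp add: algebra_simps power_add)
  qed
next
  case (mult G1 G2)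
  then obtain n1 H1 n2 H2 where 1: "qpol H1" "\<And>v x. x * Z v ^ D = F0 v \<Longrightarrow>
      Z v ^ n1 * G1 (v - k x * s) = Z v ^ n1 * G1 v - F0 v * H1 v"
    and 2: "qpol H2" "\<And>v x. x * Z v ^ D = F0 v \<Longrightarrow>
      Z v ^ n2 * G2 (v - k x * s) = Z v ^ n2 * G2 v - F0 v * H2 v"
    by auto
  let ?H = "\<lambda>v. (Z v ^ n1 * G1 v) * H2 v + (Z v ^ n2 * G2 v) * H1 v - F0 v * (H1 v * H2 v)"
  show ?case
  proof (intro exI[of _ "n1 + n2"] exI[of _ ?H] conjI allI impI)
    show "qpol ?H"
      by (intro qpol_add qpol_mult qpol_diff qpol_power Z F0 1 2 mult)
    fix v x assume x: "x * Z v ^ D = F0 v"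
    have "Z v ^ (n1 + n2) * (G1 (v - k x * s) * G2 (v - k x * s)) =
        (Z v ^ n1 * G1 (v - k x * s)) * (Z v ^ n2 * G2 (v - k x * s))"
      by (simp add: algebra_simps power_add)
    then show "Z v ^ (n1 + n2) * (G1 (v - k x * s) * G2 (v - k x * s)) =
        Z v ^ (n1 + n2) * (G1 v * G2 v) - F0 v * ?H v"
      unfolding 1(2)[OF x] 2(2)[OF x] by (simp add: algebra_simps power_add)
  qed
qed

text \<open>One step of polarization: along the line \<open>a + t y\<close> the expression is a
  polynomial in t that vanishes identically, and its coefficient at t is \<open>Suc m\<close> times
  the claimed value. Characteristic zero allows the division.\<close>

lemma qlin_power_polarize:
  assumes L: "qlin L" and Z: "qlin Z"
    and zero: "\<And>a. Z a = 0 \<Longrightarrow> L (a ^ Suc m * w) = 0" and a: "Z a = 0" and y: "Z y = 0"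
  shows "L (a ^ m * (y * w)) = 0"
proof -
  define P where "P = (\<Sum>j\<le>Suc m. monom (of_nat (Suc m choose j) * L (y ^ j * a ^ (Suc m - j) * w)) j)"
  have "poly P t = 0" for t
  proof -
    have "Z (k t * y + a) = 0"
      by (simp add: qlin_add[OF Z] qlin_smult[OF Z] a y)
    then have "0 = L ((k t * y + a) ^ Suc m * w)"
      using zero by simp
    also have "(k t * y + a) ^ Suc m * w =
        (\<Sum>j\<le>Suc m. of_nat (Suc m choose j) * (k (t ^ j) * (y ^ j * a ^ (Suc m - j) * w)))"
      unfolding binomial_ring sum_distrib_right power_mult_distrib k_power
      by (rule sum.cong) (simp_all only: mult.assoc)
    also have "L \<dots> = poly P t"
      unfolding qlin_sum[OF L] qlin_of_nat[OF L] qlin_smult[OF L] P_def poly_sum poly_monom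
      by (rule sum.cong) (simp_all only: mult_ac)
    finally show ?thesis by simp
  qed
  then have "P = 0"
    using poly_all_0_iff_0 by blast
  moreover have "coeff P 1 = of_nat (Suc m) * L (y * a ^ m * w)"
    unfolding P_def coeff_sum coeff_monom by (simp add: sum.delta del: sum.atMost_Suc)
  ultimately show ?thesis
    by (simp add: mult_ac del: of_nat_Suc)
qed

subsection \<open>Evaluation of univariate polynomials\<close>

definition ev :: "'a poly \<Rightarrow> 'r \<Rightarrow> 'r"
  where "ev P a = poly (map_poly k P) a"

lemma ev_0 [simp]: "ev 0 a = 0"
  by (simp add: ev_def)

lemma ev_pCons: "ev (pCons c P) a = k c + a * ev P a"
  by (cases "c = 0 \<and> P = 0") (auto simp: ev_def map_poly_pCons)

lemma ev_add: "ev (P + Q) a = ev P a + ev Q a"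
proof -
  have "map_poly k (P + Q) = map_poly k P + map_poly k Q"
    by (rule poly_eqI) (simp add: coeff_map_poly k_add)
  then show ?thesis by (simp add: ev_def)
qed

lemma ev_smult: "ev (smult c P) a = k c * ev P a"
  by (induct P) (simp_all add: ev_pCons k_mult algebra_simps)

lemma ev_mult: "ev (P * Q) a = ev P a * ev Q a"
  by (induct P) (simp_all add: ev_pCons ev_add ev_smult algebra_simps)

lemma ev_pcompose: "ev (pcompose P Q) a = ev P (ev Q a)"
  by (induct P) (simp_all add: pcompose_pCons ev_pCons ev_add ev_mult)

lemma ev_monom: "ev (monom c n) a = k c * a ^ n"
  by (simp add: ev_def map_poly_monom poly_monom)

lemma ev_sum: "ev (sum g I) a = (\<Sum>j\<in>I. ev (g j) a)"
  by (induct I rule: infinite_finite_induct) (simp_all add: ev_add)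

lemma ev_1: "ev 1 a = 1"
  by (simp add: one_pCons ev_pCons k_one)

lemma ev_diff: "ev (P - Q) a = ev P a - ev Q a"
  using ev_add[of "P - Q" Q a] by simp

text \<open>Carries polynomial identities modulo x^n over to elements whose \<open>n\<close>-th
  power is zero in the quotient; this makes the truncated exponential and logarithm exact inverses
  there.\<close>

lemma q_ev_cong:
  assumes "monom 1 n dvd P - Q" and "q (a ^ n) = q 0"
  shows "q (ev P a) = q (ev Q a)"
proof -
  obtain R where "P - Q = monom 1 n * R"
    using assms(1) ..
  then have "ev P a - ev Q a = a ^ n * ev R a"
    using ev_diff[of P Q a] by (simp add: ev_mult ev_monom k_one)
  then show ?thesis
    using q_mult_zero[OF assms(2)] q_eq_iff[of "ev P a" "ev Q a"] by simp
qed

lemma algebra_exp_eq: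
  assumes "q (a ^ Suc n) = q 0"
  shows "algebra_exp V (q a) = q (ev (exp_poly n) a)"
proof -
  let ?g = "\<lambda>m. inverse (fact m) \<odot>\<^bsub>V\<^esub> (q a [^]\<^bsub>V\<^esub> m)"
  have g: "?g m = q (k (inverse (fact m)) * a ^ m)" for m
    by (simp add: q_smult q_power)
  have z: "q a [^]\<^bsub>V\<^esub> m = \<zero>\<^bsub>V\<^esub>" if "m > n" for m
  proof -
    have "a ^ m = a ^ Suc n * a ^ (m - Suc n)"
      using that by (simp flip: power_add del: power_Suc)
    then show ?thesis
      using q_mult_zero[OF assms] by (metis q_power q_zero)
  qed
  have "finsum V ?g {m. q a [^]\<^bsub>V\<^esub> m \<noteq> \<zero>\<^bsub>V\<^esub>} = finsum V ?g {..n}"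
  proof (rule V.add.finprod_mono_neutral_cong_left)
    show "{m. q a [^]\<^bsub>V\<^esub> m \<noteq> \<zero>\<^bsub>V\<^esub>} \<subseteq> {..n}"
      using z by (auto simp: not_le[symmetric])
    show "?g m = \<zero>\<^bsub>V\<^esub>" if "m \<in> {..n} - {m. q a [^]\<^bsub>V\<^esub> m \<noteq> \<zero>\<^bsub>V\<^esub>}" for m
      using that q_smult[of _ 0] by (simp add: q_zero)
    show "?g \<in> {..n} \<rightarrow> carrier V"
      unfolding g by auto
  qed auto
  also have "\<dots> = q (\<Sum>m\<le>n. k (inverse (fact m)) * a ^ m)"
    unfolding g by (simp add: q_sum)
  finally show ?thesis
    by (simp add: algebra_exp_def exp_poly_def ev_sum ev_monom)
qed

end

section \<open>The hypersurface of an H-pair\<close>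

text \<open>\<open>z0\<close> is the projection to \<open>K\<close> along the maximal ideal, and \<open>p\<close> extends \<open>\<pi>\<close> to the whole
  algebra; \<open>s\<close> spans a complement of the hyperplane inside the socle.\<close>

locale hpair = presented_algebra V q k
  for V :: "('a::field_char_0, 'v, 'x) module_scheme"
    and q :: "'r::comm_ring_1 \<Rightarrow> 'v"
    and k :: "'a \<Rightarrow> 'r" +
  fixes z0 p :: "'r \<Rightarrow> 'a" and s :: 'r and d n :: nat
  assumes z0_lin: "quot_linear q k z0"
    and p_lin: "quot_linear q k p"
    and z0_one: "z0 1 = 1"
    and z0_mult: "z0 (a * b) = z0 a * z0 b"
    and nilpotent: "z0 a = 0 \<Longrightarrow> q (a ^ Suc n) = q 0"
    and p_power_zero: "z0 a = 0 \<Longrightarrow> d < m \<Longrightarrow> p (a ^ m) = 0"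
    and p_power_nonzero: "\<exists>a. z0 a = 0 \<and> p (a ^ d) \<noteq> 0"
    and d_ge_2: "2 \<le> d"
    and z0_s: "z0 s = 0"
    and p_s: "p s = 1"
    and socle: "z0 a = 0 \<Longrightarrow> q (a * s) = q 0"
begin

definition U :: "'v set"
  where "U = q ` {a. z0 a = 0 \<and> p a = 0}"

text \<open>F with its denominators cleared, where z is \<open>v - k (z0 v)\<close>. The logarithm
  stops after degree \<open>d\<close>, since \<open>p\<close> kills the higher powers of the maximal
  ideal.\<close>

definition eqn :: "'r \<Rightarrow> 'a"
  where "eqn v = (\<Sum>m<d. (-1) ^ m / of_nat (Suc m) *
    (z0 v ^ (d - Suc m) * p ((v - k (z0 v)) ^ Suc m)))"

lemmas z0_simps = qlin_add[OF z0_lin] qlin_smult[OF z0_lin] qlin_diff[OF z0_lin] qlin_zero[OF z0_lin]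
lemmas p_simps = qlin_add[OF p_lin] qlin_smult[OF p_lin] qlin_diff[OF p_lin] qlin_zero[OF p_lin]

lemma z0_k: "z0 (k c) = c"
  using qlin_smult[OF z0_lin, of c 1] by (simp add: z0_one)

lemma z0_ev: "z0 (ev P a) = poly P (z0 a)"
  by (induct P) (simp_all add: ev_pCons z0_simps z0_mult z0_k)

lemma d_le_n: "d \<le> n"
proof (rule ccontr)
  assume "\<not> d \<le> n"
  obtain a where a: "z0 a = 0" "p (a ^ d) \<noteq> 0"
    using p_power_nonzero by auto
  have "a ^ d = a ^ Suc n * a ^ (d - Suc n)"
    using \<open>\<not> d \<le> n\<close> by (simp flip: power_add del: power_Suc)
  then have "q (a ^ d) = q 0"
    using q_mult_zero[OF nilpotent[OF a(1)]] by metis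
  then show False
    using a(2) qlin_cong[OF p_lin] by (metis p_simps(4))
qed

lemma p_ln: "p (ev (ln_poly n) y) = (\<Sum>m<n. (-1) ^ m / of_nat (Suc m) * p (y ^ Suc m))"
  unfolding ln_poly_def ev_sum ev_monom by (simp add: qlin_sum[OF p_lin] p_simps del: of_nat_Suc power_Suc)

text \<open>Here \<open>y\<close> is z / z_0. The logarithm up to degree \<open>n\<close> serves the
  exponential and the one up to \<open>d\<close> the equation; \<open>p\<close> does not see the
  difference.\<close>

lemma eqn_eq_p_ln:
  assumes "z0 v = c" and "c \<noteq> 0" and "y = k (inverse c) * v - 1"
  shows "eqn v = c ^ d * p (ev (ln_poly n) y)"
proof -
  have z0y: "z0 y = 0"
    using assms by (simp add: z0_simps z0_one)
  have "k c * y = k c * k (inverse c) * v - k c"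
    unfolding assms(3) by (simp only: right_diff_distrib mult.assoc mult_1_right)
  then have y: "v - k (z0 v) = k c * y"
    using assms(1) k_inverse[OF assms(2)] by simp
  have "c ^ (d - Suc m) * p ((k c * y) ^ Suc m) = c ^ d * p (y ^ Suc m)" if "m < d" for m
  proof -
    have "c ^ (d - Suc m) * p ((k c * y) ^ Suc m) = c ^ (d - Suc m) * c ^ Suc m * p (y ^ Suc m)"
      by (simp only: power_mult_distrib k_power p_simps mult.assoc)
    then show ?thesis
      using that by (simp flip: power_add del: power_Suc)
  qed
  then have "eqn v = (\<Sum>m<d. (-1) ^ m / of_nat (Suc m) * (c ^ d * p (y ^ Suc m)))"
    unfolding eqn_def y by (simp add: assms(1) del: power_Suc of_nat_Suc)
  also have "\<dots> = c ^ d * (\<Sum>m<d. (-1) ^ m / of_nat (Suc m) * p (y ^ Suc m))"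
    by (simp add: sum_distrib_left mult.left_commute del: power_Suc of_nat_Suc)
  also have "(\<Sum>m<d. (-1) ^ m / of_nat (Suc m) * p (y ^ Suc m)) = p (ev (ln_poly n) y)"
    unfolding p_ln
    by (rule sum.mono_neutral_left) (use d_le_n p_power_zero[OF z0y] in \<open>auto simp del: power_Suc\<close>)
  finally show ?thesis .
qed

text \<open>Write a point as v = c (1 + y) with y nilpotent. Then v = c exp a means a = ln (1 + y),
  and membership of a in the hyperplane, \<open>p a = 0\<close>, is the equation.\<close>

lemma exp_cone_eq:
  "{c \<odot>\<^bsub>V\<^esub> algebra_exp V u |c u. c \<noteq> 0 \<and> u \<in> U} = q ` {v. eqn v = 0 \<and> z0 v \<noteq> 0}"
proof (intro equalityI subsetI)
  fix x assume "x \<in> {c \<odot>\<^bsub>V\<^esub> algebra_exp V u |c u. c \<noteq> 0 \<and> u \<in> U}"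
  then obtain c a where a: "c \<noteq> 0" "z0 a = 0" "p a = 0" "x = c \<odot>\<^bsub>V\<^esub> algebra_exp V (q a)"
    by (auto simp: U_def)
  define v where "v = k c * ev (exp_poly n) a"
  have x: "x = q v"
    unfolding v_def q_smult a(4) by (simp add: algebra_exp_eq[OF nilpotent[OF a(2)]])
  have z0v: "z0 v = c"
    by (simp add: v_def z0_simps z0_ev a(2) poly_0_coeff_0 exp_poly_coeff_0)
  have "k (inverse c) * v = ev (exp_poly n) a"
    unfolding v_def using k_inverse[OF a(1)] by (metis mult.assoc mult.commute mult_1_left)
  then have "eqn v = c ^ d * p (ev (ln_poly n) (ev (exp_poly n) a - 1))"
    using eqn_eq_p_ln[OF z0v a(1)] by simp
  also have "ev (ln_poly n) (ev (exp_poly n) a - 1) = ev (pcompose (ln_poly n) (exp_poly n - 1)) a"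
    by (simp add: ev_pcompose ev_diff ev_1)
  also have "p \<dots> = p (ev [:0, 1:] a)"
    by (rule qlin_cong[OF p_lin q_ev_cong[OF ln_poly_exp_poly nilpotent[OF a(2)]]])
  also have "\<dots> = 0"
    by (simp add: ev_pCons k_one a(3))
  finally show "x \<in> q ` {v. eqn v = 0 \<and> z0 v \<noteq> 0}"
    using x z0v a(1) by auto
next
  fix x assume "x \<in> q ` {v. eqn v = 0 \<and> z0 v \<noteq> 0}"
  then obtain v where v: "x = q v" "eqn v = 0" "z0 v \<noteq> 0"
    by auto
  define c where "c = z0 v"
  define y where "y = k (inverse c) * v - 1"
  define a where "a = ev (ln_poly n) y"
  have c: "c \<noteq> 0" using v(3) by (simp add: c_def)
  have z0y: "z0 y = 0"
    using c by (simp add: y_def z0_simps z0_one c_def)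
  have z0a: "z0 a = 0"
    by (simp add: a_def z0_ev z0y poly_0_coeff_0 coeff_ln_poly)
  moreover have "p a = 0"
    using eqn_eq_p_ln[OF c_def[symmetric] c y_def] v(2) c by (simp add: a_def)
  ultimately have "q a \<in> U"
    by (auto simp: U_def)
  moreover have "c \<odot>\<^bsub>V\<^esub> algebra_exp V (q a) = x"
  proof -
    have "algebra_exp V (q a) = q (ev (pcompose (exp_poly n) (ln_poly n)) y)"
      by (simp add: algebra_exp_eq[OF nilpotent[OF z0a]] ev_pcompose) (simp add: a_def)
    also have "\<dots> = q (ev [:1, 1:] y)"
      by (rule q_ev_cong[OF exp_poly_ln_poly nilpotent[OF z0y]])
    also have "ev [:1, 1:] y = k (inverse c) * v"
      by (simp add: ev_pCons k_one y_def)
    also have "c \<odot>\<^bsub>V\<^esub> q \<dots> = q (k c * k (inverse c) * v)"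
      by (simp add: q_smult[symmetric] mult.assoc)
    finally show ?thesis
      by (simp add: k_inverse[OF c] v(1))
  qed
  ultimately show "x \<in> {c \<odot>\<^bsub>V\<^esub> algebra_exp V u |c u. c \<noteq> 0 \<and> u \<in> U}"
    using c by blast
qed

lemma qhom_p_power:
  "qhom m (\<lambda>v. p ((v - k (z0 v)) ^ m * w))"
proof (rule qhom_lin_of_power[OF p_lin])
  show "q (a - k (z0 a)) = q (b - k (z0 b))" if "q a = q b" for a b
    unfolding qlin_cong[OF z0_lin that] by (rule q_cong_diff[OF that refl])
qed (simp_all add: z0_simps k_add k_mult right_diff_distrib)

lemma eqn_qhom: "qhom d eqn"
  unfolding eqn_def
proof (intro qhom_sum qhom_cmult)
  fix m assume "m \<in> {..<d}"
  then show "qhom d (\<lambda>v. z0 v ^ (d - Suc m) * p ((v - k (z0 v)) ^ Suc m))"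
    using qhom_mult[OF qhom_lin_power[OF z0_lin, of "d - Suc m"] qhom_p_power[of "Suc m" 1]]
    by (simp del: power_Suc)
qed

lemma eqn_qpol: "qpol eqn"
  using eqn_qhom by (rule qhom_imp_qpol)

text \<open>Only the summand with index \<open>d - 1\<close> is free of the factor
  \<open>z0 v\<close>.\<close>

lemma eqn_at_infinity:
  assumes "z0 v = 0"
  shows "eqn v = (-1) ^ (d - 1) / of_nat d * p (v ^ d)"
proof -
  have "eqn v = (\<Sum>m<d. if m = d - 1 then (-1) ^ (d - 1) / of_nat d * p (v ^ d) else 0)"
    unfolding eqn_def
  proof (rule sum.cong)
    fix m assume "m \<in> {..<d}"
    then consider "Suc m = d" "m = d - 1" | "d - Suc m > 0" "m \<noteq> d - 1"
      by force
    then show "(-1) ^ m / of_nat (Suc m) * (z0 v ^ (d - Suc m) * p ((v - k (z0 v)) ^ Suc m)) =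
        (if m = d - 1 then (-1) ^ (d - 1) / of_nat d * p (v ^ d) else 0)"
      by cases (simp_all only: assms, simp_all add: power_0_left del: of_nat_Suc power_Suc)
  qed simp
  then show ?thesis
    using d_ge_2 by simp
qed

lemma eqn_nonzero_at_infinity: "\<exists>v. z0 v = 0 \<and> eqn v \<noteq> 0"
  using p_power_nonzero eqn_at_infinity d_ge_2 by fastforce

lemma eqn_s: "eqn s = 0"
proof -
  have "s ^ d = s * s * s ^ (d - 2)"
    using d_ge_2 by (simp add: mult.assoc flip: power_Suc) (simp add: numeral_2_eq_2 Suc_diff_Suc)
  then have "q (s ^ d) = q 0"
    using q_mult_zero[OF socle[OF z0_s]] by metis
  then have "p (s ^ d) = 0"
    using qlin_cong[OF p_lin] by (metis p_simps(4))
  then show ?thesis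
    by (simp add: eqn_at_infinity z0_s)
qed

text \<open>The element \<open>s\<close> annihilates the maximal ideal, so the translation leaves
  all powers of y from the square on unchanged. Only the linear summand moves, by
  \<open>x * p s = x\<close>.\<close>

lemma eqn_shift: "eqn (v - k x * s) = eqn v - x * z0 v ^ (d - 1)"
proof -
  define y where "y = v - k (z0 v)"
  have z0y: "z0 y = 0"
    by (simp add: y_def z0_simps z0_k)
  have z: "z0 (v - k x * s) = z0 v"
    by (simp add: z0_simps z0_s)
  have step: "q ((y - k x * s) ^ Suc (Suc m)) = q (y ^ Suc (Suc m))" for m
  proof (induct m)
    case 0
    have e: "(y - k x * s) ^ 2 = y ^ 2 - (k x * (2 * y - k x * s)) * s"
      by (simp add: power2_eq_square algebra_simps)
    have "z0 (k x * (2 * y - k x * s)) = 0"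
      using z0_mult[of 2 y] by (simp add: z0_simps z0_s z0y)
    from q_cong_diff[OF refl socle[OF this], of "y ^ 2"] show ?case
      by (simp add: e[unfolded power2_eq_square] power2_eq_square)
  next
    case (Suc m)
    have "q (y ^ Suc (Suc m) * (y - k x * s)) = q (y ^ Suc (Suc m) * y)"
    proof -
      have "z0 (y ^ Suc (Suc m) * k x) = 0"
        by (simp add: z0_mult z0y)
      from q_cong_diff[OF refl socle[OF this], of "y ^ Suc (Suc m) * y"] show ?thesis
        by (simp add: right_diff_distrib mult.assoc)
    qed
    with q_cong_mult[OF Suc refl, of "y - k x * s"] show ?case
      by (simp only: power_Suc2[of _ "Suc (Suc m)"])
  qed
  have "p ((y - k x * s) ^ Suc m) = p (y ^ Suc m) - (if m = 0 then x else 0)" for m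
    using qlin_cong[OF p_lin step] by (cases m) (simp_all add: p_simps p_s)
  then have shift: "p ((v - k x * s - k (z0 v)) ^ Suc m) = p (y ^ Suc m) - (if m = 0 then x else 0)" for m
    unfolding y_def by (simp only: diff_diff_eq add.commute)
  have "eqn (v - k x * s) = (\<Sum>m<d. (-1) ^ m / of_nat (Suc m) *
      (z0 v ^ (d - Suc m) * p (y ^ Suc m)) - (if m = 0 then x * z0 v ^ (d - 1) else 0))"
    unfolding eqn_def z shift by (intro sum.cong) (auto simp: right_diff_distrib simp del: power_Suc)
  also have "\<dots> = eqn v - x * z0 v ^ (d - 1)"
    using d_ge_2 by (simp add: sum_subtractf eqn_def y_def sum.delta del: power_Suc)
  finally show ?thesis .
qed

section \<open>The vanishing ideal of the cone: generation by \<open>eqn\<close> and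
  primality\<close>

lemma qpol_cancel_z0:
  assumes "qpol F" and "\<And>v. F v * z0 v = 0"
  shows "F v = 0"
proof -
  from qpol_mult_eq_0[OF assms(1) qpol_lin[OF z0_lin] assms(2)]
  show ?thesis
  proof
    assume "\<forall>v. z0 v = 0"
    then have "z0 1 = 0" ..
    then show ?thesis by (simp add: z0_one)
  qed simp
qed

text \<open>Moving \<open>v\<close> along \<open>s\<close> by x =
  \<open>eqn v / z0 v ^ (d - 1)\<close> lands on the cone, where \<open>G\<close> vanishes.
  Pseudo-division then gives \<open>z0 ^ m * G = eqn * H\<close>, and the factors \<open>z0\<close>
  are removed one at a time.\<close>

lemma qpol_vanishing_factor:
  assumes G: "qpol G" and "\<And>v. z0 v \<noteq> 0 \<Longrightarrow> eqn v = 0 \<Longrightarrow> G v = 0"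
  obtains H where "qpol H" and "\<And>v. G v = eqn v * H v"
proof -
  note z0_pol = qpol_lin[OF z0_lin]
  obtain m H where H: "qpol H" "\<forall>v x. x * z0 v ^ (d - 1) = eqn v \<longrightarrow>
      z0 v ^ m * G (v - k x * s) = z0 v ^ m * G v - eqn v * H v"
    using qpol_pseudo_division[OF G z0_pol eqn_qpol, of "d - 1" s] by blast
  have "z0 v ^ m * G v - eqn v * H v = 0" if "z0 v \<noteq> 0" for v
  proof -
    define x where "x = eqn v / z0 v ^ (d - 1)"
    have x: "x * z0 v ^ (d - 1) = eqn v"
      using that by (simp add: x_def)
    have "G (v - k x * s) = 0"
      by (rule assms(2)) (use that x in \<open>simp_all add: eqn_shift z0_simps z0_s\<close>)
    then show ?thesis
      using H(2)[rule_format, OF x] by simp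
  qed
  then have "(z0 v ^ m * G v - eqn v * H v) * z0 v = 0" for v
    by auto
  then have "z0 v ^ m * G v - eqn v * H v = 0" for v
    by (rule qpol_cancel_z0[rotated]) (intro qpol_diff qpol_mult qpol_power z0_pol G H(1) eqn_qpol)
  then have "z0 v ^ m * G v = eqn v * H v" for v
    by simp
  with H(1) have "\<exists>H. qpol H \<and> (\<forall>v. G v = eqn v * H v)"
  proof (induct m arbitrary: H)
    case (Suc m)
    \<comment> \<open>On \<open>z0 = 0\<close> the product \<open>eqn * H\<close> vanishes, and
      \<open>eqn\<close> does not vanish identically there. So \<open>H\<close> does, and one factor
      \<open>z0\<close> can be divided out of both sides.\<close>
    have "(\<forall>v. z0 v = 0 \<longrightarrow> eqn v = 0) \<or> (\<forall>v. z0 v = 0 \<longrightarrow> H v = 0)"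
      by (rule qpol_mult_eq_0_hyperplane[OF eqn_qpol Suc(2) z0_lin]) (simp flip: Suc(3))
    then have "\<And>v. z0 v = 0 \<Longrightarrow> H v = 0"
      using eqn_nonzero_at_infinity by auto
    then obtain H' where H': "qpol H'" "\<And>v. H v = z0 v * H' v"
      using qpol_factor_lin[OF Suc(2) z0_lin z0_one] by blast
    have "(z0 v ^ m * G v - eqn v * H' v) * z0 v = 0" for v
      using Suc(3)[of v] by (simp add: H'(2) algebra_simps)
    then have "z0 v ^ m * G v - eqn v * H' v = 0" for v
      by (rule qpol_cancel_z0[rotated]) (intro qpol_diff qpol_mult qpol_power z0_pol G H'(1) eqn_qpol)
    then have "z0 v ^ m * G v = eqn v * H' v" for v
      by simp
    with Suc(1) H'(1) show ?case by blast
  qed auto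
  with that show ?thesis by auto
qed

text \<open>The cone itself has only points with non-zero \<open>z0\<close>. The closure also
  contains the zeros of \<open>eqn\<close> at infinity, since a function vanishing on the cone is
  already a multiple of \<open>eqn\<close>.\<close>

lemma zariski_closure_exp_cone:
  "zariski_closure V {c \<odot>\<^bsub>V\<^esub> algebra_exp V u |c u. c \<noteq> 0 \<and> u \<in> U} = q ` {v. eqn v = 0}"
proof -
  obtain f where f: "polynomial_fun V f" "eqn = (\<lambda>v. f (q v))"
    using eqn_qpol by (auto simp: qpol_def)
  have "eqn a = 0" if a: "\<And>g. polynomial_fun V g \<Longrightarrow> (\<forall>v. eqn v = 0 \<and> z0 v \<noteq> 0 \<longrightarrow> g (q v) = 0) \<Longrightarrow> g (q a) = 0" for a
    using a[OF f(1)] f(2) by metis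
  moreover have "g (q a) = 0"
    if a: "eqn a = 0" and g: "polynomial_fun V g" "\<forall>v. eqn v = 0 \<and> z0 v \<noteq> 0 \<longrightarrow> g (q v) = 0" for a g
  proof -
    have "qpol (\<lambda>v. g (q v))"
      using g(1) by (auto simp: qpol_def)
    then obtain H where "\<And>v. g (q v) = eqn v * H v"
      using qpol_vanishing_factor g(2) by metis
    then show ?thesis using a by simp
  qed
  ultimately show ?thesis
    unfolding exp_cone_eq zariski_closure_def carrier_eq by blast
qed

text \<open>Where \<open>z0\<close> is non-zero, \<open>R1\<close> and \<open>R2\<close> are, up to
  powers of \<open>z0\<close>, the values of \<open>G1\<close> and \<open>G2\<close> at the point of
  the hypersurface reached from \<open>v\<close> along \<open>s\<close>. Primality is thus reduced
  to the absence of zero divisors on the whole space.\<close>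

lemma qpol_vanishing_prime:
  assumes G: "qpol G1" "qpol G2" and "\<And>v. eqn v = 0 \<Longrightarrow> G1 v * G2 v = 0"
  shows "(\<forall>v. eqn v = 0 \<longrightarrow> G1 v = 0) \<or> (\<forall>v. eqn v = 0 \<longrightarrow> G2 v = 0)"
proof -
  note z0_pol = qpol_lin[OF z0_lin]
  obtain m1 H1 where H1: "qpol H1" "\<forall>v x. x * z0 v ^ (d - 1) = eqn v \<longrightarrow>
      z0 v ^ m1 * G1 (v - k x * s) = z0 v ^ m1 * G1 v - eqn v * H1 v"
    using qpol_pseudo_division[OF G(1) z0_pol eqn_qpol, of "d - 1" s] by blast
  obtain m2 H2 where H2: "qpol H2" "\<forall>v x. x * z0 v ^ (d - 1) = eqn v \<longrightarrow>
      z0 v ^ m2 * G2 (v - k x * s) = z0 v ^ m2 * G2 v - eqn v * H2 v"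
    using qpol_pseudo_division[OF G(2) z0_pol eqn_qpol, of "d - 1" s] by blast
  define R1 where "R1 v = z0 v ^ m1 * G1 v - eqn v * H1 v" for v
  define R2 where "R2 v = z0 v ^ m2 * G2 v - eqn v * H2 v" for v
  have R: "qpol R1" "qpol R2"
    unfolding R1_def R2_def by (intro qpol_diff qpol_mult qpol_power z0_pol G H1(1) H2(1) eqn_qpol)+
  have "R1 v * R2 v * z0 v = 0" for v
  proof (cases "z0 v = 0")
    case False
    define x where "x = eqn v / z0 v ^ (d - 1)"
    have x: "x * z0 v ^ (d - 1) = eqn v"
      using False by (simp add: x_def)
    have "G1 (v - k x * s) * G2 (v - k x * s) = 0"
      by (rule assms(3)) (simp only: eqn_shift x diff_self)
    moreover have "R1 v * R2 v = z0 v ^ m1 * z0 v ^ m2 * (G1 (v - k x * s) * G2 (v - k x * s))"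
      unfolding R1_def R2_def H1(2)[rule_format, OF x, symmetric] H2(2)[rule_format, OF x, symmetric] by (simp add: mult_ac)
    ultimately show ?thesis by simp
  qed simp
  then have "R1 v * R2 v = 0" for v
    by (rule qpol_cancel_z0[rotated]) (intro qpol_mult R)
  then have "(\<forall>v. R1 v = 0) \<or> (\<forall>v. R2 v = 0)"
    by (rule qpol_mult_eq_0[OF R])
  \<comment> \<open>A vanishing remainder only yields zeros of F where \<open>z0\<close> is
    non-zero; divisibility by \<open>eqn\<close> extends this to infinity.\<close>
  moreover have "\<forall>v. eqn v = 0 \<longrightarrow> F v = 0"
    if F: "qpol F" and "\<forall>v. z0 v ^ m * F v - eqn v * H v = 0" for F H m
  proof -
    have "F v = 0" if "z0 v \<noteq> 0" "eqn v = 0" for v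
      using that \<open>\<forall>v. z0 v ^ m * F v - eqn v * H v = 0\<close>[rule_format, of v] by simp
    then obtain H' where "\<And>v. F v = eqn v * H' v"
      using qpol_vanishing_factor[OF F] by metis
    then show ?thesis by simp
  qed
  ultimately show ?thesis
    unfolding R1_def R2_def using G by blast
qed

section \<open>The projective hypersurface and its degree\<close>

definition Y :: "'v set set"
  where "Y = hpair_hypersurface V U"

lemma Y_eq: "Y = proj_point V ` (q ` {v. eqn v = 0} - {\<zero>\<^bsub>V\<^esub>})"
  unfolding Y_def hpair_hypersurface_def zariski_closure_exp_cone ..

lemma proj_point_q: "proj_point V (q v) = range (\<lambda>c. q (k c * v))"
  by (auto simp: proj_point_def q_smult)

lemma q_s_nonzero: "q s \<noteq> \<zero>\<^bsub>V\<^esub>"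
  using qlin_cong[OF p_lin, of s 0] p_s by (auto simp: p_simps q_zero)

lemma proj_point_s_in_Y: "proj_point V (q s) \<in> Y"
  unfolding Y_eq using eqn_s q_s_nonzero by blast

lemma eqn_smult: "eqn (k c * v) = c ^ d * eqn v"
  by (rule qhom_smult[OF eqn_qhom])

lemma Y_vanishing_iff:
  "(\<forall>P\<in>Y. \<forall>v\<in>P. g v = 0) \<longleftrightarrow> (\<forall>v. eqn v = 0 \<longrightarrow> g (q v) = 0)"
proof (intro iffI allI impI)
  fix v assume g: "\<forall>P\<in>Y. \<forall>v\<in>P. g v = 0" and v: "eqn v = 0"
  show "g (q v) = 0"
  proof (cases "q v = \<zero>\<^bsub>V\<^esub>")
    case True
    \<comment> \<open>Every projective point contains the origin, so the zero vector is covered by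
      any point of \<open>Y\<close>, here that of \<open>s\<close>.\<close>
    then have "q v \<in> proj_point V (q s)"
      by (auto simp: proj_point_q q_zero intro!: image_eqI[of _ _ 0])
    then show ?thesis using g proj_point_s_in_Y by auto
  next
    case False
    have "q v \<in> proj_point V (q v)"
      by (auto simp: proj_point_q k_one intro!: image_eqI[of _ _ 1])
    moreover have "proj_point V (q v) \<in> Y"
      unfolding Y_eq using False v by blast
    ultimately show ?thesis using g by auto
  qed
next
  assume "\<forall>v. eqn v = 0 \<longrightarrow> g (q v) = 0"
  then show "\<forall>P\<in>Y. \<forall>v\<in>P. g v = 0"
    by (auto simp: Y_eq proj_point_q eqn_smult)
qed

text \<open>The cofactor \<open>h\<close> is not known to be homogeneous, so both sides are
  restricted to a line through the origin and the degrees in its parameter t are compared.\<close>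

lemma homogeneous_degree_mono:
  assumes f: "homogeneous_fun V m f" and g: "homogeneous_fun V m' g"
    and h: "polynomial_fun V h" and eq: "\<forall>v\<in>carrier V. g v = f v * h v"
    and nz: "\<exists>v\<in>carrier V. g v \<noteq> 0"
  shows "m \<le> m'"
proof -
  obtain v where v: "g (q v) \<noteq> 0"
    using nz by (auto simp: carrier_eq)
  have "qpol (\<lambda>a. h (q a))"
    using h by (auto simp: qpol_def)
  then obtain P where P: "\<And>t. h (q (0 + k t * v)) = poly P t"
    using qpol_on_line[of _ 0] by blast
  have "t ^ m' * g (q v) = t ^ m * f (q v) * poly P t" for t
  proof -
    have "g (q (k t * v)) = f (q (k t * v)) * h (q (k t * v))"
      using eq by auto
    then show ?thesis
      using P[of t] by (simp add: q_smult homogeneous_fun_smult[OF f] homogeneous_fun_smult[OF g])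
  qed
  then have "poly (monom (g (q v)) m') = poly (monom (f (q v)) m * P)"
    by (intro ext) (simp add: poly_monom mult_ac)
  then have e: "monom (g (q v)) m' = monom (f (q v)) m * P"
    by (simp only: poly_eq_poly_eq_iff)
  then have "f (q v) \<noteq> 0" "P \<noteq> 0"
    using v by auto
  then have "degree (monom (f (q v)) m * P) = m + degree P"
    by (subst degree_mult_eq) (auto simp: degree_monom_eq)
  then show ?thesis
    using e v by (metis degree_monom_eq le_add1)
qed

theorem hypersurface_degree_eq: "hypersurface_degree V Y = d"
proof -
  obtain f where f: "homogeneous_fun V d f" "eqn = (\<lambda>v. f (q v))"
    using eqn_qhom by (auto simp: qhom_def)
  have f_nz: "\<exists>v\<in>carrier V. f v \<noteq> 0"
    using eqn_nonzero_at_infinity f(2) by auto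
  have f_gen: "(\<forall>P\<in>Y. \<forall>v\<in>P. g v = 0) \<longleftrightarrow>
      (\<exists>h. polynomial_fun V h \<and> (\<forall>v\<in>carrier V. g v = f v * h v))" if g: "polynomial_fun V g" for g
  proof
    assume "\<forall>P\<in>Y. \<forall>v\<in>P. g v = 0"
    then have g0: "\<forall>v. eqn v = 0 \<longrightarrow> g (q v) = 0"
      by (simp only: Y_vanishing_iff)
    have "qpol (\<lambda>v. g (q v))"
      using g by (auto simp: qpol_def)
    then obtain H where "qpol H" "\<And>v. g (q v) = eqn v * H v"
      using qpol_vanishing_factor g0 by metis
    then show "\<exists>h. polynomial_fun V h \<and> (\<forall>v\<in>carrier V. g v = f v * h v)"
      by (auto simp: qpol_def f(2) carrier_eq)
  qed (auto simp: Y_vanishing_iff f(2))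
  show ?thesis
    unfolding hypersurface_degree_def
  proof (rule the_equality)
    show "\<exists>F. homogeneous_fun V d F \<and> (\<exists>v\<in>carrier V. F v \<noteq> 0) \<and>
        (\<forall>G. polynomial_fun V G \<longrightarrow> (\<forall>P\<in>Y. \<forall>v\<in>P. G v = 0) =
          (\<exists>H. polynomial_fun V H \<and> (\<forall>v\<in>carrier V. G v = F v * H v)))"
      using f(1) f_nz f_gen by blast
  next
    fix e assume "\<exists>F. homogeneous_fun V e F \<and> (\<exists>v\<in>carrier V. F v \<noteq> 0) \<and>
        (\<forall>G. polynomial_fun V G \<longrightarrow> (\<forall>P\<in>Y. \<forall>v\<in>P. G v = 0) =
          (\<exists>H. polynomial_fun V H \<and> (\<forall>v\<in>carrier V. G v = F v * H v)))"
    then obtain F where F: "homogeneous_fun V e F" "\<exists>v\<in>carrier V. F v \<noteq> 0"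
      and gen: "\<And>G. polynomial_fun V G \<Longrightarrow> (\<forall>P\<in>Y. \<forall>v\<in>P. G v = 0) =
          (\<exists>H. polynomial_fun V H \<and> (\<forall>v\<in>carrier V. G v = F v * H v))"
      by blast
    note fp = homogeneous_imp_polynomial[OF f(1)] and Fp = homogeneous_imp_polynomial[OF F(1)]
    have "\<forall>P\<in>Y. \<forall>v\<in>P. f v = 0"
      by (simp add: Y_vanishing_iff f(2))
    then obtain H where "polynomial_fun V H" "\<forall>v\<in>carrier V. f v = F v * H v"
      using gen[OF fp] by blast
    then have "e \<le> d"
      using homogeneous_degree_mono[OF F(1) f(1)] f_nz by blast
    \<comment> \<open>\<open>F\<close> vanishes on \<open>Y\<close> because it is a multiple of
      itself, with cofactor 1. Now both generators divide each other.\<close>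
    have "\<forall>P\<in>Y. \<forall>v\<in>P. F v = 0"
      using gen[OF Fp] polynomial_fun.const[of V 1] by (metis mult_1_right)
    then obtain H where "polynomial_fun V H" "\<forall>v\<in>carrier V. F v = f v * H v"
      using f_gen[OF Fp] by blast
    then have "d \<le> e"
      using homogeneous_degree_mono[OF f(1) F(1)] F(2) by blast
    with \<open>e \<le> d\<close> show "e = d" by simp
  qed
qed

end

section \<open>The function field\<close>

lemma a_inv_ring_of_type_algebra: "\<ominus>\<^bsub>ring_of_type_algebra\<^esub> (x :: 'r::comm_ring_1) = - x"
proof -
  interpret R: ring "ring_of_type_algebra :: 'r ring"
    by (rule ring_from_type_algebra)
  show ?thesis
    by (rule R.minus_equality) (simp_all add: ring_of_type_algebra_def)
qed

lemma cring_restrict_ring_of_type_algebra: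
  assumes "1 \<in> H" and "\<And>x. x \<in> H \<Longrightarrow> - x \<in> H"
    and "\<And>x y. x \<in> H \<Longrightarrow> y \<in> H \<Longrightarrow> x * y \<in> H"
    and "\<And>x y. x \<in> H \<Longrightarrow> y \<in> H \<Longrightarrow> x + y \<in> H"
  shows "cring ((ring_of_type_algebra :: 'r::comm_ring_1 ring)\<lparr>carrier := H\<rparr>)"
proof -
  let ?R = "ring_of_type_algebra :: 'r ring"
  interpret R: cring ?R
    by (rule cring_from_type_algebra)
  have "subring H ?R"
  proof (rule R.subringI)
    show "\<ominus>\<^bsub>?R\<^esub> h \<in> H" if "h \<in> H" for h
      using assms(2)[OF that] by (simp add: a_inv_ring_of_type_algebra)
  qed (use assms in \<open>auto simp: ring_of_type_algebra_def\<close>)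
  then show ?thesis
    using R.subcring_iff R.subcringI' R.subring_is_ring subringE(1) by blast
qed

text \<open>The last assumption says that two non-empty basic open sets meet; it makes generic
  equality an equivalence relation.\<close>

locale irreducible_projective =
  fixes V :: "('a::field, 'v, 'x) module_scheme" and Y :: "'v set set"
  assumes point: "P \<in> Y \<Longrightarrow> \<exists>v\<in>carrier V. v \<noteq> \<zero>\<^bsub>V\<^esub> \<and> P = proj_point V v"
    and zero_smult: "v \<in> carrier V \<Longrightarrow> 0 \<odot>\<^bsub>V\<^esub> v = \<zero>\<^bsub>V\<^esub>"
    and one_smult: "v \<in> carrier V \<Longrightarrow> 1 \<odot>\<^bsub>V\<^esub> v = v"
    and Y_nonempty: "Y \<noteq> {}"
    and irreducible: "homogeneous_fun V m f \<Longrightarrow> homogeneous_fun V m' g \<Longrightarrow>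
      \<exists>P\<in>Y. \<exists>v\<in>P. f v \<noteq> 0 \<Longrightarrow> \<exists>P\<in>Y. \<exists>v\<in>P. g v \<noteq> 0 \<Longrightarrow> \<exists>P\<in>Y. \<exists>v\<in>P. f v \<noteq> 0 \<and> g v \<noteq> 0"
begin

abbreviation is_open :: "'v set set \<Rightarrow> bool"
  where "is_open W \<equiv> proj_open V Y W"

lemma nonzero_representative:
  assumes "P \<in> Y"
  obtains v where "v \<in> P" and "v \<in> carrier V" and "v \<noteq> \<zero>\<^bsub>V\<^esub>"
proof -
  obtain v where v: "v \<in> carrier V" "v \<noteq> \<zero>\<^bsub>V\<^esub>" "P = proj_point V v"
    using point[OF assms] by blast
  then have "v \<in> P"
    using one_smult[OF v(1)] by (auto simp: proj_point_def intro: exI[of _ 1])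
  with v that show ?thesis by blast
qed

text \<open>\<open>proj_open\<close> asks for one representative where the function is non-zero,
  \<open>regular_on\<close> for every non-zero one; this passes between the two.\<close>

lemma homogeneous_nonzero:
  assumes f: "homogeneous_fun V m f" and "P \<in> Y" and "v \<in> P" "f v \<noteq> 0"
    and "w \<in> P" "w \<noteq> \<zero>\<^bsub>V\<^esub>"
  shows "f w \<noteq> 0"
proof -
  obtain u where u: "u \<in> carrier V" "P = proj_point V u"
    using point[OF assms(2)] by blast
  obtain c c' where c: "v = c \<odot>\<^bsub>V\<^esub> u" "w = c' \<odot>\<^bsub>V\<^esub> u"
    using assms(3,5) by (auto simp: u(2) proj_point_def)
  then have "c' \<noteq> 0" "f u \<noteq> 0"
    using assms(4,6) zero_smult[OF u(1)] homogeneous_fun_smult[OF f u(1), of c] by auto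
  then show ?thesis
    by (simp add: c(2) homogeneous_fun_smult[OF f u(1)])
qed

lemma is_open_nonzero: "homogeneous_fun V m f \<Longrightarrow> is_open {P \<in> Y. \<exists>v\<in>P. f v \<noteq> 0}"
  unfolding proj_open_def by (rule exI[of _ "{f}"]) auto

lemma is_open_Y: "is_open Y"
proof -
  have "\<exists>v. v \<in> P" if "P \<in> Y" for P
    using nonzero_representative[OF that] by auto
  then have "{P \<in> Y. \<exists>v\<in>P. (1::'a) \<noteq> 0} = Y"
    by auto
  then show ?thesis
    using is_open_nonzero[OF homogeneous_fun.const[of V 1]] by simp
qed

lemma is_open_Int:
  assumes "is_open W1" "is_open W2"
  shows "is_open (W1 \<inter> W2)"
proof -
  obtain T1 where T1: "\<forall>f\<in>T1. \<exists>m. homogeneous_fun V m f" "W1 = {P \<in> Y. \<exists>f\<in>T1. \<exists>v\<in>P. f v \<noteq> 0}"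
    using assms(1) by (auto simp: proj_open_def)
  obtain T2 where T2: "\<forall>f\<in>T2. \<exists>m. homogeneous_fun V m f" "W2 = {P \<in> Y. \<exists>f\<in>T2. \<exists>v\<in>P. f v \<noteq> 0}"
    using assms(2) by (auto simp: proj_open_def)
  define T where "T = {\<lambda>v. f v * g v |f g. f \<in> T1 \<and> g \<in> T2}"
  have "\<forall>f\<in>T. \<exists>m. homogeneous_fun V m f"
    using T1(1) T2(1) homogeneous_fun_mult unfolding T_def by blast
  moreover have "W1 \<inter> W2 = {P \<in> Y. \<exists>f\<in>T. \<exists>v\<in>P. f v \<noteq> 0}"
  proof (intro equalityI subsetI)
    fix P assume "P \<in> W1 \<inter> W2"
    then obtain f g v w where P: "P \<in> Y" "f \<in> T1" "g \<in> T2" "v \<in> P" "f v \<noteq> 0" "w \<in> P" "g w \<noteq> 0"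
      by (auto simp: T1(2) T2(2))
    obtain u where u: "u \<in> P" "u \<noteq> \<zero>\<^bsub>V\<^esub>"
      using nonzero_representative[OF P(1)] by blast
    have "f u \<noteq> 0"
      using homogeneous_nonzero[where f = f, OF _ P(1,4,5) u] T1(1) P(2) by blast
    moreover have "g u \<noteq> 0"
      using homogeneous_nonzero[where f = g, OF _ P(1,6,7) u] T2(1) P(3) by blast
    ultimately have "f u * g u \<noteq> 0"
      by simp
    have "(\<lambda>v. f v * g v) \<in> T"
      using P(2,3) by (auto simp: T_def)
    then show "P \<in> {P \<in> Y. \<exists>f\<in>T. \<exists>v\<in>P. f v \<noteq> 0}"
      using P(1) u(1) \<open>f u * g u \<noteq> 0\<close> by (auto intro!: bexI[OF _ \<open>(\<lambda>v. f v * g v) \<in> T\<close>])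
  next
    fix P assume "P \<in> {P \<in> Y. \<exists>f\<in>T. \<exists>v\<in>P. f v \<noteq> 0}"
    then obtain f g v where "P \<in> Y" "f \<in> T1" "g \<in> T2" "v \<in> P" "f v * g v \<noteq> 0"
      by (auto simp: T_def)
    then show "P \<in> W1 \<inter> W2"
      by (auto simp: T1(2) T2(2))
  qed
  ultimately show ?thesis
    unfolding proj_open_def by blast
qed

lemma is_open_Int_nonempty:
  assumes "is_open W1" "is_open W2" and "W1 \<noteq> {}" "W2 \<noteq> {}"
  shows "W1 \<inter> W2 \<noteq> {}"
proof -
  obtain T1 where T1: "\<forall>f\<in>T1. \<exists>m. homogeneous_fun V m f" "W1 = {P \<in> Y. \<exists>f\<in>T1. \<exists>v\<in>P. f v \<noteq> 0}"
    using assms(1) by (auto simp: proj_open_def)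
  obtain T2 where T2: "\<forall>f\<in>T2. \<exists>m. homogeneous_fun V m f" "W2 = {P \<in> Y. \<exists>f\<in>T2. \<exists>v\<in>P. f v \<noteq> 0}"
    using assms(2) by (auto simp: proj_open_def)
  obtain f m where f: "f \<in> T1" "homogeneous_fun V m f" "\<exists>P\<in>Y. \<exists>v\<in>P. f v \<noteq> 0"
    using assms(3) T1 by blast
  obtain g m' where g: "g \<in> T2" "homogeneous_fun V m' g" "\<exists>P\<in>Y. \<exists>v\<in>P. g v \<noteq> 0"
    using assms(4) T2 by blast
  show ?thesis
    using irreducible[OF f(2) g(2) f(3) g(3)] f(1) g(1) T1(2) T2(2) by blast
qed

lemma regular_onE:
  assumes "regular_on V Y W \<phi>" and "P \<in> W"
  obtains W' m f g where "is_open W'" "P \<in> W'" "W' \<subseteq> W"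
    "homogeneous_fun V m f" "homogeneous_fun V m g"
    "\<And>Q v. Q \<in> W' \<Longrightarrow> v \<in> Q \<Longrightarrow> v \<noteq> \<zero>\<^bsub>V\<^esub> \<Longrightarrow> g v \<noteq> 0 \<and> \<phi> Q = f v / g v"
proof -
  obtain W' m f g where "is_open W'" "P \<in> W'" "W' \<subseteq> W" "homogeneous_fun V m f" "homogeneous_fun V m g"
    "\<forall>Q\<in>W'. \<forall>v\<in>Q - {\<zero>\<^bsub>V\<^esub>}. g v \<noteq> 0 \<and> \<phi> Q = f v / g v"
    using bspec[OF assms(1)[unfolded regular_on_def] assms(2)] by (elim exE conjE)
  then show ?thesis
    by (intro that[of W' m f g]) auto
qed

lemma regular_onI:
  assumes "\<And>P. P \<in> W \<Longrightarrow> \<exists>W' m f g. is_open W' \<and> P \<in> W' \<and> W' \<subseteq> W \<and>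
    homogeneous_fun V m f \<and> homogeneous_fun V m g \<and>
    (\<forall>Q\<in>W'. \<forall>v\<in>Q - {\<zero>\<^bsub>V\<^esub>}. g v \<noteq> 0 \<and> \<phi> Q = f v / g v)"
  shows "regular_on V Y W \<phi>"
  using assms unfolding regular_on_def by meson

lemma regular_on_const: "is_open W \<Longrightarrow> regular_on V Y W (\<lambda>_. c)"
  by (rule regular_onI)
    (intro exI[of _ W] exI[of _ 0] exI[of _ "\<lambda>_. c"] exI[of _ "\<lambda>_. 1"], simp add: homogeneous_fun.const)

lemma regular_on_add_mult:
  assumes "regular_on V Y W1 \<phi>" "regular_on V Y W2 \<psi>"
  shows "regular_on V Y (W1 \<inter> W2) (\<lambda>P. \<phi> P + \<psi> P)"
    and "regular_on V Y (W1 \<inter> W2) (\<lambda>P. \<phi> P * \<psi> P)"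
proof -
  have *: "\<exists>W' m f f' g. is_open W' \<and> P \<in> W' \<and> W' \<subseteq> W1 \<inter> W2 \<and>
      homogeneous_fun V m f \<and> homogeneous_fun V m f' \<and> homogeneous_fun V m g \<and>
      (\<forall>Q\<in>W'. \<forall>v\<in>Q - {\<zero>\<^bsub>V\<^esub>}. g v \<noteq> 0 \<and> \<phi> Q + \<psi> Q = f v / g v \<and> \<phi> Q * \<psi> Q = f' v / g v)"
    if P: "P \<in> W1 \<inter> W2" for P
  proof -
    obtain W1' m1 f1 g1 where 1: "is_open W1'" "P \<in> W1'" "W1' \<subseteq> W1"
      "homogeneous_fun V m1 f1" "homogeneous_fun V m1 g1"
      "\<And>Q v. Q \<in> W1' \<Longrightarrow> v \<in> Q \<Longrightarrow> v \<noteq> \<zero>\<^bsub>V\<^esub> \<Longrightarrow> g1 v \<noteq> 0 \<and> \<phi> Q = f1 v / g1 v"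
      using regular_onE[OF assms(1), of P] P by blast
    obtain W2' m2 f2 g2 where 2: "is_open W2'" "P \<in> W2'" "W2' \<subseteq> W2"
      "homogeneous_fun V m2 f2" "homogeneous_fun V m2 g2"
      "\<And>Q v. Q \<in> W2' \<Longrightarrow> v \<in> Q \<Longrightarrow> v \<noteq> \<zero>\<^bsub>V\<^esub> \<Longrightarrow> g2 v \<noteq> 0 \<and> \<psi> Q = f2 v / g2 v"
      using regular_onE[OF assms(2), of P] P by blast
    show ?thesis
    proof (intro exI conjI)
      show "is_open (W1' \<inter> W2')" "P \<in> W1' \<inter> W2'" "W1' \<inter> W2' \<subseteq> W1 \<inter> W2"
        using is_open_Int 1 2 by auto
      show "homogeneous_fun V (m1 + m2) (\<lambda>v. f1 v * g2 v + g1 v * f2 v)"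
        by (intro homogeneous_fun.add homogeneous_fun_mult 1 2)
      show "homogeneous_fun V (m1 + m2) (\<lambda>v. f1 v * f2 v)" "homogeneous_fun V (m1 + m2) (\<lambda>v. g1 v * g2 v)"
        by (intro homogeneous_fun_mult 1 2)+
      show "\<forall>Q\<in>W1' \<inter> W2'. \<forall>v\<in>Q - {\<zero>\<^bsub>V\<^esub>}. g1 v * g2 v \<noteq> 0 \<and>
          \<phi> Q + \<psi> Q = (f1 v * g2 v + g1 v * f2 v) / (g1 v * g2 v) \<and>
          \<phi> Q * \<psi> Q = f1 v * f2 v / (g1 v * g2 v)"
      proof (intro ballI)
        fix Q v assume "Q \<in> W1' \<inter> W2'" "v \<in> Q - {\<zero>\<^bsub>V\<^esub>}"
        then have "g1 v \<noteq> 0" "\<phi> Q = f1 v / g1 v" "g2 v \<noteq> 0" "\<psi> Q = f2 v / g2 v"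
          using 1(6)[of Q v] 2(6)[of Q v] by auto
        then show "g1 v * g2 v \<noteq> 0 \<and>
            \<phi> Q + \<psi> Q = (f1 v * g2 v + g1 v * f2 v) / (g1 v * g2 v) \<and>
            \<phi> Q * \<psi> Q = f1 v * f2 v / (g1 v * g2 v)"
          by (simp add: add_frac_eq mult.commute)
      qed
    qed
  qed
  show "regular_on V Y (W1 \<inter> W2) (\<lambda>P. \<phi> P + \<psi> P)"
    by (rule regular_onI) (drule *, elim exE conjE, intro exI conjI, assumption+, blast)
  show "regular_on V Y (W1 \<inter> W2) (\<lambda>P. \<phi> P * \<psi> P)"
    by (rule regular_onI) (drule *, elim exE conjE, intro exI conjI, assumption+, blast)
qed

section \<open>The ring of rational functions and the ideal of generically zero ones\<close>

abbreviation K where "K \<equiv> rational_functions V Y"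
abbreviation Z where "Z \<equiv> generically_zero V Y"

lemma K_carrier: "\<phi> \<in> carrier K \<longleftrightarrow> (\<exists>W. is_open W \<and> W \<noteq> {} \<and> regular_on V Y W \<phi>)"
  by (simp add: rational_functions_def)

lemma K_simps: "\<phi> \<oplus>\<^bsub>K\<^esub> \<psi> = \<phi> + \<psi>" "\<phi> \<otimes>\<^bsub>K\<^esub> \<psi> = \<phi> * \<psi>" "\<one>\<^bsub>K\<^esub> = 1" "\<zero>\<^bsub>K\<^esub> = 0"
  by (simp_all add: rational_functions_def ring_of_type_algebra_def)

lemma const_in_K: "(\<lambda>_. c) \<in> carrier K"
  unfolding K_carrier using is_open_Y Y_nonempty regular_on_const by blast

lemma K_closed:
  assumes "\<phi> \<in> carrier K" "\<psi> \<in> carrier K"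
  shows "\<phi> + \<psi> \<in> carrier K" and "\<phi> * \<psi> \<in> carrier K"
proof -
  obtain W1 W2 where W: "is_open W1" "W1 \<noteq> {}" "regular_on V Y W1 \<phi>"
    "is_open W2" "W2 \<noteq> {}" "regular_on V Y W2 \<psi>"
    using assms by (auto simp: K_carrier)
  then have "is_open (W1 \<inter> W2)" "W1 \<inter> W2 \<noteq> {}"
    using is_open_Int is_open_Int_nonempty by blast+
  with regular_on_add_mult[OF W(3,6)] show "\<phi> + \<psi> \<in> carrier K" "\<phi> * \<psi> \<in> carrier K"
    unfolding K_carrier plus_fun_def times_fun_def by blast+
qed

lemma K_uminus_closed: "\<phi> \<in> carrier K \<Longrightarrow> - \<phi> \<in> carrier K"
  using K_closed(2)[OF const_in_K[of "- 1"], of \<phi>] by (simp add: times_fun_def fun_Compl_def)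

lemma cring_K: "cring K"
  unfolding rational_functions_def
proof (rule cring_restrict_ring_of_type_algebra)
  fix \<phi> \<psi> assume "\<phi> \<in> {\<phi>. \<exists>W. is_open W \<and> W \<noteq> {} \<and> regular_on V Y W \<phi>}"
    "\<psi> \<in> {\<phi>. \<exists>W. is_open W \<and> W \<noteq> {} \<and> regular_on V Y W \<phi>}"
  then show "\<phi> * \<psi> \<in> {\<phi>. \<exists>W. is_open W \<and> W \<noteq> {} \<and> regular_on V Y W \<phi>}"
    "\<phi> + \<psi> \<in> {\<phi>. \<exists>W. is_open W \<and> W \<noteq> {} \<and> regular_on V Y W \<phi>}"
    using K_closed[of \<phi> \<psi>] by (simp_all only: K_carrier mem_Collect_eq)
next
  fix \<phi> assume "\<phi> \<in> {\<phi>. \<exists>W. is_open W \<and> W \<noteq> {} \<and> regular_on V Y W \<phi>}"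
  then show "- \<phi> \<in> {\<phi>. \<exists>W. is_open W \<and> W \<noteq> {} \<and> regular_on V Y W \<phi>}"
    using K_uminus_closed[of \<phi>] by (simp_all only: K_carrier mem_Collect_eq)
next
  show "1 \<in> {\<phi>. \<exists>W. is_open W \<and> W \<noteq> {} \<and> regular_on V Y W \<phi>}"
    using const_in_K[of 1] unfolding K_carrier one_fun_def mem_Collect_eq .
qed

lemma K_a_inv: "\<phi> \<in> carrier K \<Longrightarrow> \<ominus>\<^bsub>K\<^esub> \<phi> = - \<phi>"
proof -
  interpret K: cring K by (rule cring_K)
  assume "\<phi> \<in> carrier K"
  then show ?thesis
    by (intro K.minus_equality) (simp_all add: K_simps K_uminus_closed)
qed

lemma Z_iff: "\<phi> \<in> Z \<longleftrightarrow> (\<exists>W. is_open W \<and> W \<noteq> {} \<and> (\<forall>P\<in>W. \<phi> P = 0))"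
  by (simp add: generically_zero_def)

lemma regular_on_cong:
  assumes "regular_on V Y W \<phi>" and "\<And>P. P \<in> W \<Longrightarrow> \<phi> P = \<psi> P"
  shows "regular_on V Y W \<psi>"
proof (rule regular_onI)
  fix P assume "P \<in> W"
  then obtain W' m f g where W': "is_open W'" "P \<in> W'" "W' \<subseteq> W"
    "homogeneous_fun V m f" "homogeneous_fun V m g"
    "\<And>Q v. Q \<in> W' \<Longrightarrow> v \<in> Q \<Longrightarrow> v \<noteq> \<zero>\<^bsub>V\<^esub> \<Longrightarrow> g v \<noteq> 0 \<and> \<phi> Q = f v / g v"
    using regular_onE[OF assms(1)] by blast
  have "\<forall>Q\<in>W'. \<forall>v\<in>Q - {\<zero>\<^bsub>V\<^esub>}. g v \<noteq> 0 \<and> \<psi> Q = f v / g v"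
    using W'(3,6) assms(2) by (metis Diff_iff singletonI subsetD)
  then show "\<exists>W' m f g. is_open W' \<and> P \<in> W' \<and> W' \<subseteq> W \<and>
      homogeneous_fun V m f \<and> homogeneous_fun V m g \<and>
      (\<forall>Q\<in>W'. \<forall>v\<in>Q - {\<zero>\<^bsub>V\<^esub>}. g v \<noteq> 0 \<and> \<psi> Q = f v / g v)"
    using W'(1-5) by (intro exI conjI)
qed

lemma Z_subset: "Z \<subseteq> carrier K"
proof
  fix \<phi> assume "\<phi> \<in> Z"
  then obtain W where W: "is_open W" "W \<noteq> {}" "\<forall>P\<in>W. \<phi> P = 0"
    by (auto simp: Z_iff)
  have "regular_on V Y W \<phi>"
    by (rule regular_on_cong[OF regular_on_const[OF W(1), of 0]]) (simp add: W(3))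
  then show "\<phi> \<in> carrier K"
    using W(1,2) by (auto simp: K_carrier)
qed

lemma ideal_Z: "ideal Z K"
proof -
  interpret K: cring K by (rule cring_K)
  have mult: "x * a \<in> Z" if "a \<in> Z" for a x
    using that by (fastforce simp: Z_iff)
  show ?thesis
  proof (rule idealI[OF K.ring_axioms K.add.subgroupI])
    show "Z \<noteq> {}"
      using is_open_Y Y_nonempty Z_iff[of 0] by auto
    show "\<ominus>\<^bsub>K\<^esub> a \<in> Z" if "a \<in> Z" for a
      using that Z_subset mult[OF that, of "- 1"] by (auto simp: K_a_inv)
    show "a \<oplus>\<^bsub>K\<^esub> b \<in> Z" if ab: "a \<in> Z" "b \<in> Z" for a b
    proof -
      obtain W1 W2 where W: "is_open W1" "W1 \<noteq> {}" "\<forall>P\<in>W1. a P = 0"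
        "is_open W2" "W2 \<noteq> {}" "\<forall>P\<in>W2. b P = 0"
        using ab by (auto simp: Z_iff)
      then have "is_open (W1 \<inter> W2)" "W1 \<inter> W2 \<noteq> {}"
        using is_open_Int is_open_Int_nonempty by blast+
      then show ?thesis
        using W(3,6) unfolding K_simps Z_iff by (intro exI[of _ "W1 \<inter> W2"]) simp
    qed
  qed (use mult Z_subset in \<open>auto simp: K_simps mult.commute\<close>)
qed

lemma coset_eq_iff:
  assumes "\<phi> \<in> carrier K" "\<psi> \<in> carrier K"
  shows "Z +>\<^bsub>K\<^esub> \<phi> = Z +>\<^bsub>K\<^esub> \<psi> \<longleftrightarrow> \<phi> - \<psi> \<in> Z"
proof -
  interpret K: cring K by (rule cring_K)
  show ?thesis
    using K.quotient_eq_iff_same_a_r_cos[OF ideal_Z assms]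
    by (simp add: a_minus_def K_a_inv[OF assms(2)] K_simps)
qed

lemma one_notin_Z: "1 \<notin> Z"
  by (auto simp: Z_iff)

text \<open>Restates failure of normality at \<open>P\<close> without cosets: \<open>\<phi>\<close>
  is a root of a monic quadratic with coefficients regular at \<open>P\<close>, up to generic
  equality, and agrees generically with no function regular at \<open>P\<close>.\<close>

lemma not_normal_variety:
  assumes "P \<in> Y" and \<phi>: "\<phi> \<in> carrier K"
    and W: "is_open W" "P \<in> W" "regular_on V Y W \<beta>" "regular_on V Y W \<gamma>"
    and eq: "\<phi> * \<phi> + \<beta> * \<phi> + \<gamma> \<in> Z"
    and not_regular: "\<And>W \<psi>. is_open W \<Longrightarrow> P \<in> W \<Longrightarrow> regular_on V Y W \<psi> \<Longrightarrow> \<phi> - \<psi> \<notin> Z"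
  shows "\<not> normal_variety V Y"
proof
  assume normal: "normal_variety V Y"
  interpret K: cring K by (rule cring_K)
  define Q where "Q = function_field V Y"
  define cls where "cls = (+>\<^bsub>K\<^esub>) Z"
  interpret Q: cring Q
    unfolding Q_def function_field_def by (rule ideal.quotient_is_cring[OF ideal_Z cring_K])
  interpret h: ring_hom_ring K Q cls
    by (rule ring_hom_ringI2[OF K.ring_axioms Q.ring_axioms])
      (use ideal.rcos_ring_hom[OF ideal_Z] in \<open>simp add: Q_def function_field_def cls_def\<close>)
  have \<beta>: "\<beta> \<in> carrier K" and \<gamma>: "\<gamma> \<in> carrier K"
    using W by (auto simp: K_carrier)
  have zero: "cls a = \<zero>\<^bsub>Q\<^esub>" if "a \<in> Z" for a
  proof -
    have "cls a = cls \<zero>\<^bsub>K\<^esub>"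
      unfolding cls_def using that Z_subset by (subst coset_eq_iff[OF _ K.zero_closed]) (auto simp: K_simps(4))
    then show ?thesis by simp
  qed
  let ?L = "local_ring_at V Y P"
  have local: "cls a \<in> ?L" if "is_open W'" "P \<in> W'" "regular_on V Y W' a" for a W'
    using that unfolding local_ring_at_def cls_def by blast
  have "integral_over Q ?L (cls \<phi>)"
    unfolding integral_over_def
  proof (intro bexI conjI)
    show "[\<one>\<^bsub>Q\<^esub>, cls \<beta>, cls \<gamma>] \<noteq> []" "hd [\<one>\<^bsub>Q\<^esub>, cls \<beta>, cls \<gamma>] = \<one>\<^bsub>Q\<^esub>"
      by simp_all
    \<comment> \<open>Polynomials are lists with the leading coefficient first, and that coefficient
      has to be non-zero.\<close>
    have "\<one>\<^bsub>Q\<^esub> \<noteq> \<zero>\<^bsub>Q\<^esub>"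
    proof
      assume "\<one>\<^bsub>Q\<^esub> = \<zero>\<^bsub>Q\<^esub>"
      then have "cls \<one>\<^bsub>K\<^esub> = cls \<zero>\<^bsub>K\<^esub>" by simp
      then have "\<one>\<^bsub>K\<^esub> - \<zero>\<^bsub>K\<^esub> \<in> Z"
        unfolding cls_def by (subst (asm) coset_eq_iff) auto
      then show False
        using one_notin_Z by (simp add: K_simps)
    qed
    moreover have "\<one>\<^bsub>Q\<^esub> \<in> ?L"
    proof -
      have "cls 1 \<in> ?L"
        by (rule local[OF is_open_Y assms(1)]) (simp add: one_fun_def regular_on_const is_open_Y)
      then show ?thesis
        using h.hom_one by (simp add: K_simps)
    qed
    ultimately show "[\<one>\<^bsub>Q\<^esub>, cls \<beta>, cls \<gamma>] \<in> carrier (univ_poly Q ?L)"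
      using local[OF W(1,2)] W(3,4) by (simp add: univ_poly_def polynomial_def)
    have "ring.eval Q [\<one>\<^bsub>Q\<^esub>, cls \<beta>, cls \<gamma>] (cls \<phi>) = cls (\<phi> \<otimes>\<^bsub>K\<^esub> \<phi> \<oplus>\<^bsub>K\<^esub> \<beta> \<otimes>\<^bsub>K\<^esub> \<phi> \<oplus>\<^bsub>K\<^esub> \<gamma>)"
      using \<phi> \<beta> \<gamma> by (simp add: numeral_2_eq_2 Q.add.m_assoc)
    also have "\<dots> = \<zero>\<^bsub>Q\<^esub>"
      by (rule zero) (simp add: K_simps eq)
    finally show "ring.eval Q [\<one>\<^bsub>Q\<^esub>, cls \<beta>, cls \<gamma>] (cls \<phi>) = \<zero>\<^bsub>Q\<^esub>" .
  qed
  moreover have "cls \<phi> \<in> carrier Q"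
    using \<phi> by simp
  ultimately have "cls \<phi> \<in> ?L"
    using normal assms(1) by (auto simp: normal_variety_def Q_def)
  then obtain \<psi> W' where \<psi>: "is_open W'" "P \<in> W'" "regular_on V Y W' \<psi>" "cls \<phi> = cls \<psi>"
    unfolding local_ring_at_def cls_def by blast
  then have "\<psi> \<in> carrier K"
    by (auto simp: K_carrier)
  then show False
    using not_regular[OF \<psi>(1-3)] \<psi>(4) coset_eq_iff[OF \<phi>] by (simp add: cls_def)
qed

text \<open>A function on points needs a chosen representative; for numerator and denominator of
  equal degree, \<open>ratio_eq\<close> shows that the choice does not matter.\<close>

definition ratio :: "('v \<Rightarrow> 'a) \<Rightarrow> ('v \<Rightarrow> 'a) \<Rightarrow> 'v set \<Rightarrow> 'a"
  where "ratio f g P = (let v = (SOME v. v \<in> P \<and> v \<noteq> \<zero>\<^bsub>V\<^esub>) in f v / g v)"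

lemma ratio_eq:
  assumes f: "homogeneous_fun V m f" and g: "homogeneous_fun V m g"
    and P: "P \<in> Y" and v: "v \<in> P" "v \<noteq> \<zero>\<^bsub>V\<^esub>"
  shows "ratio f g P = f v / g v"
proof -
  define w where "w = (SOME v. v \<in> P \<and> v \<noteq> \<zero>\<^bsub>V\<^esub>)"
  have w: "w \<in> P" "w \<noteq> \<zero>\<^bsub>V\<^esub>"
    unfolding w_def using someI[of "\<lambda>v. v \<in> P \<and> v \<noteq> \<zero>\<^bsub>V\<^esub>" v] v by auto
  obtain u where u: "u \<in> carrier V" "P = proj_point V u"
    using point[OF P] by blast
  obtain c c' where c: "v = c \<odot>\<^bsub>V\<^esub> u" "w = c' \<odot>\<^bsub>V\<^esub> u"
    using v(1) w(1) by (auto simp: u(2) proj_point_def)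
  then have "c \<noteq> 0" "c' \<noteq> 0"
    using v(2) w(2) zero_smult[OF u(1)] by auto
  then show ?thesis
    unfolding ratio_def w_def[symmetric] Let_def c
    by (simp add: homogeneous_fun_smult[OF f u(1)] homogeneous_fun_smult[OF g u(1)])
qed

lemma ratio_regular:
  assumes f: "homogeneous_fun V m f" and g: "homogeneous_fun V m g"
  shows "regular_on V Y {P \<in> Y. \<exists>v\<in>P. g v \<noteq> 0} (ratio f g)"
proof (rule regular_onI)
  let ?W = "{P \<in> Y. \<exists>v\<in>P. g v \<noteq> 0}"
  fix P assume P: "P \<in> ?W"
  have "\<forall>Q\<in>?W. \<forall>v\<in>Q - {\<zero>\<^bsub>V\<^esub>}. g v \<noteq> 0 \<and> ratio f g Q = f v / g v"
    using ratio_eq[OF f g] homogeneous_nonzero[where f = g, OF g] by blast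
  moreover have "is_open ?W"
    by (rule is_open_nonzero[OF g])
  ultimately show "\<exists>W' m f' g'. is_open W' \<and> P \<in> W' \<and> W' \<subseteq> ?W \<and>
      homogeneous_fun V m f' \<and> homogeneous_fun V m g' \<and>
      (\<forall>Q\<in>W'. \<forall>v\<in>Q - {\<zero>\<^bsub>V\<^esub>}. g' v \<noteq> 0 \<and> ratio f g Q = f' v / g' v)"
    using f g P by (intro exI[of _ ?W] exI[of _ m] exI[of _ f] exI[of _ g] conjI subset_refl)
qed

lemma is_open_basic:
  assumes "is_open W" and "W \<noteq> {}"
  obtains m t where "homogeneous_fun V m t" and "{P \<in> Y. \<exists>v\<in>P. t v \<noteq> 0} \<subseteq> W"
    and "{P \<in> Y. \<exists>v\<in>P. t v \<noteq> 0} \<noteq> {}"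
proof -
  obtain T where T: "\<forall>f\<in>T. \<exists>m. homogeneous_fun V m f" "W = {P \<in> Y. \<exists>f\<in>T. \<exists>v\<in>P. f v \<noteq> 0}"
    using assms(1) by (auto simp: proj_open_def)
  then obtain P t v where "P \<in> Y" "t \<in> T" "v \<in> P" "t v \<noteq> 0"
    using assms(2) by auto
  moreover obtain m where "homogeneous_fun V m t"
    using T(1) \<open>t \<in> T\<close> by auto
  ultimately show ?thesis
    using that T(2) by blast
qed

end

context hpair
begin

lemma Y_memE:
  assumes "P \<in> Y" and "v \<in> P"
  obtains r where "v = q r" and "eqn r = 0"
proof -
  obtain u where "P = proj_point V (q u)" "eqn u = 0"
    using assms(1) by (auto simp: Y_eq)
  then obtain c where "v = q (k c * u)" "eqn (k c * u) = 0"
    using assms(2) by (auto simp: proj_point_q eqn_smult)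
  then show ?thesis by (rule that)
qed

lemma proj_point_mem: "q r \<in> proj_point V (q r)"
  by (auto simp: proj_point_q k_one intro!: image_eqI[of _ _ 1])

lemma proj_point_in_Y: "eqn r = 0 \<Longrightarrow> q r \<noteq> \<zero>\<^bsub>V\<^esub> \<Longrightarrow> proj_point V (q r) \<in> Y"
  unfolding Y_eq by blast

sublocale irreducible_projective V Y
proof
  fix P assume "P \<in> Y"
  then show "\<exists>v\<in>carrier V. v \<noteq> \<zero>\<^bsub>V\<^esub> \<and> P = proj_point V v"
    unfolding Y_eq by auto
next
  fix v assume "v \<in> carrier V"
  then obtain a where "v = q a"
    by (auto simp: carrier_eq)
  then show "0 \<odot>\<^bsub>V\<^esub> v = \<zero>\<^bsub>V\<^esub>" "1 \<odot>\<^bsub>V\<^esub> v = v"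
    by (simp_all add: q_smult[symmetric] k_one q_zero)
next
  show "Y \<noteq> {}"
    using proj_point_s_in_Y by auto
next
  fix m m' f g
  assume fg: "homogeneous_fun V m f" "homogeneous_fun V m' g"
    and nz: "\<exists>P\<in>Y. \<exists>v\<in>P. f v \<noteq> 0" "\<exists>P\<in>Y. \<exists>v\<in>P. g v \<noteq> 0"
  show "\<exists>P\<in>Y. \<exists>v\<in>P. f v \<noteq> 0 \<and> g v \<noteq> 0"
  proof (rule ccontr)
    assume "\<not> ?thesis"
    then have "\<forall>P\<in>Y. \<forall>v\<in>P. f v * g v = 0"
      by auto
    then have "\<forall>v. eqn v = 0 \<longrightarrow> f (q v) * g (q v) = 0"
      by (simp only: Y_vanishing_iff)
    moreover have "qpol (\<lambda>v. f (q v))" "qpol (\<lambda>v. g (q v))"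
      using fg homogeneous_imp_polynomial by (auto simp: qpol_def)
    ultimately have "(\<forall>v. eqn v = 0 \<longrightarrow> f (q v) = 0) \<or> (\<forall>v. eqn v = 0 \<longrightarrow> g (q v) = 0)"
      using qpol_vanishing_prime by blast
    then show False
      using nz unfolding Y_vanishing_iff[symmetric] by blast
  qed
qed

lemma eqn_one: "eqn 1 = 0"
  by (simp add: eqn_def z0_one k_one p_simps(4))

lemma z0_nonzero_nonempty: "z0 = (\<lambda>a. l (q a)) \<Longrightarrow> {P \<in> Y. \<exists>v\<in>P. l v \<noteq> 0} \<noteq> {}"
proof -
  assume "z0 = (\<lambda>a. l (q a))"
  then have "l (q 1) \<noteq> 0"
    using z0_one by (metis zero_neq_one)
  moreover have "q 1 \<noteq> \<zero>\<^bsub>V\<^esub>"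
    using qlin_cong[OF z0_lin, of 1 0] z0_one by (auto simp: z0_simps(4) q_zero)
  ultimately show ?thesis
    using proj_point_in_Y[OF eqn_one] proj_point_mem by blast
qed

end

section \<open>Non-normality along a codimension two subspace\<close>

text \<open>The last three assumptions say that the equation lies in the square of the ideal of the
  subspace \<open>z0 = zi = 0\<close>.\<close>

locale singular_hpair = hpair V q k z0 p s d n
  for V :: "('a::field_char_0, 'v, 'x) module_scheme"
    and q :: "'r::comm_ring_1 \<Rightarrow> 'v"
    and k :: "'a \<Rightarrow> 'r" and z0 p :: "'r \<Rightarrow> 'a" and s :: 'r and d n :: nat +
  fixes zi :: "'r \<Rightarrow> 'a" and x :: 'r
  assumes zi_lin: "quot_linear q k zi"
    and zi_one: "zi 1 = 0" and zi_x: "zi x = 1" and z0_x: "z0 x = 0" and zi_s: "zi s = 0"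
    and p_power_d: "z0 a = 0 \<Longrightarrow> zi a = 0 \<Longrightarrow> p (a ^ d) = 0"
    and p_power_d_x: "z0 a = 0 \<Longrightarrow> zi a = 0 \<Longrightarrow> p (a ^ (d - 1) * x) = 0"
    and p_power_d1: "z0 a = 0 \<Longrightarrow> zi a = 0 \<Longrightarrow> p (a ^ (d - 1)) = 0"
begin

lemmas zi_simps = qlin_add[OF zi_lin] qlin_smult[OF zi_lin] qlin_diff[OF zi_lin] qlin_zero[OF zi_lin]

text \<open>The projection onto \<open>z0 = zi = 0\<close> along 1 and \<open>x\<close>.\<close>

definition T :: "'r \<Rightarrow> 'r"
  where "T v = v - k (z0 v) - k (zi v) * x"

lemma zi_k: "zi (k c) = 0"
  using qlin_smult[OF zi_lin, of c 1] by (simp add: zi_one)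

lemma z0_T: "z0 (T v) = 0" and zi_T: "zi (T v) = 0"
  by (simp_all add: T_def z0_simps zi_simps z0_k zi_k z0_x zi_x)

lemma qhom_p_T: "qhom m (\<lambda>v. p (T v ^ m * w))"
proof (rule qhom_lin_of_power[OF p_lin])
  show "q (T a) = q (T b)" if "q a = q b" for a b
    unfolding T_def qlin_cong[OF z0_lin that] qlin_cong[OF zi_lin that]
    by (intro q_cong_diff that refl)
next
  show "T (k c * a) = k c * T a" for c a
    unfolding T_def z0_simps zi_simps k_mult by (simp add: algebra_simps)
qed (simp add: T_def z0_simps zi_simps k_add algebra_simps)

lemma p_power_expand:
  "p ((v - k (z0 v)) ^ l) = (\<Sum>j\<le>l. of_nat (l choose j) * (zi v ^ j * p (T v ^ (l - j) * x ^ j)))"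
proof -
  have "v - k (z0 v) = k (zi v) * x + T v"
    by (simp add: T_def)
  then have "(v - k (z0 v)) ^ l = (\<Sum>j\<le>l. of_nat (l choose j) * (k (zi v ^ j) * (T v ^ (l - j) * x ^ j)))"
    by (simp only: binomial_ring power_mult_distrib k_power) (simp add: mult_ac)
  then show ?thesis
    by (simp only: qlin_sum[OF p_lin] qlin_of_nat[OF p_lin] p_simps)
qed

text \<open>All but the last two summands of \<open>eqn\<close> contain \<open>z0\<close> squared.
  In those two, z is split as \<open>zi\<close> times \<open>x\<close> plus its projection
  \<open>T\<close>: \<open>p_power_d1\<close> removes the term without \<open>zi\<close> from
  p(z^(d-1)), while \<open>p_power_d\<close> and \<open>p_power_d_x\<close> remove the terms of
  order 0 and 1 in \<open>zi\<close> from p(z^d).\<close>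

lemma eqn_in_square:
  obtains a b c where "qhom (d - 2) a" "qhom (d - 2) b" "qhom (d - 2) c"
    and "\<And>v. eqn v = a v * z0 v ^ 2 + b v * z0 v * zi v + c v * zi v ^ 2"
proof -
  obtain e where d: "d = Suc (Suc e)"
    using d_ge_2 by (auto simp: le_iff_add)
  define y where "y v = v - k (z0 v)" for v
  define co :: "nat \<Rightarrow> 'a" where "co m = (-1) ^ m / of_nat (Suc m)" for m
  define a where "a v = (\<Sum>m<e. co m * (z0 v ^ (e - Suc m) * p (y v ^ Suc m)))" for v
  define b where "b v = (\<Sum>j\<le>e. of_nat (Suc e choose Suc j) * (zi v ^ j * p (T v ^ (e - j) * x ^ Suc j)))" for v
  define c where "c v = (\<Sum>j\<le>e. of_nat (d choose Suc (Suc j)) * (zi v ^ j * p (T v ^ (e - j) * x ^ Suc (Suc j))))" for v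
  have b: "p (y v ^ Suc e) = b v * zi v" for v
  proof -
    have "p (T v ^ Suc e) = 0"
      using p_power_d1[OF z0_T zi_T] by (simp add: d)
    then show ?thesis
      unfolding y_def p_power_expand sum.atMost_Suc_shift b_def sum_distrib_right
      by (simp add: mult_ac)
  qed
  have c: "p (y v ^ d) = c v * zi v ^ 2" for v
  proof -
    have "p (T v ^ Suc (Suc e)) = 0" "p (T v ^ Suc e * x) = 0"
      using p_power_d[OF z0_T zi_T] p_power_d_x[OF z0_T zi_T] by (simp_all add: d)
    then show ?thesis
      unfolding y_def p_power_expand d sum.atMost_Suc_shift c_def sum_distrib_right
      by (simp add: mult_ac power2_eq_square)
  qed
  have "qhom e (\<lambda>v. a v)"
    unfolding a_def
  proof (intro qhom_sum qhom_cmult)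
    fix m assume "m \<in> {..<e}"
    then show "qhom e (\<lambda>v. z0 v ^ (e - Suc m) * p (y v ^ Suc m))"
      using qhom_mult[OF qhom_lin_power[OF z0_lin, of "e - Suc m"] qhom_p_power[of "Suc m" 1]]
      by (simp add: y_def del: power_Suc)
  qed
  moreover have zT: "qhom e (\<lambda>v. zi v ^ j * p (T v ^ (e - j) * w))" if "j \<in> {..e}" for j w
    using qhom_mult[OF qhom_lin_power[OF zi_lin, of j] qhom_p_T[of "e - j" w]] that by simp
  then have "qhom e b" "qhom e c"
    unfolding b_def c_def by (auto intro!: qhom_sum qhom_cmult simp del: power_Suc)
  moreover have "eqn v = a v * z0 v ^ 2 + co e * b v * z0 v * zi v + co (Suc e) * c v * zi v ^ 2" for v
  proof -
    have "eqn v = (\<Sum>m<e. co m * (z0 v ^ (d - Suc m) * p (y v ^ Suc m))) +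
        co e * (z0 v * (b v * zi v)) + co (Suc e) * (c v * zi v ^ 2)"
    proof -
      have split: "(\<Sum>m<d. G m) = (\<Sum>m<e. G m) + G e + G (Suc e)" for G :: "nat \<Rightarrow> 'a"
        by (simp add: d)
      show ?thesis
        unfolding eqn_def y_def[symmetric] co_def[symmetric] split b c d[symmetric]
        by (simp add: d)
    qed
    also have "(\<Sum>m<e. co m * (z0 v ^ (d - Suc m) * p (y v ^ Suc m))) = a v * z0 v ^ 2"
      unfolding a_def sum_distrib_right
    proof (rule sum.cong)
      fix m assume "m \<in> {..<e}"
      then have "d - Suc m = (e - Suc m) + 2"
        by (auto simp: d)
      then show "co m * (z0 v ^ (d - Suc m) * p (y v ^ Suc m)) =
          co m * (z0 v ^ (e - Suc m) * p (y v ^ Suc m)) * z0 v ^ 2"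
        by (simp only: power_add) (simp only: mult_ac)
    qed simp
    finally show ?thesis
      by (simp add: mult_ac)
  qed
  ultimately show ?thesis
    using that[of a "\<lambda>v. co e * b v" "\<lambda>v. co (Suc e) * c v"] by (simp add: d qhom_cmult)
qed

theorem not_normal: "\<not> normal_variety V Y"
proof -
  obtain a b c where abc: "qhom (d - 2) a" "qhom (d - 2) b" "qhom (d - 2) c"
    and eqn: "\<And>v. eqn v = a v * z0 v ^ 2 + b v * z0 v * zi v + c v * zi v ^ 2"
    using eqn_in_square by blast
  obtain a' b' c' where abc': "homogeneous_fun V (d - 2) a'" "homogeneous_fun V (d - 2) b'"
      "homogeneous_fun V (d - 2) c'"
    and abc_q: "a = (\<lambda>v. a' (q v))" "b = (\<lambda>v. b' (q v))" "c = (\<lambda>v. c' (q v))"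
    using abc unfolding qhom_def by blast
  obtain l0 where l0: "linear_form V l0" "z0 = (\<lambda>v. l0 (q v))"
    by (rule qlin_imp_linear_form[OF z0_lin])
  obtain li where li: "linear_form V li" "zi = (\<lambda>v. li (q v))"
    by (rule qlin_imp_linear_form[OF zi_lin])
  obtain lp where lp: "linear_form V lp" "p = (\<lambda>v. lp (q v))"
    by (rule qlin_imp_linear_form[OF p_lin])
  note hom = homogeneous_fun_linear[OF l0(1)] homogeneous_fun_linear[OF li(1)]
    homogeneous_fun_linear[OF lp(1)]
  define e where "e = d - 2"
  note abc' = abc'[folded e_def]
  define P where "P = proj_point V (q s)"
  have P: "P \<in> Y" "q s \<in> P" "q s \<noteq> \<zero>\<^bsub>V\<^esub>"
    using proj_point_s_in_Y proj_point_mem q_s_nonzero by (simp_all add: P_def)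
  \<comment> \<open>The normalizing denominator: it has the degree \<open>e\<close> of c z_i / z_0
    and is non-zero at \<open>P\<close>, because \<open>p s = 1\<close>.\<close>
  define L where "L v = lp v ^ e" for v
  have L: "homogeneous_fun V e L"
    using homogeneous_fun_power[OF hom(3), of e] by (simp add: L_def[abs_def])
  define num where "num v = li v * c' v" for v
  define den where "den v = l0 v * L v" for v
  have num: "homogeneous_fun V (1 + e) num" and den: "homogeneous_fun V (1 + e) den"
    unfolding num_def[abs_def] den_def[abs_def] by (intro homogeneous_fun_mult hom abc' L)+
  let ?D = "\<lambda>f. {Q \<in> Y. \<exists>v\<in>Q. f v \<noteq> 0}"
  define W where "W = ?D L"
  have W: "is_open W" "P \<in> W"
    using is_open_nonzero[OF L] P p_s by (auto simp: W_def L_def lp(2) intro!: bexI[of _ "q s"])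
  have den_open: "is_open (?D den)" "?D den \<noteq> {}"
  proof -
    have "?D l0 \<inter> W \<noteq> {}"
      using is_open_Int_nonempty[OF is_open_nonzero[OF hom(1)] W(1) z0_nonzero_nonempty[OF l0(2)]] W(2)
      by auto
    then obtain Q v w where Q: "Q \<in> Y" "v \<in> Q" "l0 v \<noteq> 0" "w \<in> Q" "L w \<noteq> 0"
      by (auto simp: W_def)
    obtain u where u: "u \<in> Q" "u \<noteq> \<zero>\<^bsub>V\<^esub>"
      using nonzero_representative[OF Q(1)] by blast
    have "l0 u \<noteq> 0" "L u \<noteq> 0"
      using homogeneous_nonzero[where f = l0, OF hom(1) Q(1,2,3) u]
        homogeneous_nonzero[where f = L, OF L Q(1,4,5) u] by auto
    then show "?D den \<noteq> {}"
      using Q(1) u(1) by (auto simp: den_def)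
  qed (rule is_open_nonzero[OF den])
  define \<phi> where "\<phi> = ratio num den"
  have \<phi>: "\<phi> Q = num v / den v" if "Q \<in> Y" "v \<in> Q" "v \<noteq> \<zero>\<^bsub>V\<^esub>" for Q v
    unfolding \<phi>_def by (rule ratio_eq[OF num den that])
  define \<beta> where "\<beta> = ratio b' L"
  define \<gamma> where "\<gamma> = ratio (\<lambda>v. a' v * c' v) (\<lambda>v. L v * L v)"
  show ?thesis
  proof (rule not_normal_variety[OF P(1) _ W])
    show "\<phi> \<in> carrier K"
      unfolding K_carrier \<phi>_def using den_open ratio_regular[OF num den] by blast
    show "regular_on V Y W \<beta>"
      unfolding W_def \<beta>_def by (rule ratio_regular[OF abc'(2) L])
    have "W = ?D (\<lambda>v. L v * L v)"
      by (simp add: W_def)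
    then show "regular_on V Y W \<gamma>"
      unfolding \<gamma>_def using ratio_regular[OF homogeneous_fun_mult[OF abc'(1,3)] homogeneous_fun_mult[OF L L]]
      by simp
    have "(\<phi> * \<phi> + \<beta> * \<phi> + \<gamma>) Q = 0" if Q: "Q \<in> ?D den" for Q
    proof -
      obtain v where v: "v \<in> Q" "v \<noteq> \<zero>\<^bsub>V\<^esub>"
        using nonzero_representative Q by blast
      then have nz: "den v \<noteq> 0"
        using homogeneous_nonzero[where f = den, OF den] Q by blast
      obtain r where r: "v = q r" "eqn r = 0"
        using Y_memE Q v(1) by blast
      have z: "z0 r \<noteq> 0" "L v \<noteq> 0" "l0 v = z0 r" "li v = zi r"
        using nz by (simp_all add: den_def r(1) l0(2) li(2))
      have "\<beta> Q = b r / L v" "\<gamma> Q = a r * c r / (L v * L v)" "\<phi> Q = zi r * c r / (z0 r * L v)"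
        using Q ratio_eq[OF abc'(2) L _ v] \<phi>[OF _ v]
          ratio_eq[OF homogeneous_fun_mult[OF abc'(1,3)] homogeneous_fun_mult[OF L L] _ v]
        by (simp_all add: \<beta>_def \<gamma>_def num_def den_def abc_q r(1) z[unfolded r(1)])
      then have "(\<phi> * \<phi> + \<beta> * \<phi> + \<gamma>) Q = zi r * c r / (z0 r * L v) * (zi r * c r / (z0 r * L v)) +
          b r / L v * (zi r * c r / (z0 r * L v)) + a r * c r / (L v * L v)"
        by (simp only: plus_fun_apply times_fun_apply)
      \<comment> \<open>Multiplying \<open>eqn\<close> by c makes it a quadratic in c z_i; division
        by the square of z_0 L makes it monic in \<open>\<phi>\<close>.\<close>
      also have "\<dots> = c r * eqn r / ((z0 r * L v) * (z0 r * L v))"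
        using z(1,2) by (simp add: eqn field_simps power2_eq_square)
      finally have "(\<phi> * \<phi> + \<beta> * \<phi> + \<gamma>) Q = c r * eqn r / ((z0 r * L v) * (z0 r * L v))" .
      then show ?thesis
        by (simp add: r(2))
    qed
    then show "\<phi> * \<phi> + \<beta> * \<phi> + \<gamma> \<in> Z"
      unfolding Z_iff using den_open by blast
  next
    fix W' \<psi> assume W': "is_open W'" "P \<in> W'" "regular_on V Y W' \<psi>"
    show "\<phi> - \<psi> \<notin> Z"
    proof
      assume "\<phi> - \<psi> \<in> Z"
      then obtain W1 where W1: "is_open W1" "W1 \<noteq> {}" "\<And>Q. Q \<in> W1 \<Longrightarrow> \<phi> Q = \<psi> Q"
        by (auto simp: Z_iff)
      obtain W2 m f g where W2: "is_open W2" "P \<in> W2" "homogeneous_fun V m f" "homogeneous_fun V m g"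
        "\<forall>Q\<in>W2. \<forall>v\<in>Q - {\<zero>\<^bsub>V\<^esub>}. g v \<noteq> 0 \<and> \<psi> Q = f v / g v"
        using bspec[OF W'(3)[unfolded regular_on_def] W'(2)] by (elim exE conjE)
      have "W1 \<inter> W2 \<noteq> {}"
        using is_open_Int_nonempty[OF W1(1) W2(1) W1(2)] W2(2) by auto
      then have "W1 \<inter> W2 \<inter> ?D den \<noteq> {}"
        by (rule is_open_Int_nonempty[OF is_open_Int[OF W1(1) W2(1)] den_open(1) _ den_open(2)])
      then obtain m' t where t: "homogeneous_fun V m' t" "?D t \<subseteq> W1 \<inter> W2 \<inter> ?D den" "?D t \<noteq> {}"
        using is_open_basic[OF is_open_Int[OF is_open_Int[OF W1(1) W2(1)] den_open(1)]] by blast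
      \<comment> \<open>The equality of num / den and f / g, cross-multiplied and pulled
        back.\<close>
      define G where "G r = zi r * c r * g (q r) - z0 r * L (q r) * f (q r)" for r
      have pol: "qpol (\<lambda>r. t (q r))" "qpol (\<lambda>r. g (q r))" "qpol (\<lambda>r. f (q r))" "qpol (\<lambda>r. L (q r))"
        using t(1) W2(3,4) L homogeneous_imp_polynomial by (auto simp: qpol_def)
      note pol = pol qpol_lin[OF z0_lin] qpol_lin[OF zi_lin] qhom_imp_qpol[OF abc(3)]
      have G: "qpol G"
        unfolding G_def[abs_def] by (intro qpol_diff qpol_mult pol)
      \<comment> \<open>The two fractions agree only on an open set; \<open>t\<close> vanishes off a
        basic open subset of it, so the product vanishes on the whole cone and primality can remove
        \<open>t\<close>.\<close>
      have "t (q r) * G r = 0" if r: "eqn r = 0" for r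
      proof (cases "q r = \<zero>\<^bsub>V\<^esub> \<or> t (q r) = 0")
        case True
        then show ?thesis
        proof
          assume "q r = \<zero>\<^bsub>V\<^esub>"
          then have "q r = q 0"
            by (simp only: q_zero)
          then have "z0 r = z0 0" "zi r = zi 0"
            by (rule qlin_cong[OF z0_lin], rule qlin_cong[OF zi_lin])
          then show ?thesis
            by (simp add: G_def z0_simps(4) zi_simps(4))
        qed simp
      next
        case False
        let ?Q = "proj_point V (q r)"
        have Q: "?Q \<in> Y" "q r \<in> ?Q"
          using proj_point_in_Y[OF r] False proj_point_mem by auto
        then have "?Q \<in> ?D t"
          using False by blast
        then have Q': "?Q \<in> W1" "?Q \<in> W2" "?Q \<in> ?D den"
          using t(2) by auto
        have den_nz: "den (q r) \<noteq> 0"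
          using homogeneous_nonzero[where f = den, OF den Q(1)] Q'(3) Q(2) False by blast
        have "num (q r) / den (q r) = f (q r) / g (q r)" "g (q r) \<noteq> 0"
          using W2(5)[rule_format, OF Q'(2), of "q r"] Q(2) W1(3)[OF Q'(1)] \<phi>[OF Q] False by auto
        then have "num (q r) * g (q r) = den (q r) * f (q r)"
          using den_nz by (simp add: frac_eq_eq mult_ac)
        then show ?thesis
          by (simp add: G_def num_def den_def li(2) l0(2) abc_q)
      qed
      then have "(\<forall>r. eqn r = 0 \<longrightarrow> t (q r) = 0) \<or> (\<forall>r. eqn r = 0 \<longrightarrow> G r = 0)"
        by (rule qpol_vanishing_prime[OF pol(1) G])
      moreover have "\<not> (\<forall>r. eqn r = 0 \<longrightarrow> t (q r) = 0)"
        using t(3) unfolding Y_vanishing_iff[symmetric] by blast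
      ultimately obtain H where H: "qpol H" "\<And>r. G r = eqn r * H r"
        using qpol_vanishing_factor[OF G] by metis
      \<comment> \<open>On \<open>z0 = 0\<close> the term with f drops out of \<open>G\<close> and
        \<open>eqn\<close> reduces to c z_i^2, so both sides of \<open>G = eqn * H\<close> share the
        factor z_i c.\<close>
      have "zi r * c r * (g (q r) - zi r * H r) = 0" if "z0 r = 0" for r
        using H(2)[of r] that by (simp add: G_def eqn power2_eq_square algebra_simps)
      then have "(\<forall>r. z0 r = 0 \<longrightarrow> zi r * c r = 0) \<or> (\<forall>r. z0 r = 0 \<longrightarrow> g (q r) - zi r * H r = 0)"
        by (intro qpol_mult_eq_0_hyperplane[OF _ _ z0_lin] qpol_mult qpol_diff pol H(1))
      moreover have "\<not> (\<forall>r. z0 r = 0 \<longrightarrow> zi r * c r = 0)"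
      proof
        assume "\<forall>r. z0 r = 0 \<longrightarrow> zi r * c r = 0"
        then have "eqn r = 0" if "z0 r = 0" for r
          using that by (auto simp: eqn power2_eq_square)
        then show False
          using eqn_nonzero_at_infinity by blast
      qed
      ultimately have "g (q s) = 0"
        using z0_s zi_s by auto
      then show False
        using W2(5)[rule_format, OF W2(2), of "q s"] P(2,3) by simp
    qed
  qed
qed

end

section \<open>Monomials\<close>

lemma cell_size_add: "cell_size (a + b) = cell_size a + cell_size b"
  by (simp add: cell_size_def lookup_add sum.distrib)

lemma cell_size_single: "cell_size (Poly_Mapping.single i m) = m"
  by (simp add: cell_size_def lookup_single when_def)

lemma cell_size_eq_0_iff: "cell_size \<kappa> = 0 \<longleftrightarrow> \<kappa> = 0"
  by (auto simp: cell_size_def poly_mapping_eq_iff fun_eq_iff)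

lemma lookup_le_cell_size: "Poly_Mapping.lookup \<kappa> i \<le> cell_size \<kappa>"
  unfolding cell_size_def by (rule member_le_sum) auto

lemma cell_size_eq_1D:
  assumes "cell_size \<kappa> = 1"
  obtains i where "\<kappa> = Poly_Mapping.single i 1"
proof -
  have "\<kappa> \<noteq> 0"
    using assms by (auto simp: cell_size_def)
  then obtain i where i: "Poly_Mapping.lookup \<kappa> i \<noteq> 0"
    by (auto simp: poly_mapping_eq_iff fun_eq_iff)
  have "Poly_Mapping.lookup \<kappa> j = Poly_Mapping.lookup (Poly_Mapping.single i 1) j" for j
  proof (cases "j = i")
    case True
    then show ?thesis
      using i lookup_le_cell_size[of \<kappa> i] assms by simp
  next
    case False
    have "Poly_Mapping.lookup \<kappa> i + Poly_Mapping.lookup \<kappa> j = (\<Sum>l\<in>{i, j}. Poly_Mapping.lookup \<kappa> l)"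
      using False by simp
    also have "\<dots> \<le> cell_size \<kappa>"
      unfolding cell_size_def by (rule sum_mono2) auto
    finally show ?thesis
      using i False assms by (simp add: lookup_single)
  qed
  then have "\<kappa> = Poly_Mapping.single i 1"
    by (rule poly_mapping_eqI)
  with that show ?thesis .
qed

lemma sum_single_lookup:
  "(\<Sum>\<kappa>\<in>Poly_Mapping.keys f. Poly_Mapping.single \<kappa> (Poly_Mapping.lookup f \<kappa>)) = f"
  by (rule poly_mapping_eqI)
    (auto simp: lookup_sum lookup_single when_def sum.delta in_keys_iff)

lemma lookup_single_0_mult:
  "Poly_Mapping.lookup (Poly_Mapping.single 0 c * f) \<kappa> = c * Poly_Mapping.lookup f \<kappa>"
  for f :: "('b::comm_monoid_add \<Rightarrow>\<^sub>0 'a::semiring_0)"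
  by (simp add: mult_map_scale_conv_mult[symmetric] Poly_Mapping.map.rep_eq when_def)

text \<open>An exponent occurring in \<open>f ^ m\<close> is a sum of m exponents of
  \<open>f\<close>, so bounds additive in the pair of m and exponent pass from \<open>f\<close> to
  its powers. Size and weight are the two instances.\<close>

lemma keys_power_induct:
  fixes f :: "('b::comm_monoid_add) \<Rightarrow>\<^sub>0 'a::comm_semiring_1"
  assumes "\<And>\<kappa>. \<kappa> \<in> Poly_Mapping.keys f \<Longrightarrow> P 1 \<kappa>" and "P 0 0"
    and "\<And>m \<kappa> \<kappa>'. P 1 \<kappa> \<Longrightarrow> P m \<kappa>' \<Longrightarrow> P (Suc m) (\<kappa> + \<kappa>')"
    and "\<kappa> \<in> Poly_Mapping.keys (f ^ m)"
  shows "P m \<kappa>"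
  using assms(4)
proof (induct m arbitrary: \<kappa>)
  case 0
  then show ?case
    using assms(2) by (simp split: if_splits)
next
  case (Suc m)
  then obtain \<alpha> \<beta> where "\<kappa> = \<alpha> + \<beta>" "\<alpha> \<in> Poly_Mapping.keys f" "\<beta> \<in> Poly_Mapping.keys (f ^ m)"
    using keys_mult[of f "f ^ m"] by auto
  then show ?case
    using Suc(1) assms(1,3) by blast
qed

lemma keys_power_size:
  fixes f :: "('k::finite \<Rightarrow>\<^sub>0 nat) \<Rightarrow>\<^sub>0 'a::comm_semiring_1"
  assumes "Poly_Mapping.lookup f 0 = 0" and "\<kappa> \<in> Poly_Mapping.keys (f ^ m)"
  shows "m \<le> cell_size \<kappa>"
proof (rule keys_power_induct[OF _ _ _ assms(2)])
  show "1 \<le> cell_size \<kappa>" if "\<kappa> \<in> Poly_Mapping.keys f" for \<kappa>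
  proof -
    have "\<kappa> \<noteq> 0"
      using that assms(1) by (auto simp: in_keys_iff)
    then show ?thesis
      using cell_size_eq_0_iff[of \<kappa>] by simp
  qed
qed (simp_all add: cell_size_add)

text \<open>The weight \<open>2 |\<kappa>| - \<kappa>\<^sub>i\<close> is at least 2 on every monomial other than 1 and \<open>x\<^sub>i\<close>.\<close>

lemma keys_power_weight:
  fixes f :: "('k::finite \<Rightarrow>\<^sub>0 nat) \<Rightarrow>\<^sub>0 'a::comm_semiring_1"
  assumes "Poly_Mapping.lookup f 0 = 0" and "Poly_Mapping.lookup f (Poly_Mapping.single i 1) = 0"
    and "\<kappa> \<in> Poly_Mapping.keys (f ^ m)"
  shows "Poly_Mapping.lookup \<kappa> i + 2 * m \<le> 2 * cell_size \<kappa>"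
proof (rule keys_power_induct[OF _ _ _ assms(3)])
  show "Poly_Mapping.lookup \<kappa> i + 2 * 1 \<le> 2 * cell_size \<kappa>" if \<kappa>: "\<kappa> \<in> Poly_Mapping.keys f" for \<kappa>
  proof -
    have "\<kappa> \<noteq> 0" "\<kappa> \<noteq> Poly_Mapping.single i 1"
      using \<kappa> assms(1,2) by (auto simp: in_keys_iff)
    \<comment> \<open>For size at least 2 the weight is at least the size, since
      \<open>\<kappa>\<close> has i-th coordinate at most its size. A cell of size 1 other than e_i
      has i-th coordinate 0.\<close>
    then consider "cell_size \<kappa> \<ge> 2" | j where "\<kappa> = Poly_Mapping.single j 1" "j \<noteq> i"
      using cell_size_eq_0_iff[of \<kappa>] cell_size_eq_1D[of \<kappa>]
      by (metis One_nat_def Suc_1 Suc_leI le_less_Suc_eq less_one not_le)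
    then show ?thesis
    proof cases
      case 1
      then show ?thesis
        using lookup_le_cell_size[of \<kappa> i] by simp
    next
      case 2
      then show ?thesis
        by (simp add: cell_size_single lookup_single)
    qed
  qed
qed (simp_all add: cell_size_add lookup_add)

lemma single_cell_le: "Poly_Mapping.lookup \<mu> i \<noteq> 0 \<Longrightarrow> Poly_Mapping.single i 1 \<preceq> \<mu>"
  by (auto simp: cell_le_def lookup_single when_def)

section \<open>The algebra of a Young diagram\<close>

text \<open>The relations make every corner monomial a multiple of the one for
  \<open>\<mu>0\<close>, which will span the complement of the hyperplane in the maximal
  ideal.\<close>

locale diagram =
  fixes \<Lambda> :: "('k::finite \<Rightarrow>\<^sub>0 nat) set" and b :: "('k \<Rightarrow>\<^sub>0 nat) \<Rightarrow> 'a::field_char_0"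
    and \<mu>0 :: "'k \<Rightarrow>\<^sub>0 nat"
  assumes young: "young_diagram \<Lambda>" and nonexc: "non_exceptional \<Lambda>"
    and \<mu>0: "\<mu>0 \<in> corner_cells \<Lambda>" "b \<mu>0 \<noteq> 0"
begin

abbreviation "C \<equiv> corner_cells \<Lambda>"
abbreviation "I \<equiv> diagram_ideal \<Lambda> b"
abbreviation q where "q \<equiv> diagram_class \<Lambda> b"
abbreviation V where "V \<equiv> diagram_algebra \<Lambda> b"
abbreviation R where "R \<equiv> (poly_ring :: (('k \<Rightarrow>\<^sub>0 nat) \<Rightarrow>\<^sub>0 'a) ring)"

definition k :: "'a \<Rightarrow> ('k \<Rightarrow>\<^sub>0 nat) \<Rightarrow>\<^sub>0 'a"
  where "k c = Poly_Mapping.single 0 c"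

definition z0 :: "(('k \<Rightarrow>\<^sub>0 nat) \<Rightarrow>\<^sub>0 'a) \<Rightarrow> 'a"
  where "z0 f = Poly_Mapping.lookup f 0"

text \<open>In the quotient x^\<mu> is \<open>b \<mu>\<close> times \<open>s\<close> for every
  corner \<open>\<mu>\<close>, so this reads off the coefficient at \<open>s\<close>.\<close>

definition p :: "(('k \<Rightarrow>\<^sub>0 nat) \<Rightarrow>\<^sub>0 'a) \<Rightarrow> 'a"
  where "p f = (\<Sum>\<mu>\<in>C. b \<mu> * Poly_Mapping.lookup f \<mu>)"

definition s :: "('k \<Rightarrow>\<^sub>0 nat) \<Rightarrow>\<^sub>0 'a"
  where "s = Poly_Mapping.single \<mu>0 (inverse (b \<mu>0))"

definition d :: nat
  where "d = Max (cell_size ` {\<mu>\<in>C. b \<mu> \<noteq> 0})"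

definition n :: nat
  where "n = Max (cell_size ` \<Lambda>)"

lemma finite_\<Lambda>: "finite \<Lambda>" and down_closed: "\<mu> \<in> \<Lambda> \<Longrightarrow> \<kappa> \<preceq> \<mu> \<Longrightarrow> \<kappa> \<in> \<Lambda>"
  and each_direction: "\<exists>\<kappa>\<in>\<Lambda>. Poly_Mapping.lookup \<kappa> i \<noteq> 0"
  using young unfolding young_diagram_def by blast+

lemma C_subset: "C \<subseteq> \<Lambda>"
  by (auto simp: corner_cells_def)

lemma finite_C: "finite C"
  using C_subset finite_\<Lambda> by (rule finite_subset)

lemma corner_maximal: "\<mu> \<in> C \<Longrightarrow> \<kappa> \<in> \<Lambda> \<Longrightarrow> \<mu> \<preceq> \<kappa> \<Longrightarrow> \<kappa> = \<mu>"
  by (auto simp: corner_cells_def)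

lemma single_in_\<Lambda>: "Poly_Mapping.single i 1 \<in> \<Lambda>"
proof -
  obtain \<kappa> where "\<kappa> \<in> \<Lambda>" "Poly_Mapping.lookup \<kappa> i \<noteq> 0"
    using each_direction by blast
  then show ?thesis
    using down_closed[OF _ single_cell_le] by blast
qed

lemma zero_in_\<Lambda>: "0 \<in> \<Lambda>"
  by (rule down_closed[OF single_in_\<Lambda>]) (simp add: cell_le_def)

text \<open>A corner e_i would leave no other cell with non-zero i-th coordinate, so the diagram
  would be exceptional. This is where non-exceptionality enters; it yields \<open>2 \<le> d\<close>
  and keeps 0 and every e_i away from the corners.\<close>

lemma corner_size: 
  assumes "\<mu> \<in> C"
  shows "2 \<le> cell_size \<mu>"
proof (rule ccontr)
  assume "\<not> ?thesis"
  then consider "cell_size \<mu> = 0" | "cell_size \<mu> = 1"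
    by linarith
  then show False
  proof cases
    case 1
    then have "\<mu> = 0"
      by (simp add: cell_size_eq_0_iff)
    then have "Poly_Mapping.single (undefined :: 'k) 1 = \<mu>"
      by (intro corner_maximal[OF assms single_in_\<Lambda>]) (simp add: cell_le_def)
    then show ?thesis
      using 1 cell_size_single[of "undefined :: 'k" 1] by auto
  next
    case 2
    then obtain i where i: "\<mu> = Poly_Mapping.single i 1"
      by (rule cell_size_eq_1D)
    then have "exceptional_wrt \<Lambda> i"
      using corner_maximal[OF assms, unfolded i, OF _ single_cell_le] unfolding exceptional_wrt_def by blast
    then show ?thesis
      using nonexc by (auto simp: non_exceptional_def)
  qed
qed

lemma corner_plus_notin: "\<mu> \<in> C \<Longrightarrow> \<alpha> \<noteq> 0 \<Longrightarrow> \<alpha> + \<mu> \<notin> \<Lambda>"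
proof
  assume \<mu>: "\<mu> \<in> C" "\<alpha> \<noteq> 0" "\<alpha> + \<mu> \<in> \<Lambda>"
  then have "\<alpha> + \<mu> = \<mu>"
    by (intro corner_maximal) (simp_all add: cell_le_def lookup_add)
  then show False
    using \<mu>(2) by simp
qed

lemma plus_notin: "\<kappa> \<notin> \<Lambda> \<Longrightarrow> \<alpha> + \<kappa> \<notin> \<Lambda>"
  using down_closed[of "\<alpha> + \<kappa>" \<kappa>] by (auto simp: cell_le_def lookup_add)

subsection \<open>The ideal\<close>

text \<open>The ideal described by linear conditions on coefficients, so that forms on the quotient
  can be checked for well-definedness; \<open>I_eq_J\<close> identifies it with the ideal given by
  generators.\<close>

definition J :: "(('k \<Rightarrow>\<^sub>0 nat) \<Rightarrow>\<^sub>0 'a) set"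
  where "J = {f. (\<forall>\<kappa>\<in>\<Lambda> - C. Poly_Mapping.lookup f \<kappa> = 0) \<and> p f = 0}"

lemma p_add: "p (f + g) = p f + p g"
  by (simp add: p_def lookup_add distrib_left sum.distrib)

lemma p_scale: "p (k c * f) = c * p f"
  by (simp add: p_def k_def lookup_single_0_mult sum_distrib_left mult.left_commute)

lemma p_minus: "p (f - g) = p f - p g"
  using p_add[of "f - g" g] by simp

lemma p_eq_0I: "(\<And>\<mu>. \<mu> \<in> C \<Longrightarrow> b \<mu> \<noteq> 0 \<Longrightarrow> \<mu> \<notin> Poly_Mapping.keys f) \<Longrightarrow> p f = 0"
  unfolding p_def by (intro sum.neutral) (auto simp: in_keys_iff)

lemma p_single: "p (Poly_Mapping.single \<kappa> c) = (if \<kappa> \<in> C then b \<kappa> * c else 0)"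
  by (auto simp: p_def lookup_single when_def finite_C if_distrib sum.delta' cong: if_cong)

lemma JI_keys: "Poly_Mapping.keys f \<inter> \<Lambda> = {} \<Longrightarrow> f \<in> J"
  unfolding J_def using C_subset by (auto intro!: p_eq_0I simp: in_keys_iff[symmetric] simp flip: in_keys_iff)

text \<open>Split off the constant term of \<open>g\<close>. The rest only has non-zero exponents,
  and adding one to a corner or to an exponent outside the diagram leads outside the
  diagram.\<close>

lemma J_mult:
  assumes "f \<in> J"
  shows "g * f \<in> J"
proof -
  define g' where "g' = g - k (Poly_Mapping.lookup g 0)"
  have "g' * f \<in> J"
  proof (rule JI_keys, rule ccontr)
    assume "Poly_Mapping.keys (g' * f) \<inter> \<Lambda> \<noteq> {}"
    then obtain \<alpha> \<kappa> where *: "\<alpha> \<in> Poly_Mapping.keys g'" "\<kappa> \<in> Poly_Mapping.keys f" "\<alpha> + \<kappa> \<in> \<Lambda>"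
      using keys_mult[of g' f] by blast
    have "\<alpha> \<noteq> 0"
      using *(1) by (auto simp: g'_def k_def in_keys_iff lookup_minus)
    moreover have "\<kappa> \<notin> \<Lambda> \<or> \<kappa> \<in> C"
      using *(2) assms by (auto simp: J_def in_keys_iff)
    ultimately show False
      using *(3) corner_plus_notin plus_notin by blast
  qed
  moreover have "k (Poly_Mapping.lookup g 0) * f \<in> J"
    using assms by (simp add: J_def p_scale) (simp add: k_def lookup_single_0_mult)
  moreover have "g * f = g' * f + k (Poly_Mapping.lookup g 0) * f"
    by (simp add: g'_def algebra_simps)
  ultimately show ?thesis
    by (simp add: J_def p_add lookup_add)
qed

lemma cring_R: "cring R"
  by (rule cring_from_type_algebra)

sublocale R: cring R
  by (rule cring_R)

lemma R_simps: "f \<oplus>\<^bsub>R\<^esub> g = f + g" "f \<otimes>\<^bsub>R\<^esub> g = f * g" "\<one>\<^bsub>R\<^esub> = 1" "\<zero>\<^bsub>R\<^esub> = 0" "carrier R = UNIV"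
  by (simp_all add: ring_of_type_algebra_def)

lemma ideal_J: "ideal J R"
proof (rule idealI[OF R.ring_axioms R.add.subgroupI])
  show "\<ominus>\<^bsub>R\<^esub> f \<in> J" if "f \<in> J" for f
    using J_mult[OF that, of "- 1"] by (simp add: a_inv_ring_of_type_algebra)
  show "J \<noteq> {}"
    by (auto simp: J_def p_def intro: exI[of _ 0])
  show "g \<otimes>\<^bsub>R\<^esub> f \<in> J" "f \<otimes>\<^bsub>R\<^esub> g \<in> J" if "f \<in> J" for f g
    using J_mult[OF that, of g] by (simp_all add: R_simps mult.commute)
qed (auto simp: R_simps J_def p_add lookup_add)

lemma ideal_I: "ideal I R"
  unfolding diagram_ideal_def by (rule R.genideal_ideal) (simp add: R_simps)

lemma I_add: "f \<in> I \<Longrightarrow> g \<in> I \<Longrightarrow> f + g \<in> I"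
  using additive_subgroup.a_closed[OF ideal.axioms(1)[OF ideal_I]] by (simp add: R_simps)

lemma I_zero: "0 \<in> I"
  using additive_subgroup.zero_closed[OF ideal.axioms(1)[OF ideal_I]] by (simp add: R_simps)

lemma I_mult: "f \<in> I \<Longrightarrow> g * f \<in> I"
  using ideal.I_l_closed[OF ideal_I, of f g] by (simp add: R_simps)

lemma I_generators:
  "{Poly_Mapping.single \<kappa> 1 |\<kappa>. \<kappa> \<notin> \<Lambda>} \<union>
     {Poly_Mapping.single \<mu> (b \<nu>) - Poly_Mapping.single \<nu> (b \<mu>) |\<mu> \<nu>. \<mu> \<in> C \<and> \<nu> \<in> C} \<subseteq> I"
  unfolding diagram_ideal_def by (rule R.genideal_self) (simp add: R_simps)

lemma I_subset_J: "I \<subseteq> J"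
  unfolding diagram_ideal_def
proof (rule R.genideal_minimal[OF ideal_J], intro Un_least subsetI)
  fix f assume "f \<in> {Poly_Mapping.single \<kappa> (1::'a) |\<kappa>. \<kappa> \<notin> \<Lambda>}"
  then show "f \<in> J"
    by (auto intro!: JI_keys)
next
  fix f assume "f \<in> {Poly_Mapping.single \<mu> (b \<nu>) - Poly_Mapping.single \<nu> (b \<mu>) |\<mu> \<nu>. \<mu> \<in> C \<and> \<nu> \<in> C}"
  then obtain \<mu> \<nu> where f: "f = Poly_Mapping.single \<mu> (b \<nu>) - Poly_Mapping.single \<nu> (b \<mu>)"
      "\<mu> \<in> C" "\<nu> \<in> C"
    by auto
  then show "f \<in> J"
    by (auto simp: J_def p_minus p_single lookup_minus lookup_single when_def mult.commute)
qed

text \<open>The normal form: non-corner coefficients are kept, and all corner terms are collected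
  into one multiple of x^\<mu>0. Its vanishing is what puts an element of \<open>J\<close> into the
  ideal.\<close>

definition red :: "(('k \<Rightarrow>\<^sub>0 nat) \<Rightarrow>\<^sub>0 'a) \<Rightarrow> ('k \<Rightarrow>\<^sub>0 nat) \<Rightarrow>\<^sub>0 'a"
  where "red f = (\<Sum>\<kappa>\<in>\<Lambda> - C. Poly_Mapping.single \<kappa> (Poly_Mapping.lookup f \<kappa>)) +
    Poly_Mapping.single \<mu>0 (p f / b \<mu>0)"

lemma red_add: "red (f + g) = red f + red g"
  by (simp add: red_def lookup_add p_add single_add sum.distrib add_divide_distrib)

lemma red_sum: "finite A \<Longrightarrow> red (sum g A) = (\<Sum>j\<in>A. red (g j))"
  by (induct A rule: finite_induct) (simp_all add: red_add, simp add: red_def p_def)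

lemma single_minus_red_in_I: "Poly_Mapping.single \<kappa> c - red (Poly_Mapping.single \<kappa> c) \<in> I"
proof -
  have lk: "(\<Sum>\<alpha>\<in>\<Lambda> - C. Poly_Mapping.single \<alpha> (Poly_Mapping.lookup (Poly_Mapping.single \<kappa> c) \<alpha>)) =
      (if \<kappa> \<in> \<Lambda> - C then Poly_Mapping.single \<kappa> c else 0)"
  proof -
    have "Poly_Mapping.single \<alpha> (Poly_Mapping.lookup (Poly_Mapping.single \<kappa> c) \<alpha>) =
        (if \<kappa> = \<alpha> then Poly_Mapping.single \<kappa> c else 0)" for \<alpha>
      by (simp add: lookup_single when_def)
    then show ?thesis
      using finite_\<Lambda> by (simp add: sum.delta')
  qed
  consider "\<kappa> \<in> \<Lambda> - C" | "\<kappa> \<in> C" | "\<kappa> \<notin> \<Lambda>"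
    by auto
  then show ?thesis
  proof cases
    case 1
    then show ?thesis
      by (simp add: red_def lk p_single I_zero)
  next
    case 2
    then have "Poly_Mapping.single \<kappa> (b \<mu>0) - Poly_Mapping.single \<mu>0 (b \<kappa>) \<in> I"
      using I_generators \<mu>0(1) by auto
    from I_mult[OF this, of "Poly_Mapping.single 0 (c / b \<mu>0)"] show ?thesis
      using 2 \<mu>0(2) by (simp add: red_def lk p_single right_diff_distrib mult_single mult.commute)
  next
    case 3
    then have "Poly_Mapping.single \<kappa> 1 \<in> I" "\<kappa> \<notin> C"
      using I_generators C_subset by auto
    from I_mult[OF this(1), of "Poly_Mapping.single 0 c"] this(2) 3 show ?thesis
      by (simp add: red_def lk p_single mult_single)
  qed
qed

lemma minus_red_in_I: "f - red f \<in> I"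
proof -
  let ?g = "\<lambda>\<kappa>. Poly_Mapping.single \<kappa> (Poly_Mapping.lookup f \<kappa>)"
  have "(\<Sum>\<kappa>\<in>A. ?g \<kappa> - red (?g \<kappa>)) \<in> I" if "finite A" for A
    using that by (induct A) (simp_all add: I_zero I_add single_minus_red_in_I)
  from this[of "Poly_Mapping.keys f"] show ?thesis
    by (simp add: sum_subtractf red_sum[symmetric] sum_single_lookup)
qed

lemma I_eq_J: "I = J"
proof
  show "J \<subseteq> I"
  proof
    fix f assume "f \<in> J"
    then have "red f = 0"
      by (simp add: J_def red_def)
    then show "f \<in> I"
      using minus_red_in_I[of f] by simp
  qed
qed (rule I_subset_J)

subsection \<open>The quotient\<close>

lemma q_eq_iff_I: "q f = q g \<longleftrightarrow> f - g \<in> I"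
  using R.quotient_eq_iff_same_a_r_cos[OF ideal_I, of f g]
  by (simp add: diagram_class_def R_simps a_minus_def a_inv_ring_of_type_algebra)

abbreviation Q where "Q \<equiv> R Quot I"

lemma cring_Q: "cring Q"
  by (rule ideal.quotient_is_cring[OF ideal_I cring_R])

lemma V_simps: "carrier V = carrier Q" "x \<oplus>\<^bsub>V\<^esub> y = x \<oplus>\<^bsub>Q\<^esub> y" "x \<otimes>\<^bsub>V\<^esub> y = x \<otimes>\<^bsub>Q\<^esub> y"
    "\<one>\<^bsub>V\<^esub> = \<one>\<^bsub>Q\<^esub>" "\<zero>\<^bsub>V\<^esub> = \<zero>\<^bsub>Q\<^esub>" "c \<odot>\<^bsub>V\<^esub> x = q (Poly_Mapping.single 0 c) \<otimes>\<^bsub>Q\<^esub> x"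
  by (simp_all add: diagram_algebra_def Let_def ring.defs module.defs)

lemma cring_V: "cring V"
proof -
  interpret Q: cring Q by (rule cring_Q)
  show ?thesis
  proof (rule cringI)
    show "abelian_group V"
    proof (rule abelian_groupI)
      show "\<exists>y\<in>carrier V. y \<oplus>\<^bsub>V\<^esub> x = \<zero>\<^bsub>V\<^esub>" if "x \<in> carrier V" for x
        using that Q.l_neg[of x] by (auto simp: V_simps intro: bexI[of _ "\<ominus>\<^bsub>Q\<^esub> x"])
      show "x \<oplus>\<^bsub>V\<^esub> y = y \<oplus>\<^bsub>V\<^esub> x" if "x \<in> carrier V" "y \<in> carrier V" for x y
        using that Q.a_comm by (simp add: V_simps)
    qed (auto simp: V_simps Q.a_assoc)
    show "Group.comm_monoid V"
    proof (rule comm_monoidI)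
      show "x \<otimes>\<^bsub>V\<^esub> y = y \<otimes>\<^bsub>V\<^esub> x" if "x \<in> carrier V" "y \<in> carrier V" for x y
        using that Q.m_comm by (simp add: V_simps)
    qed (auto simp: V_simps Q.m_assoc)
  qed (auto simp: V_simps Q.l_distr)
qed

lemma q_ring_hom: "q \<in> ring_hom R Q"
  using ideal.rcos_ring_hom[OF ideal_I] by (simp add: diagram_class_def[abs_def])

lemma q_add_Q: "q (f + g) = q f \<oplus>\<^bsub>Q\<^esub> q g" and q_mult_Q: "q (f * g) = q f \<otimes>\<^bsub>Q\<^esub> q g"
  and q_one_Q: "q 1 = \<one>\<^bsub>Q\<^esub>"
  using ring_hom_add[OF q_ring_hom, of f g] ring_hom_mult[OF q_ring_hom, of f g]
    ring_hom_one[OF q_ring_hom] by (simp_all add: R_simps)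

lemma q_zero_Q: "q 0 = \<zero>\<^bsub>Q\<^esub>"
proof -
  interpret Q: cring Q by (rule cring_Q)
  interpret h: ring_hom_ring R Q q
    by (rule ring_hom_ringI2[OF R.ring_axioms Q.ring_axioms q_ring_hom])
  show ?thesis
    using h.hom_zero by (simp add: R_simps)
qed

lemma carrier_V: "carrier V = range q"
  by (auto simp: V_simps FactRing_def A_RCOSETS_def' R_simps diagram_class_def)

lemma quot_linearI:
  assumes "\<And>f g. L (f + g) = L f + L g" and "\<And>c f. L (k c * f) = c * L f"
    and "\<And>f. f \<in> J \<Longrightarrow> L f = 0"
  shows "quot_linear q k L"
proof -
  have "L f = L g" if "q f = q g" for f g
  proof -
    have "L (f - g) = 0"
      using that by (intro assms(3)) (simp add: q_eq_iff_I I_eq_J)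
    then show ?thesis
      using assms(1)[of "f - g" g] by simp
  qed
  then show ?thesis
    unfolding quot_linear_def using assms(1,2) by blast
qed

lemma lookup_k: "Poly_Mapping.lookup (k c * f) \<kappa> = c * Poly_Mapping.lookup f \<kappa>"
  by (simp add: k_def lookup_single_0_mult)

lemma lookup_lin: "\<kappa> \<in> \<Lambda> - C \<Longrightarrow> quot_linear q k (\<lambda>f. Poly_Mapping.lookup f \<kappa>)"
  by (rule quot_linearI) (auto simp: lookup_add lookup_k J_def)

lemma p_lin: "quot_linear q k p"
  by (rule quot_linearI) (auto simp: p_add p_scale J_def)

lemma p_lin_scaled: "quot_linear q k (\<lambda>f. p f / c)"
  by (rule quot_linearI) (auto simp: p_add p_scale J_def add_divide_distrib)

lemma basis:
  "\<exists>B coord. finite B \<and> (\<forall>\<beta>\<in>B. quot_linear q k (coord \<beta>)) \<and>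
    (\<forall>f. q f = q (\<Sum>\<beta>\<in>B. k (coord \<beta> f) * \<beta>))"
proof -
  define h :: "('k \<Rightarrow>\<^sub>0 nat) \<Rightarrow> ('k \<Rightarrow>\<^sub>0 nat) \<Rightarrow>\<^sub>0 'a" where "h \<kappa> = Poly_Mapping.single \<kappa> 1" for \<kappa>
  define co where "co \<kappa> f = (if \<kappa> = \<mu>0 then p f / b \<mu>0 else Poly_Mapping.lookup f \<kappa>)" for \<kappa> f
  \<comment> \<open>Coordinates are indexed by the basis elements themselves, so the cell is read
    back from the monomial.\<close>
  define coord where "coord \<beta> = co (the_elem (Poly_Mapping.keys (\<beta> :: ('k \<Rightarrow>\<^sub>0 nat) \<Rightarrow>\<^sub>0 'a)))" for \<beta>
  let ?S = "insert \<mu>0 (\<Lambda> - C)"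
  have fin: "finite ?S" and notin: "\<mu>0 \<notin> \<Lambda> - C"
    using finite_\<Lambda> \<mu>0(1) by auto
  have "inj h"
    by (rule inj_on_inverseI[of _ "\<lambda>\<beta>. the_elem (Poly_Mapping.keys \<beta>)"]) (simp add: h_def)
  have ch: "coord (h \<kappa>) = co \<kappa>" for \<kappa>
    by (simp add: coord_def h_def)
  have "quot_linear q k (co \<kappa>)" if "\<kappa> \<in> ?S" for \<kappa>
    using that p_lin_scaled lookup_lin by (cases "\<kappa> = \<mu>0") (simp_all add: co_def[abs_def])
  then have "quot_linear q k (coord \<beta>)" if "\<beta> \<in> h ` ?S" for \<beta>
    using that ch by auto
  moreover have "q f = q (\<Sum>\<beta>\<in>h ` ?S. k (coord \<beta> f) * \<beta>)" for f
  proof -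
    have "(\<Sum>\<beta>\<in>h ` ?S. k (coord \<beta> f) * \<beta>) = (\<Sum>\<kappa>\<in>?S. Poly_Mapping.single \<kappa> (co \<kappa> f))"
      by (subst sum.reindex[OF inj_on_subset[OF \<open>inj h\<close> subset_UNIV]])
        (simp add: ch o_def, simp add: k_def h_def mult_single)
    also have "\<dots> = red f"
      using fin notin by (auto simp: red_def co_def add.commute intro!: sum.cong)
    finally show ?thesis
      by (simp add: q_eq_iff_I minus_red_in_I)
  qed
  ultimately show ?thesis
    using fin by (intro exI[of _ "h ` ?S"] exI[of _ coord]) auto
qed

sublocale presented_algebra V q k
proof (rule presented_algebra.intro)
  show "q (k c * f) = c \<odot>\<^bsub>V\<^esub> q f" for c f
    by (simp add: V_simps q_mult_Q k_def)
next
  show "\<exists>B coord. finite B \<and> (\<forall>\<beta>\<in>B. quot_linear q k (coord \<beta>)) \<and>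
      (\<forall>f. q f = q (\<Sum>\<beta>\<in>B. k (coord \<beta> f) * \<beta>))"
    by (rule basis)
qed (simp_all add: cring_V carrier_V V_simps q_add_Q q_mult_Q q_one_Q q_zero_Q k_def single_add mult_single)

subsection \<open>The hyperplane and the degree\<close>

lemma z0_lin: "quot_linear q k z0"
proof -
  have "0 \<in> \<Lambda> - C"
    using zero_in_\<Lambda> corner_size[of 0] by (auto simp: cell_size_def)
  then show ?thesis
    using lookup_lin[of 0] by (simp add: z0_def[abs_def])
qed

lemma z0_mult: "z0 (f * g) = z0 f * z0 g"
proof -
  define f' where "f' = f - k (z0 f)"
  define g' where "g' = g - k (z0 g)"
  have f': "0 \<notin> Poly_Mapping.keys f'"
    by (simp add: f'_def k_def z0_def in_keys_iff lookup_minus)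
  have "0 \<notin> Poly_Mapping.keys (f' * g)"
  proof
    assume "0 \<in> Poly_Mapping.keys (f' * g)"
    then have "0 \<in> {\<alpha> + \<beta> |\<alpha> \<beta>. \<alpha> \<in> Poly_Mapping.keys f' \<and> \<beta> \<in> Poly_Mapping.keys g}"
      using keys_mult[of f' g] by blast
    then obtain \<alpha> \<beta> where *: "\<alpha> \<in> Poly_Mapping.keys f'" "0 = \<alpha> + \<beta>"
      by blast
    then have "cell_size \<alpha> = 0"
      using cell_size_add[of \<alpha> \<beta>] by (simp flip: *(2)) (simp add: cell_size_def)
    then show False
      using * f' by (simp add: cell_size_eq_0_iff)
  qed
  moreover have "f * g = f' * g + k (z0 f) * g"
    by (simp add: f'_def algebra_simps)
  ultimately show ?thesis
    by (simp add: z0_def lookup_add lookup_k in_keys_iff)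
qed

lemma J_q: "f \<in> J \<Longrightarrow> q f = q 0"
  by (simp add: q_eq_iff_I I_eq_J)

lemma corner_le_d:
  assumes "\<mu> \<in> C" "b \<mu> \<noteq> 0"
  shows "cell_size \<mu> \<le> d"
  unfolding d_def by (rule Max_ge) (use assms finite_C in auto)

lemma d_attained:
  obtains \<mu> where "\<mu> \<in> C" "b \<mu> \<noteq> 0" "cell_size \<mu> = d"
proof -
  have "d \<in> cell_size ` {\<mu> \<in> C. b \<mu> \<noteq> 0}"
    unfolding d_def by (rule Max_in) (use \<mu>0 finite_C in auto)
  then show ?thesis
    using that by auto
qed

text \<open>A monomial is a product of variables, and repeated polarization trades the factors of a
  power for these variables one at a time; \<open>w\<close> collects those already split
  off.\<close>

lemma p_monomial_power:
  assumes "\<And>a. z0 a = 0 \<Longrightarrow> p (a ^ cell_size \<mu> * w) = 0"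
  shows "p (Poly_Mapping.single \<mu> 1 * w) = 0"
  using assms
proof (induct "cell_size \<mu>" arbitrary: \<mu> w)
  case 0
  then have "\<mu> = 0"
    by (simp add: cell_size_eq_0_iff)
  then show ?case
    using 0(2)[of 0] by (simp add: cell_size_def z0_def)
next
  case (Suc m)
  then have "\<mu> \<noteq> 0"
    by (auto simp: cell_size_def)
  then obtain j where j: "Poly_Mapping.lookup \<mu> j \<noteq> 0"
    by (auto simp: poly_mapping_eq_iff fun_eq_iff)
  let ?e = "Poly_Mapping.single j (1::nat)"
  have \<mu>: "\<mu> = (\<mu> - ?e) + ?e"
    by (rule poly_mapping_eqI) (use j in \<open>auto simp: lookup_add lookup_minus lookup_single when_def\<close>)
  then have m: "m = cell_size (\<mu> - ?e)"
    using cell_size_add[of "\<mu> - ?e" ?e] Suc(2) by (simp add: cell_size_single)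
  have "?e \<noteq> 0"
    by (simp add: poly_mapping_eq_iff fun_eq_iff lookup_single when_def)
  then have "z0 (Poly_Mapping.single ?e 1) = 0"
    by (simp add: z0_def lookup_single)
  then have "p (a ^ m * (Poly_Mapping.single ?e 1 * w)) = 0" if "z0 a = 0" for a
    using qlin_power_polarize[OF p_lin z0_lin _ that] Suc(3) by (simp flip: Suc(2) del: power_Suc)
  then have "p (Poly_Mapping.single (\<mu> - ?e) 1 * (Poly_Mapping.single ?e 1 * w)) = 0"
    using Suc(1)[OF m] m by simp
  then show ?case
    using \<mu> by (simp add: mult_single flip: mult.assoc)
qed

sublocale hpair V q k z0 p s d n
proof
  show "quot_linear q k z0" "quot_linear q k p"
    by (rule z0_lin, rule p_lin)
  show "z0 1 = 1"
    by (simp add: z0_def)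
  show "z0 (f * g) = z0 f * z0 g" for f g
    by (rule z0_mult)
  show "q (f ^ Suc n) = q 0" if "z0 f = 0" for f
  proof (rule J_q, rule JI_keys, rule ccontr)
    assume "Poly_Mapping.keys (f ^ Suc n) \<inter> \<Lambda> \<noteq> {}"
    then obtain \<kappa> where \<kappa>: "\<kappa> \<in> Poly_Mapping.keys (f ^ Suc n)" "\<kappa> \<in> \<Lambda>"
      by blast
    have "Suc n \<le> cell_size \<kappa>"
      using keys_power_size[OF _ \<kappa>(1)] that by (simp add: z0_def)
    moreover have "cell_size \<kappa> \<le> n"
      unfolding n_def by (rule Max_ge) (use finite_\<Lambda> \<kappa>(2) in auto)
    ultimately show False by simp
  qed
  show "p (f ^ m) = 0" if "z0 f = 0" "d < m" for f m
  proof (rule p_eq_0I)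
    fix \<mu> assume "\<mu> \<in> C" "b \<mu> \<noteq> 0"
    then have "cell_size \<mu> < m"
      using corner_le_d that(2) by fastforce
    then show "\<mu> \<notin> Poly_Mapping.keys (f ^ m)"
      using keys_power_size[of f \<mu> m] that(1) by (auto simp: z0_def)
  qed
  show "\<exists>f. z0 f = 0 \<and> p (f ^ d) \<noteq> 0"
  proof (rule ccontr)
    \<comment> \<open>Otherwise polarization would kill x^\<mu> for a corner of size
      \<open>d\<close>, whose image under \<open>p\<close> is \<open>b \<mu>\<close>.\<close>
    assume *: "\<not> ?thesis"
    obtain \<mu> where \<mu>: "\<mu> \<in> C" "b \<mu> \<noteq> 0" "cell_size \<mu> = d"
      by (rule d_attained)
    have "p (Poly_Mapping.single \<mu> 1 * 1) = 0"
      by (rule p_monomial_power) (use * \<mu>(3) in auto)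
    then show False
      using \<mu>(1,2) by (simp add: p_single)
  qed
  show "2 \<le> d"
    using d_attained corner_size by metis
  have "\<mu>0 \<noteq> 0"
    using corner_size[OF \<mu>0(1)] by (auto simp: cell_size_def)
  then show "z0 s = 0"
    by (simp add: z0_def s_def lookup_single)
  show "p s = 1"
    using \<mu>0 by (simp add: s_def p_single)
  show "q (f * s) = q 0" if "z0 f = 0" for f
  proof (rule J_q, rule JI_keys, rule ccontr)
    assume "Poly_Mapping.keys (f * s) \<inter> \<Lambda> \<noteq> {}"
    then obtain \<alpha> where "\<alpha> \<in> Poly_Mapping.keys f" "\<alpha> + \<mu>0 \<in> \<Lambda>"
      using keys_mult[of f s] by (auto simp: s_def split: if_splits)
    then show False
      using corner_plus_notin[OF \<mu>0(1), of \<alpha>] that by (auto simp: z0_def in_keys_iff)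
  qed
qed

lemma hyperplane_eq: "diagram_hyperplane \<Lambda> b = U"
proof -
  let ?S = "\<Lambda> - (C \<union> {0})"
  define h where "h \<kappa> = q (Poly_Mapping.single \<kappa> 1)" for \<kappa>
  have span: "diagram_hyperplane \<Lambda> b = linear_span V (h ` ?S)"
    unfolding diagram_hyperplane_def h_def by (rule arg_cong[where f = "linear_span V"]) blast
  \<comment> \<open>A span sums over a set of vectors, so passing to sums over cells needs distinct
    cells to have distinct classes.\<close>
  have inj: "inj_on h ?S"
  proof (rule inj_onI)
    fix \<kappa> \<kappa>' assume *: "\<kappa> \<in> ?S" "\<kappa>' \<in> ?S" "h \<kappa> = h \<kappa>'"
    have "Poly_Mapping.lookup (Poly_Mapping.single \<kappa> (1::'a)) \<kappa> = Poly_Mapping.lookup (Poly_Mapping.single \<kappa>' 1) \<kappa>"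
      using qlin_cong[OF lookup_lin *(3)[unfolded h_def], of \<kappa>] *(1) by simp
    then show "\<kappa> = \<kappa>'"
      by (auto simp: lookup_single when_def split: if_splits)
  qed
  have "(\<Oplus>\<^bsub>V\<^esub>v\<in>F. c v \<odot>\<^bsub>V\<^esub> v) \<in> U" if F: "finite F" "F \<subseteq> h ` ?S" for c F
  proof -
    obtain A where A: "A \<subseteq> ?S" "F = h ` A"
      using F(2) by (auto simp: subset_image_iff)
    have injA: "inj_on h A"
      using inj A(1) by (rule inj_on_subset)
    then have "finite A"
      using F(1) A(2) finite_imageD by blast
    define f where "f = (\<Sum>\<kappa>\<in>A. k (c (h \<kappa>)) * Poly_Mapping.single \<kappa> 1)"
    have "(\<Oplus>\<^bsub>V\<^esub>v\<in>F. c v \<odot>\<^bsub>V\<^esub> v) = (\<Oplus>\<^bsub>V\<^esub>\<kappa>\<in>A. c (h \<kappa>) \<odot>\<^bsub>V\<^esub> h \<kappa>)"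
      unfolding A(2) by (rule V.finsum_reindex[OF _ injA]) (auto simp: h_def simp flip: q_smult)
    also have "\<dots> = q f"
      unfolding f_def h_def q_smult[symmetric] by (rule q_sum[OF \<open>finite A\<close>, symmetric])
    finally have e: "(\<Oplus>\<^bsub>V\<^esub>v\<in>F. c v \<odot>\<^bsub>V\<^esub> v) = q f" .
    have "z0 (Poly_Mapping.single \<kappa> 1) = 0" "p (Poly_Mapping.single \<kappa> 1) = 0" if "\<kappa> \<in> A" for \<kappa>
      using that A(1) by (auto simp: z0_def p_single lookup_single when_def)
    then have "z0 f = 0" "p f = 0"
      by (simp_all add: f_def qlin_sum[OF z0_lin] qlin_sum[OF p_lin] z0_simps p_simps)
    then show ?thesis
      unfolding e U_def by blast
  qed
  then have "linear_span V (h ` ?S) \<subseteq> U"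
    unfolding linear_span_def by blast
  moreover have "U \<subseteq> linear_span V (h ` ?S)"
  proof
    fix v assume "v \<in> U"
    then obtain f where f: "v = q f" "z0 f = 0" "p f = 0"
      by (auto simp: U_def)
    define c where "c = (\<lambda>v. Poly_Mapping.lookup f (inv_into ?S h v))"
    have "red f = (\<Sum>\<kappa>\<in>?S. Poly_Mapping.single \<kappa> (Poly_Mapping.lookup f \<kappa>))"
      unfolding red_def f(3) using f(2) finite_\<Lambda>
      by (auto simp: z0_def intro!: sum.mono_neutral_right)
    also have "\<dots> = (\<Sum>\<kappa>\<in>?S. k (c (h \<kappa>)) * Poly_Mapping.single \<kappa> 1)"
      by (rule sum.cong) (simp_all only: c_def inv_into_f_f[OF inj], simp_all add: k_def mult_single)
    finally have "v = q (\<Sum>\<kappa>\<in>?S. k (c (h \<kappa>)) * Poly_Mapping.single \<kappa> 1)"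
      using minus_red_in_I[of f] by (simp add: f(1) q_eq_iff_I)
    also have "\<dots> = (\<Oplus>\<^bsub>V\<^esub>\<kappa>\<in>?S. c (h \<kappa>) \<odot>\<^bsub>V\<^esub> h \<kappa>)"
      unfolding h_def q_smult[symmetric] by (rule q_sum) (use finite_\<Lambda> in auto)
    also have "\<dots> = (\<Oplus>\<^bsub>V\<^esub>v\<in>h ` ?S. c v \<odot>\<^bsub>V\<^esub> v)"
      by (rule V.finsum_reindex[OF _ inj, symmetric]) (auto simp: h_def simp flip: q_smult)
    finally show "v \<in> linear_span V (h ` ?S)"
      unfolding linear_span_def using finite_\<Lambda> by blast
  qed
  ultimately show ?thesis
    unfolding span by blast
qed

lemma degree_eq: "hypersurface_degree V (hpair_hypersurface V (diagram_hyperplane \<Lambda> b)) = d"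
  using hypersurface_degree_eq by (simp add: hyperplane_eq Y_def)

text \<open>A product of monomials other than 1 and \<open>x\<^sub>i\<close> that is a multiple of a corner has too small an
  exponent of \<open>x\<^sub>i\<close> to reach the corners of size \<open>d\<close> and \<open>d - 1\<close>.\<close>

lemma not_normal:
  assumes top: "\<And>\<mu>. \<mu> \<in> C \<Longrightarrow> cell_size \<mu> = d \<Longrightarrow> 3 \<le> Poly_Mapping.lookup \<mu> i"
    and sub: "\<And>\<mu>. \<mu> \<in> C \<Longrightarrow> cell_size \<mu> + 1 = d \<Longrightarrow> 1 \<le> Poly_Mapping.lookup \<mu> i"
  shows "\<not> normal_variety V Y"
proof -
  define e where "e = Poly_Mapping.single i (1::nat)"
  define zi where "zi f = Poly_Mapping.lookup f e" for f :: "('k \<Rightarrow>\<^sub>0 nat) \<Rightarrow>\<^sub>0 'a"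
  define x where "x = Poly_Mapping.single e (1::'a)"
  have size_e: "cell_size e = 1"
    by (simp add: e_def cell_size_single)
  have e: "e \<in> \<Lambda> - C" "e \<noteq> 0" "e \<noteq> \<mu>0"
    using single_in_\<Lambda>[of i] corner_size[of e] corner_size[OF \<mu>0(1)] size_e cell_size_eq_0_iff[of e]
    by (auto simp: e_def)
  have weight: "Poly_Mapping.lookup \<mu> i + 2 * m \<le> 2 * cell_size \<mu>"
    if "z0 f = 0" "zi f = 0" "\<mu> \<in> Poly_Mapping.keys (f ^ m)" for f \<mu> m
    using keys_power_weight[of f i \<mu> m] that by (simp add: z0_def zi_def e_def)
  interpret singular_hpair V q k z0 p s d n zi x
  proof
    show "quot_linear q k zi"
      using lookup_lin[OF e(1)] by (simp add: zi_def[abs_def])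
    show "zi 1 = 0" "zi x = 1" "z0 x = 0" "zi s = 0"
      using e(2,3) by (simp_all add: zi_def x_def z0_def s_def lookup_one lookup_single when_def)
  next
    fix f assume f: "z0 f = 0" "zi f = 0"
    show "p (f ^ d) = 0"
    proof (rule p_eq_0I, rule notI)
      fix \<mu> assume \<mu>: "\<mu> \<in> C" "b \<mu> \<noteq> 0" "\<mu> \<in> Poly_Mapping.keys (f ^ d)"
      \<comment> \<open>The weight forces size \<open>d\<close> and i-th coordinate 0.\<close>
      show False
        using weight[OF f \<mu>(3)] corner_le_d[OF \<mu>(1,2)] top[OF \<mu>(1)] by linarith
    qed
    show "p (f ^ (d - 1)) = 0"
    proof (rule p_eq_0I, rule notI)
      fix \<mu> assume \<mu>: "\<mu> \<in> C" "b \<mu> \<noteq> 0" "\<mu> \<in> Poly_Mapping.keys (f ^ (d - 1))"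
      \<comment> \<open>With d - 1 factors, a corner of size \<open>d\<close> may contain one factor
        x_i^2, so its i-th coordinate is at most 2: this is the source of the bound 3. A corner of
        size d - 1 has i-th coordinate 0, which the second condition excludes.\<close>
      show False
        using weight[OF f \<mu>(3)] corner_le_d[OF \<mu>(1,2)] top[OF \<mu>(1)] sub[OF \<mu>(1)] d_ge_2 by linarith
    qed
    show "p (f ^ (d - 1) * x) = 0"
    proof (rule p_eq_0I, rule notI)
      fix \<mu> assume \<mu>: "\<mu> \<in> C" "b \<mu> \<noteq> 0" "\<mu> \<in> Poly_Mapping.keys (f ^ (d - 1) * x)"
      then obtain \<alpha> where \<alpha>: "\<alpha> \<in> Poly_Mapping.keys (f ^ (d - 1))" "\<mu> = \<alpha> + e"
        using keys_mult[of "f ^ (d - 1)" x] by (auto simp: x_def)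
      have "Poly_Mapping.lookup \<mu> i = Poly_Mapping.lookup \<alpha> i + 1" "cell_size \<mu> = cell_size \<alpha> + 1"
        by (simp_all add: \<alpha>(2) e_def lookup_add cell_size_add cell_size_single)
      \<comment> \<open>The extra factor x_i raises the coordinate to at most 1, and again the size
        must be \<open>d\<close>.\<close>
      then show False
        using weight[OF f \<alpha>(1)] corner_le_d[OF \<mu>(1,2)] top[OF \<mu>(1)] d_ge_2 by linarith
    qed
  qed
  show ?thesis
    by (rule not_normal)
qed

end

theorem proposition7:
  fixes \<Lambda> :: "('k::finite \<Rightarrow>\<^sub>0 nat) set"
    and b :: "('k \<Rightarrow>\<^sub>0 nat) \<Rightarrow> 'a::{alg_closed_field, field_char_0}"
    and A :: "('a, (('k \<Rightarrow>\<^sub>0 nat) \<Rightarrow>\<^sub>0 'a) set) module"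
    and U :: "(('k \<Rightarrow>\<^sub>0 nat) \<Rightarrow>\<^sub>0 'a) set set"
    and Y :: "(('k \<Rightarrow>\<^sub>0 nat) \<Rightarrow>\<^sub>0 'a) set set set"
    and d :: nat
    and i :: 'k
  assumes "young_diagram \<Lambda>"
    and "non_exceptional \<Lambda>"
    and "\<exists>\<mu>\<in>corner_cells \<Lambda>. b \<mu> \<noteq> 0"
    and "A = diagram_algebra \<Lambda> b"
    and "U = diagram_hyperplane \<Lambda> b"
    and "Y = hpair_hypersurface A U"
    and "d = hypersurface_degree A Y"
    and "\<forall>\<mu>\<in>corner_cells \<Lambda>. cell_size \<mu> = d \<longrightarrow> Poly_Mapping.lookup \<mu> i \<ge> 3"
    and "\<forall>\<mu>\<in>corner_cells \<Lambda>. cell_size \<mu> + 1 = d \<longrightarrow> Poly_Mapping.lookup \<mu> i \<ge> 1"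
  shows "\<not> normal_variety A Y"
proof -
  obtain \<mu>0 where "\<mu>0 \<in> corner_cells \<Lambda>" "b \<mu>0 \<noteq> 0"
    using assms(3) by blast
  then interpret D: diagram \<Lambda> b \<mu>0
    using assms(1,2) by unfold_locales
  have Y: "Y = D.Y"
    by (simp add: assms(4-6) D.Y_def D.hyperplane_eq)
  have "d = D.d"
    using assms(4-7) D.degree_eq by simp
  then show ?thesis
    unfolding assms(4) Y using assms(8,9) by (intro D.not_normal[of i]) auto
qed

end
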